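(* Let $c_1,c_2,\beta_1,\beta_2>0$ and let $V\in L^\infty_{loc}(\mathbb{R})$ be a real-valued potential satisfying $$c_1(|x|+1)^{\beta_1}\le V(x)\le c_2(|x|+1)^{\beta_2}\qquad\text{for all }x\in\mathbb{R}.$$ Let $H=-\partial_x^2+V(x)$. Let $s\in\mathbb{R}$, $\tau\ge0$, and let $\omega\subset\mathbb{R}$ be an $(s,\tau)$-thick set with constants $\gamma\in(0,\frac12)$ and $D>0$. Then there is a constant $C>0$, independent of $\lambda$ and $\phi$, such that the following hold for every $\lambda>0$. (i) If $\frac{\beta_1-\beta_2}{2}\le s<1$, then $$\|\phi\|_{L^2(\mathbb{R})}\le e^{C\lambda^{\frac{\tau}{\beta_1}+\frac{s}{\beta_1}+\frac{\beta_2}{2\beta_1}}}\|\phi\|_{L^2(\omega)}\qquad\text{for all }\phi\in Ran(P_\lambda(H)).$$ (ii) The inequality in (i) also holds for $s=1$, $\tau=0$. (iii) If $s<\frac{\beta_1-\beta_2}{2}$, then $$\|\phi\|_{L^2(\mathbb{R})}\le e^{C\lambda^{\frac{\tau}{\beta_1}+\frac12}}\|\phi\|_{L^2(\omega)}\qquad\text{for all }\phi\in Ran(P_\lambda(H)).$$ In these cases one can choose $C=C_0|\log\gamma|$, where $C_0$ depends only on $\beta_1,\beta_2,c_1,c_2,s$ and $D$.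
   Context: $|S|$ denotes the Lebesgue measure of $S\subset\mathbb{R}$, $\langle x\rangle=(1+|x|^2)^{1/2}$, and $I_r(x)=[x-r,x+r]$. For $s\in\mathbb{R}$ and $\tau\ge0$, a measurable set $\omega\subset\mathbb{R}$ is called $(s,\tau)$-thick (with constants $\gamma$ and $D$) if there exist $\gamma\in(0,\frac12)$ and $D>0$ such that $$|\omega\cap I_{D\langle x\rangle^s}(x)|\ge\gamma^{\langle x\rangle^\tau}\,|I_{D\langle x\rangle^s}(x)|\qquad\text{for all }x\in\mathbb{R}.$$ Since $V(x)\to+\infty$ as $|x|\to\infty$, the operator $H=-\partial_x^2+V$ on $L^2(\mathbb{R})$ has discrete spectrum, with eigenvalues $\lambda_0\le\lambda_1\le\dots\to\infty$ (counted with multiplicity) and eigenfunctions $\phi_k$ forming an orthonormal basis of $L^2(\mathbb{R})$. $Ran(P_\lambda(H))$ denotes the linear span of the eigenfunctions $\phi_k$ with $\lambda_k\le\lambda$.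
   Formalization: The claim that C = C₀|log γ| with C₀ independent of τ is false for small λ (let τ→∞ with λ₀<1); it is proved for λ ≥ 1, while for every λ > 0 the constant is C₁|log γ| with C₁ depending also on τ. *)

theory Defs
  imports "HOL-Analysis.Analysis"
begin

definition japanese_bracket :: "real \<Rightarrow> real"
  where "japanese_bracket x = sqrt (1 + \<bar>x\<bar>\<^sup>2)"

definition thick :: "real \<Rightarrow> real \<Rightarrow> real \<Rightarrow> real \<Rightarrow> real set \<Rightarrow> bool"
  where "thick s \<tau> \<gamma> D \<omega> \<longleftrightarrow>
    \<omega> \<in> sets lebesgue \<and> 0 < \<gamma> \<and> \<gamma> < 1/2 \<and> 0 < D \<and>
    (\<forall>x. let r = D * japanese_bracket x powr s; I = {x - r..x + r} in
      measure lebesgue (\<omega> \<inter> I) \<ge> \<gamma> powr (japanese_bracket x powr \<tau>) * measure lebesgue I)"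

definition Linf_loc :: "(real \<Rightarrow> real) set"
  where "Linf_loc = {V. V \<in> borel_measurable lebesgue \<and>
    (\<forall>R. \<exists>M. AE x in lebesgue. \<bar>x\<bar> \<le> R \<longrightarrow> \<bar>V x\<bar> \<le> M)}"

definition L2 :: "(real \<Rightarrow> complex) set"
  where "L2 = {f. f \<in> borel_measurable lebesgue \<and> integrable lebesgue (\<lambda>x. (cmod (f x))\<^sup>2)}"

definition L2_norm :: "real set \<Rightarrow> (real \<Rightarrow> complex) \<Rightarrow> real"
  where "L2_norm A f = sqrt (LINT x:A|lebesgue. (cmod (f x))\<^sup>2)"

text \<open>
  The graph of \<open>-d\<^sup>2/dx\<^sup>2 + V\<close> on the maximal domain: all \<open>f\<close> in \<open>L2\<close> that agree almost everywhere
  with a \<open>C\<^sup>1\<close> function \<open>u\<close> whose derivative \<open>u'\<close> is locally absolutely continuous (that is, an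
  indefinite integral of a locally integrable \<open>u''\<close>) and for which \<open>-u'' + V u\<close> is again in \<open>L2\<close>.
  If \<open>V\<close> is locally bounded and bounded below, both endpoints are in the limit point case, so this
  is the only self-adjoint realisation and agrees with the form (Friedrichs) operator.
  Elements of \<open>L2\<close> are represented by functions, and both components of the graph are closed under
  equality almost everywhere.
\<close>
definition schroedinger :: "(real \<Rightarrow> real) \<Rightarrow> ((real \<Rightarrow> complex) \<times> (real \<Rightarrow> complex)) set"
  where "schroedinger V = {(f, g). f \<in> L2 \<and> g \<in> L2 \<and>
    (\<exists>u u' u''.
      (AE x in lebesgue. f x = u x) \<and>
      (\<forall>x. (u has_vector_derivative u' x) (at x)) \<and>
      (\<forall>a b. a \<le> b \<longrightarrow>
        u'' absolutely_integrable_on {a..b} \<and> (u'' has_integral (u' b - u' a)) {a..b}) \<and>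
      (AE x in lebesgue. g x = - u'' x + complex_of_real (V x) * u x))}"

definition eigenfunction ::
    "((real \<Rightarrow> complex) \<times> (real \<Rightarrow> complex)) set \<Rightarrow> real \<Rightarrow> (real \<Rightarrow> complex) \<Rightarrow> bool"
  where "eigenfunction H \<mu> f \<longleftrightarrow>
    (f, \<lambda>x. complex_of_real \<mu> * f x) \<in> H \<and> \<not> (AE x in lebesgue. f x = 0)"

text \<open>
  The complex linear span of the eigenfunctions with eigenvalue at most \<open>l\<close>, up to equality almost
  everywhere. Letting all eigenfunctions of \<open>H\<close> generate the span avoids choosing an orthonormal
  basis of eigenfunctions; every such choice has the same span.
\<close>
definition Ran_P :: "((real \<Rightarrow> complex) \<times> (real \<Rightarrow> complex)) set \<Rightarrow> real \<Rightarrow> (real \<Rightarrow> complex) set"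
  where "Ran_P H l = {f. \<exists>(n::nat) c \<mu> e.
    (\<forall>k<n. \<mu> k \<le> l \<and> eigenfunction H (\<mu> k) (e k)) \<and>
    (AE x in lebesgue. f x = (\<Sum>k<n. c k * e k x))}"

end

theory Submission imports Defs "HOL-Complex_Analysis.Cauchy_Integral_Formula" begin

text \<open>
  For a real combination \<open>\<phi> = \<Sum> \<psi>\<^sub>k\<close> of eigenfunctions, \<open>\<Phi>(x, t) = \<Sum> \<psi>\<^sub>k(x) cosh(\<surd>\<lambda>\<^sub>k t)\<close> solves
  \<open>\<Delta>\<Phi> = V \<Phi>\<close>. Since \<open>V \<ge> 0\<close>, the Riccati equation \<open>a' + a\<^sup>2 = V\<close> has a solution with
  \<open>0 \<le> a \<le> \<surd>(sup V)\<close>, and \<open>\<Phi>\<close> is the real part of a function \<open>f\<close> with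
  \<open>f\<^sub>x + i f\<^sub>t = a \<cdot> cnj f\<close> and \<open>f(x, 0) = \<phi>(x)\<close>. By the similarity principle \<open>f = e\<^sup>s F\<close> on a disc of radius \<open>\<rho>\<close>,
  with \<open>F\<close> holomorphic and \<open>\<bar>s\<bar> \<le> C \<rho> \<surd>(sup V)\<close>: this linear dependence on \<open>\<rho> \<surd>(sup V)\<close> produces the sharp exponent.
  Lagrange interpolation of \<open>F\<close> at nodes in \<open>\<omega>\<close>, with Hermite's remainder, then bounds \<open>\<phi>\<close> at the centre of the disc.
  The disc is placed at a maximum of \<open>\<bar>\<phi>\<bar>\<close> over \<open>\<bar>x\<bar> \<le> C \<lambda>\<^bsup>1/\<beta>1\<^esup>\<close>, where \<open>\<phi>\<close> has half of its mass, so that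
  one interval is enough. In case (iii) the same argument applies, because \<open>\<beta>1 \<le> \<beta>2\<close> forces \<open>s < 0\<close>.
\<close>

section \<open>Lagrange interpolation at separated nodes\<close>

text \<open>The exponent in l is the sum of two rates. On a window of radius r about the maximum
  point, the logarithmic growth of \<open>f\<close> is at most of order T, where T dominates r sqrt
  l (from \<open>cosh\<close>), r sqrt(sup V) (from the similarity factor) and the logarithms of all
  polynomial quantities. Hermite's remainder gains a factor 4 per node, so about T nodes beat this
  growth. Interpolating from nodes in a set of relative density \<theta> costs a fixed power of
  1/\<theta> per node, so the total is exp(C T |ln \<theta>|). With r = D Y^s, Y the bracket of the
  centre (at most of order l^(1/\<beta>1)) and \<theta> = \<gamma>^(Y^\<tau>), T is of order
  l^max(1/2, (s + \<beta>2/2)/\<beta>1) and |ln \<theta>| at most of order |ln \<gamma>|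
  l^(\<tau>/\<beta>1). Polynomial factors in l disappear because the first exponent is at least 1/2.
  The shape of the proof is dictated by the low regularity of V, which is merely measurable and
  locally bounded: second derivatives of eigenfunctions exist only in integrated form. The
  first-order system for \<open>f\<close> has continuous coefficients, so \<open>f\<close> is
  continuously differentiable and Cauchy's formula can be used.\<close>

lemma partial_fractions_distinct_roots:
  fixes W :: "'a::field set"
  assumes "finite W" "W \<noteq> {}" "z \<notin> W"
  shows "(\<Sum>w\<in>W. 1 / ((z - w) * (\<Prod>u\<in>W - {w}. w - u))) = 1 / (\<Prod>w\<in>W. z - w)"
  using assms
proof (induction W arbitrary: z rule: finite_ne_induct)
  case (singleton x)
  then show ?case by simp
next
  case (insert v W)
  have zv: "z \<noteq> v" "z \<notin> W" using insert by auto
  define c where "c w = (\<Prod>u\<in>W - {w}. w - u)" for w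
  have IH: "(\<Sum>w\<in>W. 1 / ((y - w) * c w)) = 1 / (\<Prod>w\<in>W. y - w)" if "y \<notin> W" for y
    using insert.IH[of y] that unfolding c_def by simp
  \<comment> \<open>1/((z - w)(w - v)) is a difference of simple fractions over
    \<open>z - v\<close>; this is why the hypothesis is needed at \<open>z\<close> and at the new
    root \<open>v\<close>.\<close>
  have eq: "1 / ((z - w) * (\<Prod>u\<in>insert v W - {w}. w - u))
      = (1 / ((z - w) * c w) - 1 / ((v - w) * c w)) / (z - v)" if w: "w \<in> W" for w
  proof -
    have "insert v W - {w} = insert v (W - {w})" using w insert.hyps by auto
    hence "(\<Prod>u\<in>insert v W - {w}. w - u) = (w - v) * c w"
      using insert.hyps unfolding c_def by simp
    moreover have "w \<noteq> v" "z \<noteq> w" using w insert by auto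
    moreover have "c w \<noteq> 0" unfolding c_def using insert.hyps by auto
    moreover have "1 / ((z - w) * c w) - 1 / ((v - w) * c w) = (z - v) / ((z - w) * ((w - v) * c w))"
      using calculation by (simp add: divide_simps) (simp add: algebra_simps)
    ultimately show ?thesis using zv by simp
  qed
  have "(\<Sum>w\<in>insert v W. 1 / ((z - w) * (\<Prod>u\<in>insert v W - {w}. w - u)))
     = 1 / ((z - v) * (\<Prod>u\<in>W. v - u)) + (\<Sum>w\<in>W. (1 / ((z - w) * c w) - 1 / ((v - w) * c w)) / (z - v))"
    using insert.hyps eq by (simp add: insert_Diff_if)
  also have "(\<Sum>w\<in>W. (1 / ((z - w) * c w) - 1 / ((v - w) * c w)) / (z - v))
     = (1 / (\<Prod>w\<in>W. z - w) - 1 / (\<Prod>w\<in>W. v - w)) / (z - v)"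
    using IH[OF zv(2)] IH[of v] insert.hyps by (simp add: sum_divide_distrib[symmetric] sum_subtractf)
  also have "1 / ((z - v) * (\<Prod>u\<in>W. v - u)) + (1 / (\<Prod>w\<in>W. z - w) - 1 / (\<Prod>w\<in>W. v - w)) / (z - v)
     = 1 / (\<Prod>w\<in>insert v W. z - w)"
    using insert.hyps by (simp add: diff_divide_distrib mult.commute)
  finally show ?case .
qed

text \<open>The distribution function \<open>M\<close> of \<open>E\<close> is 1-Lipschitz and rises
  from 0 to |E|. The interval [0, m] of its values is cut into 2N equal levels and a node is taken
  from every second one; the skipped levels force the gaps, since \<open>p j - q i\<close> is 2(j -
  i) - 1 \<ge> j - i levels for i < j.\<close>

lemma obtain_separated_nodes:
  fixes E :: "real set"
  assumes E: "E \<in> sets lebesgue" "E \<subseteq> {a..b}" and m: "0 < m" "m \<le> measure lebesgue E" and N: "0 < N"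
  obtains x :: "nat \<Rightarrow> real" where "\<And>j. j < N \<Longrightarrow> x j \<in> E"
    "\<And>i j. i < N \<Longrightarrow> j < N \<Longrightarrow> \<bar>real i - real j\<bar> * m / (2 * real N) \<le> \<bar>x i - x j\<bar>"
proof -
  define M where "M x = measure lebesgue (E \<inter> {..x})" for x
  define \<mu> where "\<mu> = measure lebesgue E"
  have fmE: "E \<in> lmeasurable" using E by (meson bounded_closed_interval bounded_set_imp_lmeasurable bounded_subset)
  have fm: "E \<inter> S \<in> lmeasurable" if "S \<in> sets lebesgue" for S
    using fmE that by (simp add: fmeasurable_Int_fmeasurable)
  have Mdiff: "M y - M x = measure lebesgue (E \<inter> {x<..y})" if "x \<le> y" for x y
  proof -
    have "E \<inter> {..y} = (E \<inter> {..x}) \<union> (E \<inter> {x<..y})" using that by auto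
    moreover have "E \<inter> {x<..y} - E \<inter> {..x} = E \<inter> {x<..y}" by auto
    ultimately show ?thesis unfolding M_def
      using measure_Un2[of "E \<inter> {..x}" lebesgue "E \<inter> {x<..y}"] fm by simp
  qed
  have mono: "M x \<le> M y" if "x \<le> y" for x y
    using Mdiff[OF that] measure_nonneg[of lebesgue "E \<inter> {x<..y}"] by linarith
  have lip: "M y - M x \<le> y - x" if "x \<le> y" for x y
  proof -
    have "measure lebesgue (E \<inter> {x<..y}) \<le> measure lebesgue {x..y}"
      by (rule measure_mono_fmeasurable) (use E in auto)
    thus ?thesis using Mdiff[OF that] that by simp
  qed
  have lip2: "\<bar>M y - M x\<bar> \<le> \<bar>y - x\<bar>" for x y
    using lip[of x y] lip[of y x] mono[of x y] mono[of y x] by linarith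
  have cont: "continuous_on S M" for S
    unfolding continuous_on_iff dist_real_def
    by (metis lip2 le_less_trans)
  define p where "p j = (2 * real j) * m / (2 * real N)" for j
  define q where "q j = (2 * real j + 1) * m / (2 * real N)" for j
  have "E \<inter> {..a - 1} = {}" using E(2) by fastforce
  hence Ma: "M (a - 1) = 0" unfolding M_def by simp
  have Mb: "M (max a b) = \<mu>" unfolding M_def \<mu>_def
  proof -
    have "E \<inter> {..max a b} = E" using E(2) by auto
    thus "measure lebesgue (E \<inter> {..max a b}) = measure lebesgue E" by simp
  qed
  have ex: "\<exists>y. M y = t" if "0 \<le> t" "t \<le> \<mu>" for t
  proof -
    have "a - 1 \<le> max a b" by linarith
    thus ?thesis using IVT'[of M "a-1" t "max a b"] Ma Mb that cont by auto
  qed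
  have pick: "\<exists>y\<in>E. p j \<le> M y \<and> M y \<le> q j" if j: "j < N" for j
  proof -
    have "2 * real j + 1 \<le> 2 * real N" using j by linarith
    hence "q j \<le> 2 * real N * m / (2 * real N)" unfolding q_def using m N by (intro divide_right_mono mult_right_mono) auto
    hence qm: "q j \<le> \<mu>" using m N unfolding \<mu>_def by simp
    have pq: "p j < q j" "0 \<le> p j" unfolding p_def q_def using m N by (auto simp: field_simps)
    obtain y1 where y1: "M y1 = p j" using ex[of "p j"] pq qm by auto
    obtain y2 where y2: "M y2 = q j" using ex[of "q j"] pq qm by auto
    have le: "y1 \<le> y2" using mono[of y2 y1] y1 y2 pq by linarith
    \<comment> \<open>A preimage of a level under \<open>M\<close> may lie outside \<open>E\<close>;
      positive measure supplies a point of \<open>E\<close> itself.\<close>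
    have "measure lebesgue (E \<inter> {y1<..y2}) > 0" using Mdiff[OF le] y1 y2 pq by linarith
    then obtain y where "y \<in> E \<inter> {y1<..y2}" by (metis all_not_in_conv less_irrefl measure_empty)
    thus ?thesis using mono[of y1 y] mono[of y y2] y1 y2 by (intro bexI[of _ y]) auto
  qed
  then obtain x where x: "\<And>j. j < N \<Longrightarrow> x j \<in> E \<and> p j \<le> M (x j) \<and> M (x j) \<le> q j" by metis
  have gap: "(real j - real i) * m / (2 * real N) \<le> \<bar>x i - x j\<bar>" if ij: "i < N" "j < N" "i < j" for i j
  proof -
    have "(real j - real i) * m / (2 * real N) \<le> p j - q i"
      unfolding p_def q_def diff_divide_distrib[symmetric] left_diff_distrib[symmetric]
      using ij m N by (intro divide_right_mono mult_right_mono) auto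
    also have "\<dots> \<le> M (x j) - M (x i)" using x[OF ij(1)] x[OF ij(2)] by linarith
    also have "\<dots> \<le> \<bar>x i - x j\<bar>" using lip2[of "x j" "x i"] by linarith
    finally show ?thesis .
  qed
  have "\<bar>real i - real j\<bar> * m / (2 * real N) \<le> \<bar>x i - x j\<bar>" if "i < N" "j < N" for i j
    using gap[of i j] gap[of j i] that by (cases i j rule: linorder_cases) (auto simp: abs_minus_commute)
  with x that show ?thesis by blast
qed

section \<open>Continuously differentiable functions of a complex variable\<close>

text \<open>The partial derivatives are explicit arguments so that \<open>Gx + \<i> * Gy\<close>,
  twice the antiholomorphic derivative, can be named. It measures the failure of \<open>G\<close> to
  be holomorphic.\<close>

definition C1_on :: "complex set \<Rightarrow> (complex \<Rightarrow> complex) \<Rightarrow> (complex \<Rightarrow> complex) \<Rightarrow> (complex \<Rightarrow> complex) \<Rightarrow> bool"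
  where "C1_on U G Gx Gy \<longleftrightarrow>
    (\<forall>z\<in>U. (G has_derivative (\<lambda>h. of_real (Re h) * Gx z + of_real (Im h) * Gy z)) (at z)) \<and>
    continuous_on U Gx \<and> continuous_on U Gy"

lemma C1_onD:
  assumes "C1_on U G Gx Gy"
  shows "\<And>z. z \<in> U \<Longrightarrow> (G has_derivative (\<lambda>h. of_real (Re h) * Gx z + of_real (Im h) * Gy z)) (at z)"
    "continuous_on U Gx" "continuous_on U Gy" "continuous_on U G"
proof -
  show d: "\<And>z. z \<in> U \<Longrightarrow> (G has_derivative (\<lambda>h. of_real (Re h) * Gx z + of_real (Im h) * Gy z)) (at z)"
    "continuous_on U Gx" "continuous_on U Gy"
    using assms unfolding C1_on_def by auto
  show "continuous_on U G"
    by (rule continuous_at_imp_continuous_on) (meson d(1) has_derivative_continuous)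
qed

lemma C1_on_subset: "C1_on U G Gx Gy \<Longrightarrow> S \<subseteq> U \<Longrightarrow> C1_on S G Gx Gy"
  unfolding C1_on_def using continuous_on_subset by blast

lemma C1_on_mult:
  assumes "C1_on U F Fx Fy" "C1_on U G Gx Gy"
  shows "C1_on U (\<lambda>z. F z * G z) (\<lambda>z. Fx z * G z + F z * Gx z) (\<lambda>z. Fy z * G z + F z * Gy z)"
  unfolding C1_on_def
proof (intro conjI ballI)
  fix z assume z: "z \<in> U"
  show "((\<lambda>z. F z * G z) has_derivative
      (\<lambda>h. of_real (Re h) * (Fx z * G z + F z * Gx z) + of_real (Im h) * (Fy z * G z + F z * Gy z))) (at z)"
    by (rule has_derivative_eq_rhs[OF has_derivative_mult[OF C1_onD(1)[OF assms(1) z] C1_onD(1)[OF assms(2) z]]])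
      (simp add: algebra_simps)
qed (use C1_onD(2-4)[OF assms(1)] C1_onD(2-4)[OF assms(2)] in \<open>auto intro!: continuous_intros\<close>)

lemma C1_on_exp:
  assumes "C1_on U G Gx Gy"
  shows "C1_on U (\<lambda>z. exp (G z)) (\<lambda>z. exp (G z) * Gx z) (\<lambda>z. exp (G z) * Gy z)"
  unfolding C1_on_def
proof (intro conjI ballI)
  fix z assume z: "z \<in> U"
  have "(exp has_derivative (\<lambda>h. exp (G z) * h)) (at (G z))"
    using DERIV_exp[of "G z"] by (simp add: has_field_derivative_def)
  from has_derivative_compose[OF C1_onD(1)[OF assms z] this]
  show "((\<lambda>z. exp (G z)) has_derivative
      (\<lambda>h. of_real (Re h) * (exp (G z) * Gx z) + of_real (Im h) * (exp (G z) * Gy z))) (at z)"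
    by (rule has_derivative_eq_rhs) (simp add: algebra_simps)
qed (use C1_onD(2-4)[OF assms(1)] in \<open>auto intro!: continuous_intros\<close>)

lemma C1_on_uminus:
  assumes "C1_on U G Gx Gy"
  shows "C1_on U (\<lambda>z. - G z) (\<lambda>z. - Gx z) (\<lambda>z. - Gy z)"
  unfolding C1_on_def
proof (intro conjI ballI)
  fix z assume z: "z \<in> U"
  show "((\<lambda>z. - G z) has_derivative
      (\<lambda>h. of_real (Re h) * (- Gx z) + of_real (Im h) * (- Gy z))) (at z)"
    by (rule has_derivative_eq_rhs[OF has_derivative_minus[OF C1_onD(1)[OF assms z]]]) simp
qed (use C1_onD(2-4)[OF assms(1)] in \<open>auto intro!: continuous_intros\<close>)

lemma C1_on_chain:
  assumes "C1_on U G Gx Gy" "g t \<in> U" "(g has_vector_derivative h) (at t within S)"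
  shows "((\<lambda>t. G (g t)) has_vector_derivative (of_real (Re h) * Gx (g t) + of_real (Im h) * Gy (g t))) (at t within S)"
  using has_derivative_compose[OF assms(3)[unfolded has_vector_derivative_def] C1_onD(1)[OF assms(1,2)]]
  unfolding has_vector_derivative_def
  by (rule has_derivative_eq_rhs) (simp add: scaleR_conv_of_real algebra_simps)

text \<open>The homotopy \<open>\<tau> \<mapsto> w + \<tau> (\<zeta> - w)\<close> shrinks the circle to \<open>w\<close>; along it the
  Cauchy integral changes only through the antiholomorphic derivative.\<close>

lemma Cauchy_integral_almost_holomorphic:
  assumes G: "C1_on U G Gx Gy" and U: "cball c \<rho> \<subseteq> U" and w: "w \<in> ball c \<rho>"
    and eps: "\<And>z. z \<in> cball c \<rho> \<Longrightarrow> cmod (Gx z + \<i> * Gy z) \<le> \<epsilon>"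
  shows "cmod (contour_integral (circlepath c \<rho>) (\<lambda>\<zeta>. G \<zeta> / (\<zeta> - w)) - 2 * pi * \<i> * G w) \<le> 2 * pi * \<rho> * \<epsilon>"
proof -
  have \<rho>: "\<rho> > 0" using w by (metis ball_eq_empty empty_iff not_less)
  define \<gamma> where "\<gamma> = circlepath c \<rho>"
  define \<gamma>' where "\<gamma>' x = 2 * pi * \<i> * \<rho> * exp (2 * of_real pi * \<i> * of_real x)" for x :: real
  have \<gamma>d: "(\<gamma> has_vector_derivative \<gamma>' x) (at x within X)" for x X
    unfolding \<gamma>_def \<gamma>'_def by (rule has_vector_derivative_circlepath)
  have \<gamma>c: "continuous_on S \<gamma>" for S
    using \<gamma>d by (meson continuous_on_vector_derivative)
  have \<gamma>'c: "continuous_on S \<gamma>'" for S unfolding \<gamma>'_def by (intro continuous_intros)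
  have n\<gamma>': "cmod (\<gamma>' x) = 2 * pi * \<rho>" for x unfolding \<gamma>'_def using \<rho> by (simp add: norm_mult)
  have \<gamma>s: "\<gamma> x \<in> sphere c \<rho>" for x
    unfolding \<gamma>_def circlepath using \<rho> by (auto simp: dist_norm norm_mult)
  have \<gamma>w: "\<gamma> x \<noteq> w" for x using \<gamma>s[of x] w by auto
  define Z where "Z \<tau> x = w + of_real \<tau> * (\<gamma> x - w)" for \<tau> x :: real
  have Zin: "Z \<tau> x \<in> cball c \<rho>" if "\<tau> \<in> {0..1}" for \<tau> x
  proof -
    have "Z \<tau> x = (1 - \<tau>) *\<^sub>R w + \<tau> *\<^sub>R \<gamma> x" unfolding Z_def by (simp add: scaleR_conv_of_real algebra_simps)
    moreover have "\<dots> \<in> cball c \<rho>"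
      using convex_cball[of c \<rho>] w \<gamma>s[of x] that unfolding convex_alt by (simp add: sphere_def)
    ultimately show ?thesis by simp
  qed
  \<comment> \<open>The form d\<zeta>/(\<zeta> - w) is invariant under scaling about
    \<open>w\<close>, so the same kernel serves every shrunken circle, and \<open>J \<tau>\<close>
    is the Cauchy integral over the circle scaled by \<tau>.\<close>
  define k where "k x = \<gamma>' x / (\<gamma> x - w)" for x
  have kc: "continuous_on S k" for S unfolding k_def
    using \<gamma>w by (intro continuous_intros \<gamma>c \<gamma>'c) auto
  define J where "J \<tau> = integral {0..1} (\<lambda>x. G (Z \<tau> x) * k x)" for \<tau>
  define P where "P \<tau> x = (of_real (Re (\<gamma> x - w)) * Gx (Z \<tau> x) + of_real (Im (\<gamma> x - w)) * Gy (Z \<tau> x)) * k x" for \<tau> x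
  have Zc: "continuous_on ({0..1} \<times> {0..1}) (\<lambda>(\<tau>, x). Z \<tau> x)"
    unfolding Z_def split_beta
    by (intro continuous_intros continuous_on_compose2[OF \<gamma>c[of UNIV]]) auto
  have comp: "continuous_on ({0..1} \<times> {0..1}) (\<lambda>(\<tau>, x). H (Z \<tau> x))" if "continuous_on U H" for H :: "complex \<Rightarrow> complex"
    using continuous_on_compose2[OF that Zc] Zin U by (force simp: split_beta)
  have Zx: "continuous_on {0..1} (\<lambda>x. H (Z \<tau> x))" if "continuous_on U H" "\<tau> \<in> {0..1}" for \<tau> and H :: "complex \<Rightarrow> complex"
  proof -
    have "continuous_on {0..1} (\<lambda>x. (\<tau>, x))" by (intro continuous_intros)
    from continuous_on_compose2[OF comp[OF that(1)] this] that show ?thesis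
      by (simp add: image_subset_iff)
  qed
  note Gc = C1_onD(2-4)[OF G]
  have Pc: "continuous_on ({0..1} \<times> {0..1}) (\<lambda>(\<tau>, x). P \<tau> x)"
    unfolding P_def split_beta
    by (intro continuous_intros comp[OF Gc(1), unfolded split_beta] comp[OF Gc(2), unfolded split_beta]
          continuous_on_compose2[OF \<gamma>c[of UNIV]] continuous_on_compose2[OF kc[of UNIV]]) auto
  have Zd: "((\<lambda>\<tau>. Z \<tau> x) has_vector_derivative (\<gamma> x - w)) (at \<tau> within S)" for x \<tau> S
    unfolding Z_def by (auto intro!: derivative_eq_intros)
  have Jd: "(J has_vector_derivative integral {0..1} (P \<tau>)) (at \<tau> within {0..1})" if "\<tau> \<in> {0..1}" for \<tau>
    unfolding J_def
  proof (rule leibniz_rule_vector_derivative[where 'b=real, unfolded cbox_interval])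
    fix \<tau> x :: real assume a: "\<tau> \<in> {0..1}" "x \<in> {0..1}"
    have "((\<lambda>\<tau>. G (Z \<tau> x)) has_vector_derivative
        (of_real (Re (\<gamma> x - w)) * Gx (Z \<tau> x) + of_real (Im (\<gamma> x - w)) * Gy (Z \<tau> x))) (at \<tau> within {0..1})"
      using C1_on_chain[OF G _ Zd[of x]] Zin[OF a(1)] U by blast
    thus "((\<lambda>\<tau>. G (Z \<tau> x) * k x) has_vector_derivative P \<tau> x) (at \<tau> within {0..1})"
      unfolding P_def by (intro derivative_eq_intros) auto
  next
    fix \<tau> :: real assume "\<tau> \<in> {0..1}"
    thus "(\<lambda>x. G (Z \<tau> x) * k x) integrable_on {0..1}"
      by (intro integrable_continuous_interval continuous_intros kc Zx[OF Gc(3)])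
  qed (use Pc that in auto)
  have Jbound: "cmod (integral {0..1} (P \<tau>)) \<le> 2 * pi * \<rho> * \<epsilon>" if t: "0 < \<tau>" "\<tau> < 1" for \<tau>
  proof -
    \<comment> \<open>\<tau> \<open>L\<close> is the derivative of \<open>G\<close> along the closed
      curve, so \<open>L\<close> has integral 0. The integrand \<open>P\<close> of J' has the same
      complex-linear part as \<open>L\<close>; their difference \<open>R\<close> contains only the
      antiholomorphic derivative.\<close>
    define L where "L x = of_real (Re (\<gamma>' x)) * Gx (Z \<tau> x) + of_real (Im (\<gamma>' x)) * Gy (Z \<tau> x)" for x
    define R where "R x = (Gx (Z \<tau> x) + \<i> * Gy (Z \<tau> x)) / 2 * (cnj (\<gamma> x - w) * k x - cnj (\<gamma>' x))" for x
    have dec: "of_real (Re h) * A + of_real (Im h) * B = (A - \<i> * B) / 2 * h + (A + \<i> * B) / 2 * cnj h" for h A B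
      by (simp add: complex_eq_iff field_simps)
    have PL: "P \<tau> x = L x + R x" for x
    proof -
      have "(\<gamma> x - w) * k x = \<gamma>' x" unfolding k_def using \<gamma>w[of x] by simp
      moreover have "P \<tau> x = (Gx (Z \<tau> x) - \<i> * Gy (Z \<tau> x)) / 2 * ((\<gamma> x - w) * k x)
          + (Gx (Z \<tau> x) + \<i> * Gy (Z \<tau> x)) / 2 * (cnj (\<gamma> x - w) * k x)"
        unfolding P_def dec by (simp only: distrib_right mult.assoc)
      ultimately show ?thesis unfolding L_def R_def dec by (simp add: right_diff_distrib)
    qed
    have Zin': "Z \<tau> x \<in> U" "Z \<tau> x \<in> cball c \<rho>" for x using Zin[of \<tau> x] t U by auto
    have Zdx: "(Z \<tau> has_vector_derivative (of_real \<tau> * \<gamma>' x)) (at x within S)" for x S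
      unfolding Z_def by (auto intro!: derivative_eq_intros \<gamma>d)
    have GZd: "((\<lambda>x. G (Z \<tau> x)) has_vector_derivative of_real \<tau> * L x) (at x within S)" for x S
      using C1_on_chain[OF G Zin'(1) Zdx] unfolding L_def by (simp add: algebra_simps)
    have "((\<lambda>x. of_real \<tau> * L x) has_integral (G (Z \<tau> 1) - G (Z \<tau> 0))) {0..1}"
      by (rule fundamental_theorem_of_calculus) (use GZd in auto)
    moreover have "Z \<tau> 1 = Z \<tau> 0" unfolding Z_def \<gamma>_def circlepath by simp
    ultimately have "((\<lambda>x. of_real \<tau> * L x) has_integral 0) {0..1}" by simp
    from has_integral_mult_right[OF this, of "1 / of_real \<tau>"]
    have Lint: "(L has_integral 0) {0..1}" using t by simp
    have Rb: "cmod (R x) \<le> 2 * pi * \<rho> * \<epsilon>" for x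
    proof -
      have "cmod (cnj (\<gamma> x - w) * k x - cnj (\<gamma>' x)) \<le> cmod (cnj (\<gamma> x - w) * k x) + cmod (cnj (\<gamma>' x))"
        by (rule norm_triangle_ineq4)
      also have "\<dots> = 2 * (2 * pi * \<rho>)"
        unfolding k_def using \<gamma>w[of x] n\<gamma>'[of x]
        by (simp only: norm_mult norm_divide complex_mod_cnj) simp
      finally have "cmod (R x) \<le> \<epsilon> / 2 * (2 * (2 * pi * \<rho>))"
        unfolding R_def norm_mult using eps[OF Zin'(2)[of x]]
        by (intro mult_mono) (auto simp: norm_divide intro: order_trans[OF norm_ge_zero])
      thus ?thesis by (simp add: algebra_simps)
    qed
    have "P \<tau> integrable_on {0..1}"
      unfolding P_def using t by (intro integrable_continuous_interval continuous_intros kc \<gamma>c Zx Gc) auto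
    hence "(P \<tau> has_integral integral {0..1} (P \<tau>)) {0..1}" by (rule integrable_integral)
    from has_integral_diff[OF this Lint] have Rint: "(R has_integral integral {0..1} (P \<tau>)) {0..1}"
      by (simp add: PL)
    have "0 \<le> 2 * pi * \<rho> * \<epsilon>" using Rb[of 0] norm_ge_zero order_trans by blast
    from has_integral_bound[OF this Rint[folded cbox_interval]] Rb show ?thesis by simp
  qed
  have Jc: "continuous_on {0..1} J"
    using Jd by (meson continuous_on_vector_derivative)
  have mvt: "cmod (J 1 - J 0) \<le> 2 * pi * \<rho> * \<epsilon> * 1 - 2 * pi * \<rho> * \<epsilon> * 0"
  proof (rule differentiable_bound_general[where \<phi>="\<lambda>x. 2 * pi * \<rho> * \<epsilon> * x" and \<phi>'="\<lambda>_. 2 * pi * \<rho> * \<epsilon>" and f'="\<lambda>\<tau>. integral {0..1} (P \<tau>)"])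
    fix \<tau> :: real assume "0 < \<tau>" "\<tau> < 1"
    thus "(J has_vector_derivative integral {0..1} (P \<tau>)) (at \<tau>)"
      using Jd[of \<tau>] by (simp add: at_within_Icc_at)
  qed (use Jc Jbound in \<open>auto intro!: continuous_intros derivative_eq_intros\<close>)
  have vd: "vector_derivative \<gamma> (at x) = \<gamma>' x" for x
    using \<gamma>d vector_derivative_at by blast
  have ci: "contour_integral \<gamma> (\<lambda>\<zeta>. H \<zeta> / (\<zeta> - w)) = integral {0..1} (\<lambda>x. H (\<gamma> x) * k x)" for H
    unfolding contour_integral_integral vd k_def by simp
  have "J 1 = contour_integral \<gamma> (\<lambda>\<zeta>. G \<zeta> / (\<zeta> - w))"
    unfolding J_def ci Z_def by simp
  moreover have "J 0 = 2 * pi * \<i> * G w"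
  proof -
    have "contour_integral \<gamma> (\<lambda>\<zeta>. G w / (\<zeta> - w)) = 2 * of_real pi * \<i> * G w"
      unfolding \<gamma>_def using w
      by (intro contour_integral_unique Cauchy_integral_circlepath_simple) (auto simp: dist_norm norm_minus_commute)
    thus ?thesis unfolding ci J_def Z_def by simp
  qed
  ultimately show ?thesis using mvt unfolding \<gamma>_def by simp
qed

section \<open>The Cauchy transform\<close>

text \<open>In polar coordinates around \<open>z\<close> the Cauchy kernel \<open>1 / (z - \<zeta>)\<close> times the area element is
  \<open>cis (- \<theta>)\<close>, so the Cauchy transform has no singularity to treat.\<close>

lemma dbar_primitive:
  assumes b: "C1_on UNIV b bx by'" and R: "0 < R"
    and B: "\<And>z. cmod (b z) \<le> B"
  obtains s sx sy where "C1_on UNIV s sx sy" "\<And>z. cmod (s z) \<le> R * B"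
    "\<And>z. (\<And>\<theta>. b (z - of_real R * cis \<theta>) = 0) \<Longrightarrow> sx z + \<i> * sy z = b z"
proof -
  \<comment> \<open>Polar coordinates (r, \<theta>) for the disc of radius R about \<open>z\<close>;
    integrating over a disc that moves with \<open>z\<close> lets the derivative fall on
    \<open>b\<close>.\<close>
  define K where "K = cbox (0::real, 0::real) (R, 2*pi)"
  define P where "P z y = z - of_real (fst y) * cis (snd y)" for z and y :: "real \<times> real"
  define e where "e y = cis (- snd y)" for y :: "real \<times> real"
  note bc = C1_onD(2-4)[OF b] and bd = C1_onD(1)[OF b UNIV_I]
  have cisc: "continuous_on S (\<lambda>x. cis (g x))" if "continuous_on S g" for S :: "'a::topological_space set" and g
    using that unfolding cis_conv_exp by (intro continuous_intros)
  have Pc: "continuous_on S (\<lambda>x. P (g x) (h x))" if "continuous_on S g" "continuous_on S h"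
    for S :: "'a::topological_space set" and g h
    unfolding P_def by (intro continuous_intros cisc that)
  have HPc: "continuous_on S (\<lambda>x. H (P (g x) (h x)))" if "continuous_on UNIV H" "continuous_on S g" "continuous_on S h"
    for S :: "'a::topological_space set" and g h and H :: "complex \<Rightarrow> complex"
    using continuous_on_compose2[OF that(1) Pc[OF that(2,3)]] by simp
  have ec: "continuous_on S (\<lambda>x. e (h x))" if "continuous_on S h"
    for S :: "'a::topological_space set" and h
    unfolding e_def by (intro continuous_intros cisc that)
  define f where "f z y = b (P z y) * e y" for z y
  define I where "I H z = integral K (\<lambda>y. H (P z y) * e y)" for H :: "complex \<Rightarrow> complex" and z
  have Hint: "(\<lambda>y. H (P z y) * e y) integrable_on K" if "continuous_on UNIV H" for H z
    unfolding K_def by (intro integrable_continuous continuous_intros HPc ec that)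
  have Ic: "continuous_on UNIV (I H)" if "continuous_on UNIV H" for H
    unfolding I_def K_def
    by (rule integral_continuous_on_param)
      (auto simp: split_beta intro!: continuous_intros HPc ec that)
  define ReB where "ReB = Blinfun (\<lambda>h. complex_of_real (Re h))"
  define ImB where "ImB = Blinfun (\<lambda>h. complex_of_real (Im h))"
  have ReB: "blinfun_apply ReB h = of_real (Re h)" and ImB: "blinfun_apply ImB h = of_real (Im h)" for h
    unfolding ReB_def ImB_def
    by (subst bounded_linear_Blinfun_apply; (intro bounded_linear_compose[OF bounded_linear_of_real] bounded_linear_Re bounded_linear_Im)?; simp)+
  define T where "T z y = (blinfun_mult_right (bx (P z y) * e y) o\<^sub>L ReB) + (blinfun_mult_right (by' (P z y) * e y) o\<^sub>L ImB)" for z y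
  have T: "blinfun_apply (T z y) h = (of_real (Re h) * bx (P z y) + of_real (Im h) * by' (P z y)) * e y" for z y h
    unfolding T_def by (simp add: blinfun.add_left ReB ImB algebra_simps)
  have Tc: "continuous_on S (\<lambda>x. T (g x) (h x))" if "continuous_on S g" "continuous_on S h"
    for S :: "'a::topological_space set" and g h
    unfolding T_def
    by (intro continuous_intros bounded_bilinear.continuous_on[OF bounded_bilinear_blinfun_compose]
      bounded_linear.continuous_on[OF bounded_linear_blinfun_mult_right] HPc ec that bc)
  have Ider: "(I b has_derivative integral K (T z)) (at z)" for z
    unfolding I_def K_def
  proof (rule leibniz_rule[where U=UNIV and fx=T, simplified])
    fix z y
    have "((\<lambda>z. P z y) has_derivative (\<lambda>h. h)) (at z)" unfolding P_def by (auto intro!: derivative_eq_intros)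
    from has_derivative_compose[OF this bd]
    show "((\<lambda>z. b (P z y) * e y) has_derivative blinfun_apply (T z y)) (at z)"
      by (auto intro!: derivative_eq_intros simp: T fun_eq_iff)
  next
    fix z show "(\<lambda>y. b (P z y) * e y) integrable_on cbox (0, 0) (R, 2 * pi)"
      using Hint[OF bc(3)] unfolding K_def .
  next
    show "continuous_on (UNIV \<times> cbox (0, 0) (R, 2 * pi)) (\<lambda>(x, y). T x y)"
      unfolding split_beta by (intro Tc continuous_intros)
  qed
  have Tint: "blinfun_apply (integral K (T z)) h = of_real (Re h) * I bx z + of_real (Im h) * I by' z" for z h
  proof -
    have "T z integrable_on K" unfolding K_def by (intro integrable_continuous Tc continuous_intros)
    hence "blinfun_apply (integral K (T z)) h = integral K (\<lambda>y. blinfun_apply (T z y) h)"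
      by (rule blinfun_apply_integral)
    also have "\<dots> = integral K (\<lambda>y. of_real (Re h) * (bx (P z y) * e y) + of_real (Im h) * (by' (P z y) * e y))"
      by (simp add: T algebra_simps)
    also have "\<dots> = of_real (Re h) * I bx z + of_real (Im h) * I by' z"
      unfolding I_def using Hint[OF bc(1), of z] Hint[OF bc(2), of z]
      by (subst integral_add) (auto intro!: integrable_on_mult_right)
    finally show ?thesis .
  qed
  \<comment> \<open>The normalisation is 1/(2 pi) instead of the usual 1/pi because the operator is
    \<partial>x + i \<partial>y, twice the Cauchy-Riemann operator.\<close>
  define s where "s z = I b z / (2 * pi)" for z
  define sx where "sx z = I bx z / (2 * pi)" for z
  define sy where "sy z = I by' z / (2 * pi)" for z
  have C1: "C1_on UNIV s sx sy"
    unfolding C1_on_def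
  proof (intro conjI ballI)
    fix z
    show "(s has_derivative (\<lambda>h. of_real (Re h) * sx z + of_real (Im h) * sy z)) (at z)"
      unfolding s_def sx_def sy_def
      by (rule has_derivative_eq_rhs[OF has_derivative_divide'[OF Ider]]) 
        (auto simp: Tint fun_eq_iff field_simps)
  qed (auto simp: sx_def sy_def intro!: continuous_intros Ic bc)
  have bound: "cmod (s z) \<le> R * B" for z
  proof -
    have B0: "0 \<le> B" using B[of 0] norm_ge_zero order_trans by blast
    have int: "((\<lambda>y. b (P z y) * e y) has_integral I b z) K"
      unfolding I_def using Hint[OF bc(3)] by (rule integrable_integral)
    have "cmod (I b z) \<le> B * measure lborel (cbox (0::real, 0::real) (R, 2*pi))"
      by (rule has_integral_bound[OF B0 int[unfolded K_def]])
        (use B in \<open>simp add: e_def norm_mult\<close>)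
    also have "\<dots> = B * R * (2 * pi)" using R by (simp add: content_Pair)
    finally show ?thesis unfolding s_def by (simp add: norm_divide field_simps)
  qed
  have dbar: "sx z + \<i> * sy z = b z" if z: "\<And>\<theta>. b (z - of_real R * cis \<theta>) = 0" for z
  proof -
    define p where "p r \<theta> = z - of_real r * cis \<theta>" for r \<theta>
    have pc: "continuous_on S (\<lambda>x. p (g x) (h x))" if "continuous_on S g" "continuous_on S h"
      for S :: "'a::topological_space set" and g h
      unfolding p_def by (intro continuous_intros cisc that)
    have Hpc: "continuous_on S (\<lambda>x. H (p (g x) (h x)))" if "continuous_on UNIV H" "continuous_on S g" "continuous_on S h"
      for S :: "'a::topological_space set" and g h and H :: "complex \<Rightarrow> complex"
      using continuous_on_compose2[OF that(1) pc[OF that(2,3)]] by simp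
    \<comment> \<open>Rotating the gradient by \<open>cis (- \<theta>)\<close> splits it into a
      radial part \<open>br\<close> and an angular part \<open>q\<close>. The angular part
      integrates to 0 over a period; the radial part integrates to \<open>b z\<close>, as
      \<open>b\<close> vanishes at radius R.\<close>
    define br where "br r \<theta> = of_real (cos \<theta>) * bx (p r \<theta>) + of_real (sin \<theta>) * by' (p r \<theta>)" for r \<theta>
    define q where "q r \<theta> = of_real (cos \<theta>) * by' (p r \<theta>) - of_real (sin \<theta>) * bx (p r \<theta>)" for r \<theta>
    have brc: "continuous_on S (\<lambda>x. br (g x) (h x))" and qc: "continuous_on S (\<lambda>x. q (g x) (h x))"
      if "continuous_on S g" "continuous_on S h"
      for S :: "'a::real_normed_vector set" and g h
      unfolding br_def q_def by (intro continuous_intros Hpc bc that)+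
    have pr: "((\<lambda>r. p r \<theta>) has_vector_derivative - cis \<theta>) (at r within S)" for r \<theta> S
      unfolding p_def by (auto intro!: derivative_eq_intros)
    have cisd: "(cis has_vector_derivative \<i> * cis \<theta>) (at \<theta> within S)" for \<theta> S
    proof -
      have "((\<lambda>w. exp (\<i> * w)) has_field_derivative \<i> * exp (\<i> * of_real \<theta>)) (at (of_real \<theta>))"
        by (auto intro!: derivative_eq_intros)
      moreover have "cis = (\<lambda>x. exp (\<i> * of_real x))" by (simp add: fun_eq_iff cis_conv_exp)
      ultimately show ?thesis using has_vector_derivative_real_field[of "\<lambda>w. exp (\<i> * w)" _ \<theta> S] by (metis cis_conv_exp)
    qed
    have pt: "((\<lambda>\<theta>. p r \<theta>) has_vector_derivative - (of_real r * (\<i> * cis \<theta>))) (at \<theta> within S)" for r \<theta> S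
      unfolding p_def by (auto intro!: derivative_eq_intros cisd)
    have dr: "((\<lambda>r. b (p r \<theta>)) has_vector_derivative - br r \<theta>) (at r within S)" for r \<theta> S
      using C1_on_chain[OF b UNIV_I pr[of \<theta> r S]] unfolding br_def by simp
    have dt: "((\<lambda>\<theta>. b (p r \<theta>)) has_vector_derivative - (of_real r * q r \<theta>)) (at \<theta> within S)" for r \<theta> S
      using C1_on_chain[OF b UNIV_I pt[of r \<theta> S]] unfolding q_def by (simp add: algebra_simps)
    have q0: "integral {0..2*pi} (q r) = 0" if "r > 0" for r
    proof -
      have "((\<lambda>\<theta>. - (of_real r * q r \<theta>)) has_integral (b (p r (2*pi)) - b (p r 0))) {0..2*pi}"
        by (rule fundamental_theorem_of_calculus) (use dt in auto)
      hence "((\<lambda>\<theta>. - (of_real r * q r \<theta>)) has_integral 0) {0..2*pi}" by (simp add: p_def)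
      from has_integral_mult_right[OF this, of "- 1 / of_real r"] that
      have "(q r has_integral 0) {0..2*pi}" by simp
      thus ?thesis by (rule integral_unique)
    qed
    have intr: "integral {0..R} (\<lambda>r. br r \<theta>) = b z" for \<theta>
    proof -
      have "((\<lambda>r. - br r \<theta>) has_integral (b (p R \<theta>) - b (p 0 \<theta>))) {0..R}"
        by (rule fundamental_theorem_of_calculus) (use dr R in auto)
      from has_integral_neg[OF this] show ?thesis using z[of \<theta>] by (intro integral_unique) (simp add: p_def)
    qed
    have "(bx (P z y) + \<i> * by' (P z y)) * e y = br (fst y) (snd y) + \<i> * q (fst y) (snd y)" for y
      unfolding P_def e_def br_def q_def p_def by (simp add: cis.code complex_eq_iff algebra_simps)
    hence "I (\<lambda>w. bx w + \<i> * by' w) z = integral K (\<lambda>(r, \<theta>). br r \<theta> + \<i> * q r \<theta>)"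
      unfolding I_def by (simp add: split_beta')
    also have "\<dots> = integral {0..R} (\<lambda>r. integral {0..2*pi} (\<lambda>\<theta>. br r \<theta> + \<i> * q r \<theta>))"
      unfolding K_def
      by (subst integral_prod_continuous)
        (auto simp: split_beta cbox_interval intro!: continuous_intros brc qc)
    also have "\<dots> = integral {0..R} (\<lambda>r. integral {0..2*pi} (br r) + \<i> * integral {0..2*pi} (q r))"
      by (subst integral_add) (auto intro!: integrable_continuous_interval continuous_intros brc qc)
    \<comment> \<open>\<open>q0\<close> divides by r, so the radius r = 0 is discarded as a
      negligible set.\<close>
    also have "\<dots> = integral {0..R} (\<lambda>r. integral {0..2*pi} (br r))"
      by (rule integral_spike[of "{0}"]) (use q0 in auto)
    also have "\<dots> = integral {0..2*pi} (\<lambda>\<theta>. integral {0..R} (\<lambda>r. br r \<theta>))"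
      by (rule integral_swap_continuous[where 'a=real and 'b=real, unfolded cbox_interval])
        (auto simp: split_beta intro!: brc continuous_intros)
    also have "\<dots> = 2 * pi * b z" unfolding intr by (simp add: scaleR_conv_of_real)
    finally have "I (\<lambda>w. bx w + \<i> * by' w) z = 2 * pi * b z" .
    moreover have "I (\<lambda>w. bx w + \<i> * by' w) z = I bx z + \<i> * I by' z"
      using Hint[OF bc(1), of z] Hint[OF bc(2), of z] unfolding I_def
      by (simp add: distrib_right mult.assoc integral_add integrable_on_mult_right)
    ultimately show ?thesis unfolding sx_def sy_def by (simp add: field_simps)
  qed
  show thesis by (rule that[OF C1 bound dbar])
qed

section \<open>The similarity principle\<close>

text \<open>Squaring removes the corner of the positive part. This gives a continuously
  differentiable cutoff of compact support from elementary functions.\<close>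

lemma DERIV_max_0_power2: "((\<lambda>y. (max 0 y)\<^sup>2) has_real_derivative 2 * max 0 y) (at y)"
proof -
  have b: "\<bar>((max 0 (y + h))\<^sup>2 - (max 0 y)\<^sup>2) / h - 2 * max 0 y\<bar> \<le> \<bar>h\<bar>" if "h \<noteq> 0" for h
  proof -
    define p where "p = max 0 (y + h) - max 0 y"
    have ph: "\<bar>p\<bar> \<le> \<bar>h\<bar>" unfolding p_def by (auto simp: max_def)
    have e: "\<bar>(max 0 (y + h))\<^sup>2 - (max 0 y)\<^sup>2 - 2 * max 0 y * h\<bar> \<le> h\<^sup>2"
    proof (cases "y + h \<ge> 0")
      case a: True
      show ?thesis
      proof (cases "y \<ge> 0")
        case True thus ?thesis using a by (simp add: power2_eq_square algebra_simps)
      next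
        case False
        hence "(y + h)\<^sup>2 \<le> h\<^sup>2" using a by (intro power_mono) auto
        thus ?thesis using a False by simp
      qed
    next
      case a: False
      show ?thesis
      proof (cases "y \<ge> 0")
        case True
        have "y * (2 * \<bar>h\<bar> - y) \<le> \<bar>h\<bar> * \<bar>h\<bar>"
          using zero_le_power2[of "y - \<bar>h\<bar>"] by (simp add: power2_eq_square algebra_simps)
        moreover have "y * (2 * \<bar>h\<bar> - y) \<ge> 0" using True a by (intro mult_nonneg_nonneg) auto
        ultimately show ?thesis using a True by (simp add: power2_eq_square abs_if algebra_simps)
      qed (use a in auto)
    qed
    have "\<bar>((max 0 (y + h))\<^sup>2 - (max 0 y)\<^sup>2) / h - 2 * max 0 y\<bar>
        = \<bar>(max 0 (y + h))\<^sup>2 - (max 0 y)\<^sup>2 - 2 * max 0 y * h\<bar> / \<bar>h\<bar>"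
      using that by (simp add: abs_divide[symmetric] diff_divide_distrib)
    also have "\<dots> \<le> h\<^sup>2 / \<bar>h\<bar>" using e by (intro divide_right_mono) auto
    also have "\<dots> = \<bar>h\<bar>" using that by (simp add: power2_eq_square abs_if)
    finally show ?thesis .
  qed
  have "((\<lambda>h. ((max 0 (y + h))\<^sup>2 - (max 0 y)\<^sup>2) / h - 2 * max 0 y) \<longlongrightarrow> 0) (at 0)"
  proof (rule Lim_null_comparison)
    show "\<forall>\<^sub>F h in at 0. norm (((max 0 (y + h))\<^sup>2 - (max 0 y)\<^sup>2) / h - 2 * max 0 y) \<le> \<bar>h\<bar>"
      using b by (auto simp: eventually_at intro!: exI[of _ 1])
    show "((\<lambda>h::real. \<bar>h\<bar>) \<longlongrightarrow> 0) (at 0)" by (rule tendsto_rabs_zero) simp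
  qed
  thus ?thesis unfolding DERIV_def by (rule LIM_zero_cancel)
qed

lemma C1_on_of_real:
  assumes "\<And>z. (p has_derivative (\<lambda>h. Re h * px z + Im h * py z)) (at z)"
    "continuous_on UNIV px" "continuous_on UNIV py"
  shows "C1_on UNIV (\<lambda>z. complex_of_real (p z)) (\<lambda>z. of_real (px z)) (\<lambda>z. of_real (py z))"
  unfolding C1_on_def
proof (intro conjI ballI)
  fix z
  show "((\<lambda>z. complex_of_real (p z)) has_derivative
      (\<lambda>h. of_real (Re h) * of_real (px z) + of_real (Im h) * of_real (py z))) (at z)"
    by (rule has_derivative_eq_rhs[OF has_derivative_of_real[OF assms(1)]]) simp
qed (intro continuous_intros assms)+

text \<open>Polynomials in the two real coordinates are the smooth approximants provided by
  Stone-Weierstrass; the induction follows their generation from linear maps and constants.\<close>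

lemma C1_real_polynomial_function:
  fixes p :: "complex \<Rightarrow> real"
  assumes "real_polynomial_function p"
  shows "\<exists>px py. continuous_on UNIV px \<and> continuous_on UNIV py \<and>
    (\<forall>z. (p has_derivative (\<lambda>h. Re h * px z + Im h * py z)) (at z))"
  using assms
proof induction
  case (linear f)
  have "f h = Re h * f 1 + Im h * f \<i>" for h
  proof -
    have "Re h *\<^sub>R 1 + Im h *\<^sub>R \<i> = h" by (simp add: complex_eq_iff)
    hence "f h = f (Re h *\<^sub>R 1 + Im h *\<^sub>R \<i>)" by simp
    also have "\<dots> = Re h * f 1 + Im h * f \<i>"
      using linear by (simp add: linear_add linear_scale bounded_linear.linear)
    finally show ?thesis .
  qed
  hence "f = (\<lambda>h. Re h * f 1 + Im h * f \<i>)" by blast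
  hence "(f has_derivative (\<lambda>h. Re h * f 1 + Im h * f \<i>)) (at z)" for z
    using bounded_linear_imp_has_derivative[OF linear] by metis
  thus ?case by (intro exI[of _ "\<lambda>_. f 1"] exI[of _ "\<lambda>_. f \<i>"]) auto
next
  case (const c)
  show ?case by (intro exI[of _ "\<lambda>_. 0"]) auto
next
  case (add f g)
  then obtain fx fy gx gy where c: "continuous_on UNIV fx" "continuous_on UNIV fy" "continuous_on UNIV gx" "continuous_on UNIV gy"
    and f: "\<And>z. (f has_derivative (\<lambda>h. Re h * fx z + Im h * fy z)) (at z)"
    and g: "\<And>z. (g has_derivative (\<lambda>h. Re h * gx z + Im h * gy z)) (at z)"
    by auto
  show ?case
  proof (intro exI conjI allI)
    show "((\<lambda>x. f x + g x) has_derivative (\<lambda>h. Re h * (fx z + gx z) + Im h * (fy z + gy z))) (at z)" for z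
      by (rule has_derivative_eq_rhs[OF has_derivative_add[OF f g]]) (simp add: algebra_simps)
  qed (intro continuous_intros c)+
next
  case (mult f g)
  then obtain fx fy gx gy where c: "continuous_on UNIV fx" "continuous_on UNIV fy" "continuous_on UNIV gx" "continuous_on UNIV gy"
    and f: "\<And>z. (f has_derivative (\<lambda>h. Re h * fx z + Im h * fy z)) (at z)"
    and g: "\<And>z. (g has_derivative (\<lambda>h. Re h * gx z + Im h * gy z)) (at z)"
    by auto
  have fg: "continuous_on UNIV f" "continuous_on UNIV g"
    by (rule continuous_at_imp_continuous_on, use f g has_derivative_continuous in blast)+
  show ?case
  proof (intro exI conjI allI)
    show "((\<lambda>x. f x * g x) has_derivative (\<lambda>h. Re h * (f z * gx z + fx z * g z) + Im h * (f z * gy z + fy z * g z))) (at z)" for z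
      by (rule has_derivative_eq_rhs[OF has_derivative_mult[OF f g]]) (simp add: algebra_simps)
  qed (intro continuous_intros c fg)+
qed

lemma C1_polynomial_function:
  fixes p :: "complex \<Rightarrow> complex"
  assumes "polynomial_function p"
  obtains px py where "C1_on UNIV p px py"
proof -
  have "real_polynomial_function (Re \<circ> p)" "real_polynomial_function (Im \<circ> p)"
    using assms bounded_linear_Re bounded_linear_Im unfolding polynomial_function_def by auto
  from C1_real_polynomial_function[OF this(1)] C1_real_polynomial_function[OF this(2)]
  obtain rx ry ix iy where c: "continuous_on UNIV rx" "continuous_on UNIV ry" "continuous_on UNIV ix" "continuous_on UNIV iy"
    and r: "\<And>z. ((\<lambda>z. Re (p z)) has_derivative (\<lambda>h. Re h * rx z + Im h * ry z)) (at z)"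
    and i: "\<And>z. ((\<lambda>z. Im (p z)) has_derivative (\<lambda>h. Re h * ix z + Im h * iy z)) (at z)"
    unfolding comp_def by auto
  have "C1_on UNIV p (\<lambda>z. of_real (rx z) + \<i> * of_real (ix z)) (\<lambda>z. of_real (ry z) + \<i> * of_real (iy z))"
    unfolding C1_on_def
  proof (intro conjI ballI)
    fix z
    have "p = (\<lambda>z. of_real (Re (p z)) + \<i> * of_real (Im (p z)))" by (simp add: fun_eq_iff complex_eq_iff)
    moreover have "((\<lambda>z. of_real (Re (p z)) + \<i> * of_real (Im (p z))) has_derivative
        (\<lambda>h. of_real (Re h) * (of_real (rx z) + \<i> * of_real (ix z)) + of_real (Im h) * (of_real (ry z) + \<i> * of_real (iy z)))) (at z)"
      by (rule has_derivative_eq_rhs[OF has_derivative_add[OF has_derivative_of_real[OF r]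
            has_derivative_mult_right[OF has_derivative_of_real[OF i]]]])
        (simp add: algebra_simps)
    ultimately show "(p has_derivative
        (\<lambda>h. of_real (Re h) * (of_real (rx z) + \<i> * of_real (ix z)) + of_real (Im h) * (of_real (ry z) + \<i> * of_real (iy z)))) (at z)"
      by simp
  qed (intro continuous_intros c)+
  thus thesis by (rule that)
qed

text \<open>The similarity principle for \<open>f\<^sub>x + i f\<^sub>y = a \<cdot> cnj f\<close>. The exact exponent would solve
  \<open>s\<^sub>x + i s\<^sub>y = a \<cdot> cnj f / f\<close>, whose right-hand side is singular at the zeros of \<open>f\<close>; it is replaced by a
  smooth approximation of \<open>a \<cdot> (cnj f)\<^sup>2 / (\<bar>f\<bar>\<^sup>2 + k\<^sup>2)\<close>.\<close>

lemma approximate_similarity: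
  fixes f :: "complex \<Rightarrow> complex" and a :: "complex \<Rightarrow> real"
  assumes \<rho>: "0 < \<rho>" and A: "0 < A"
    and fc: "continuous_on (cball c (2 * \<rho>)) f"
    and ac: "continuous_on (cball c (2 * \<rho>)) a"
    and aA: "\<And>z. z \<in> cball c (2 * \<rho>) \<Longrightarrow> \<bar>a z\<bar> \<le> A" and \<epsilon>: "0 < \<epsilon>"
  obtains s sx sy where "C1_on UNIV s sx sy" "\<And>z. cmod (s z) \<le> 6 * A * \<rho>"
    "\<And>z. z \<in> cball c \<rho> \<Longrightarrow> cmod (of_real (a z) * cnj (f z) - f z * (sx z + \<i> * sy z)) \<le> \<epsilon>"
proof -
  define K where "K = cball c (2 * \<rho>)"
  have Kc: "compact K" unfolding K_def by simp
  have "bounded (f ` K)" using compact_continuous_image[OF fc] Kc compact_imp_bounded unfolding K_def by blast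
  then obtain M where M: "\<And>z. z \<in> K \<Longrightarrow> cmod (f z) \<le> M" "M > 0"
    by (meson bounded_pos imageI)
  define w where "w = 1 / \<rho>\<^sup>2"
  \<comment> \<open>The cutoff \<open>\<eta>\<close>, the squared positive part of 4 - (|z -
    c|/\<rho>)^2, is supported in the disc of radius 2\<rho>, is at least 3^2 = 9 on the disc of
    radius \<rho>, and at most 4^2 = 16.\<close>
  define q where "q z = 4 - w * ((Re z - Re c)\<^sup>2 + (Im z - Im c)\<^sup>2)" for z
  have q: "q z = 4 - (dist c z / \<rho>)\<^sup>2" for z
    unfolding q_def w_def dist_norm by (simp add: cmod_power2 power_divide power2_commute)
  define \<eta> where "\<eta> z = (max 0 (q z))\<^sup>2" for z
  have \<eta>16: "0 \<le> \<eta> z" "\<eta> z \<le> 16" for z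
  proof -
    have "max 0 (q z) \<le> 4" unfolding q by auto
    hence "(max 0 (q z))\<^sup>2 \<le> 4\<^sup>2" by (intro power_mono) auto
    thus "0 \<le> \<eta> z" "\<eta> z \<le> 16" unfolding \<eta>_def by auto
  qed
  have \<eta>9: "9 \<le> \<eta> z" if "z \<in> cball c \<rho>" for z
  proof -
    have "dist c z / \<rho> \<le> 1" using that \<rho> by simp
    hence "(dist c z / \<rho>)\<^sup>2 \<le> 1\<^sup>2" using \<rho> by (intro power_mono) auto
    hence "3 \<le> max 0 (q z)" unfolding q by auto
    hence "3\<^sup>2 \<le> (max 0 (q z))\<^sup>2" by (intro power_mono) auto
    thus ?thesis unfolding \<eta>_def by simp
  qed
  have \<eta>0: "\<eta> z = 0" if "2 * \<rho> \<le> dist c z" for z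
  proof -
    have "2 \<le> dist c z / \<rho>" using that \<rho> by (simp add: field_simps)
    hence "2\<^sup>2 \<le> (dist c z / \<rho>)\<^sup>2" by (intro power_mono) auto
    thus ?thesis unfolding \<eta>_def q by simp
  qed
  have qc: "continuous_on S q" for S unfolding q_def by (intro continuous_intros)
  have \<eta>c: "continuous_on S \<eta>" for S unfolding \<eta>_def by (intro continuous_intros qc)
  have \<eta>d: "(\<eta> has_derivative (\<lambda>h. Re h * (2 * max 0 (q z) * (- (2 * (Re z - Re c) * w)))
      + Im h * (2 * max 0 (q z) * (- (2 * (Im z - Im c) * w))))) (at z)" for z
  proof -
    have qd: "(q has_derivative (\<lambda>h. - (w * (2 * (Re z - Re c) * Re h + 2 * (Im z - Im c) * Im h)))) (at z)"
      unfolding q_def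
      by (auto intro!: derivative_eq_intros simp: fun_eq_iff algebra_simps)
    have "((\<lambda>y. (max 0 y)\<^sup>2) has_derivative (\<lambda>h. 2 * max 0 (q z) * h)) (at (q z))"
      using DERIV_max_0_power2[of "q z"] by (simp add: has_field_derivative_def)
    from has_derivative_compose[OF qd this] show ?thesis
      unfolding \<eta>_def by (rule has_derivative_eq_rhs) (simp add: fun_eq_iff algebra_simps)
  qed
  have \<eta>C1: "C1_on UNIV (\<lambda>z. complex_of_real (\<eta> z)) (\<lambda>z. of_real (2 * max 0 (q z) * (- (2 * (Re z - Re c) * w))))
      (\<lambda>z. of_real (2 * max 0 (q z) * (- (2 * (Im z - Im c) * w))))"
    by (rule C1_on_of_real[OF \<eta>d]) (intro continuous_intros qc)+
  \<comment> \<open>The regularisation by k^2 in the denominator of \<open>\<kappa>\<close> causes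
    an error of at most A k = \<epsilon>/2, because |f| k \<le> |f|^2 + k^2.\<close>
  define k where "k = \<epsilon> / (2 * A)"
  have k: "k > 0" unfolding k_def using \<epsilon> A by simp
  define \<kappa> where "\<kappa> z = of_real (a z) * (cnj (f z))\<^sup>2 / of_real ((cmod (f z))\<^sup>2 + k\<^sup>2)" for z
  \<comment> \<open>Division by \<open>\<eta>\<close> makes \<open>\<eta> * h\<close> equal to
    \<open>\<kappa>\<close> on the inner disc without a plateau in the cutoff; the maximum with 9
    keeps \<open>h\<close> continuous where \<open>\<eta>\<close> is small.\<close>
  define h where "h z = \<kappa> z / of_real (max 9 (\<eta> z))" for z
  have den: "(cmod (f z))\<^sup>2 + k\<^sup>2 > 0" for z using k by (intro add_nonneg_pos) auto
  have \<kappa>A: "cmod (\<kappa> z) \<le> A" if "z \<in> K" for z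
  proof -
    have "cmod (\<kappa> z) = \<bar>a z\<bar> * ((cmod (f z))\<^sup>2 / ((cmod (f z))\<^sup>2 + k\<^sup>2))"
      unfolding \<kappa>_def using den[of z] by (simp add: norm_mult norm_divide norm_power del: of_real_add of_real_power)
    also have "\<dots> \<le> A * 1" using aA that A den[of z] unfolding K_def by (intro mult_mono) auto
    finally show ?thesis by simp
  qed
  have hA: "cmod (h z) \<le> A / 9" if "z \<in> K" for z
  proof -
    have "cmod (h z) = cmod (\<kappa> z) / max 9 (\<eta> z)" unfolding h_def by (simp add: norm_divide)
    also have "\<dots> \<le> A / 9" using \<kappa>A[OF that] A by (intro frac_le) auto
    finally show ?thesis .
  qed
  have hc: "continuous_on K h"
  proof -
    have "complex_of_real ((cmod (f z))\<^sup>2 + k\<^sup>2) \<noteq> 0" for z using den[of z] by (metis less_irrefl of_real_eq_0_iff)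
    moreover have "complex_of_real (max 9 (\<eta> z)) \<noteq> 0" for z using of_real_eq_0_iff[of "max 9 (\<eta> z)"] by auto
    ultimately show ?thesis unfolding h_def \<kappa>_def K_def by (intro continuous_intros fc ac \<eta>c) auto
  qed
  \<comment> \<open>The first entry gives |p| \<le> A/9 + A/72 = A/8 and hence |b| \<le> 16 A/8 =
    2A; the second bounds the approximation error 16 M e by \<epsilon>/2.\<close>
  define e where "e = min (A / 72) (\<epsilon> / (32 * M))"
  have e: "e > 0" "e \<le> A / 72" "e \<le> \<epsilon> / (32 * M)" unfolding e_def using A \<epsilon> M by auto
  obtain p where p: "polynomial_function p" "\<And>z. z \<in> K \<Longrightarrow> cmod (h z - p z) < e"
    using Stone_Weierstrass_polynomial_function[OF Kc hc e(1)] by blast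
  obtain px py where pC1: "C1_on UNIV p px py" using C1_polynomial_function[OF p(1)] .
  define b where "b z = of_real (\<eta> z) * p z" for z
  have b0: "b z = 0" if "2 * \<rho> \<le> dist c z" for z unfolding b_def using \<eta>0[OF that] by simp
  have bB: "cmod (b z) \<le> 2 * A" for z
  proof (cases "z \<in> K")
    case True
    have "cmod (p z) \<le> cmod (h z) + cmod (h z - p z)" by (metis norm_triangle_sub norm_minus_commute)
    also have "\<dots> \<le> A / 9 + A / 72" using hA[OF True] p(2)[OF True] e by linarith
    finally have "cmod (p z) \<le> A / 8" by simp
    hence "\<eta> z * cmod (p z) \<le> 16 * (A / 8)" using \<eta>16[of z] by (intro mult_mono) auto
    thus ?thesis unfolding b_def using \<eta>16[of z] by (simp add: norm_mult)
  next
    case False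
    thus ?thesis using b0[of z] A unfolding K_def by simp
  qed
  \<comment> \<open>A circle of radius 3\<rho> about a point of the inner disc stays at distance at
    least 2\<rho> from \<open>c\<close>, outside the support of \<open>b\<close>. The resulting
    bound for \<open>s\<close> is 3\<rho> times 2A.\<close>
  have R3: "0 < 3 * \<rho>" using \<rho> by simp
  obtain s sx sy where s: "C1_on UNIV s sx sy" "\<And>z. cmod (s z) \<le> 3 * \<rho> * (2 * A)"
    "\<And>z. (\<And>\<theta>. b (z - of_real (3 * \<rho>) * cis \<theta>) = 0) \<Longrightarrow> sx z + \<i> * sy z = b z"
    using dbar_primitive[OF C1_on_mult[OF \<eta>C1 pC1, folded b_def] R3 bB] by blast
  show thesis
  proof (rule that[OF s(1)])
    show "cmod (s z) \<le> 6 * A * \<rho>" for z using s(2)[of z] by (simp add: algebra_simps)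
    fix z assume z: "z \<in> cball c \<rho>"
    hence zK: "z \<in> K" unfolding K_def using \<rho> by simp
    have "b (z - of_real (3 * \<rho>) * cis \<theta>) = 0" for \<theta>
    proof (rule b0)
      have "dist z (z - of_real (3 * \<rho>) * cis \<theta>) = 3 * \<rho>" unfolding dist_norm using \<rho> by (simp add: norm_mult)
      moreover have "dist z (z - of_real (3 * \<rho>) * cis \<theta>) \<le> dist c z + dist c (z - of_real (3 * \<rho>) * cis \<theta>)"
        by (metis dist_commute dist_triangle)
      ultimately show "2 * \<rho> \<le> dist c (z - of_real (3 * \<rho>) * cis \<theta>)" using z by simp
    qed
    hence sb: "sx z + \<i> * sy z = b z" by (rule s(3))
    have \<kappa>h: "\<kappa> z = of_real (\<eta> z) * h z" unfolding h_def using \<eta>9[OF z] by (auto simp: max_def)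
    have 1: "of_real (a z) * cnj (f z) - f z * \<kappa> z = of_real (a z) * cnj (f z) * of_real (k\<^sup>2 / ((cmod (f z))\<^sup>2 + k\<^sup>2))"
    proof -
      have "f z * (cnj (f z))\<^sup>2 = of_real ((cmod (f z))\<^sup>2) * cnj (f z)"
        unfolding complex_norm_square by (simp add: power2_eq_square)
      hence "f z * \<kappa> z = of_real (a z) * cnj (f z) * (of_real ((cmod (f z))\<^sup>2) / of_real ((cmod (f z))\<^sup>2 + k\<^sup>2))"
        unfolding \<kappa>_def by (simp add: algebra_simps del: of_real_add of_real_power)
      also have "\<dots> = of_real (a z) * cnj (f z) * of_real ((cmod (f z))\<^sup>2 / ((cmod (f z))\<^sup>2 + k\<^sup>2))"
        by (simp only: of_real_divide)
      finally have "of_real (a z) * cnj (f z) - f z * \<kappa> z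
          = of_real (a z) * cnj (f z) * of_real (1 - (cmod (f z))\<^sup>2 / ((cmod (f z))\<^sup>2 + k\<^sup>2))"
        by (simp only: of_real_diff of_real_1 right_diff_distrib mult_1_right)
      moreover have "1 - (cmod (f z))\<^sup>2 / ((cmod (f z))\<^sup>2 + k\<^sup>2) = k\<^sup>2 / ((cmod (f z))\<^sup>2 + k\<^sup>2)"
      proof -
        define d where "d = (cmod (f z))\<^sup>2 + k\<^sup>2"
        have "d \<noteq> 0" "k\<^sup>2 = d - (cmod (f z))\<^sup>2" using den[of z] unfolding d_def by auto
        thus ?thesis unfolding d_def[symmetric] by (simp add: diff_divide_distrib)
      qed
      ultimately show ?thesis by simp
    qed
    have 2: "cmod (of_real (a z) * cnj (f z) - f z * \<kappa> z) \<le> A * k"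
    proof -
      define x where "x = cmod (f z)"
      have "0 \<le> x * k" using k unfolding x_def by simp
      moreover have "2 * (x * k) \<le> x\<^sup>2 + k\<^sup>2" using zero_le_power2[of "x - k"] by (simp add: power2_diff)
      ultimately have "k * (x * k) \<le> k * (x\<^sup>2 + k\<^sup>2)" using k by (intro mult_left_mono) auto
      hence "x * k\<^sup>2 \<le> k * (x\<^sup>2 + k\<^sup>2)" by (simp add: power2_eq_square algebra_simps)
      hence xk: "x * (k\<^sup>2 / (x\<^sup>2 + k\<^sup>2)) \<le> k" using den[of z] unfolding x_def by (simp add: divide_le_eq)
      have "cmod (of_real (a z) * cnj (f z) - f z * \<kappa> z) = \<bar>a z\<bar> * (x * (k\<^sup>2 / (x\<^sup>2 + k\<^sup>2)))"
        unfolding 1 x_def using den[of z] by (simp add: norm_mult del: of_real_divide of_real_add of_real_power)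
      also have "\<dots> \<le> A * k" using aA[of z] zK xk A k unfolding K_def x_def
        by (intro mult_mono) auto
      finally show ?thesis .
    qed
    have 3: "cmod (f z * (\<kappa> z - b z)) \<le> M * (16 * e)"
      unfolding norm_mult
    proof (rule mult_mono)
      have "\<kappa> z - b z = of_real (\<eta> z) * (h z - p z)" unfolding \<kappa>h b_def by (simp add: algebra_simps)
      hence "cmod (\<kappa> z - b z) = \<eta> z * cmod (h z - p z)" using \<eta>16[of z] by (simp add: norm_mult)
      also have "\<dots> \<le> 16 * e" using \<eta>16[of z] p(2)[OF zK] by (intro mult_mono) auto
      finally show "cmod (\<kappa> z - b z) \<le> 16 * e" .
    qed (use M zK in auto)
    have "M * (16 * e) \<le> \<epsilon> / 2" using e(3) M by (simp add: field_simps)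
    moreover have "A * k = \<epsilon> / 2" unfolding k_def using A by simp
    moreover have eq: "of_real (a z) * cnj (f z) - f z * (sx z + \<i> * sy z)
        = (of_real (a z) * cnj (f z) - f z * \<kappa> z) + f z * (\<kappa> z - b z)"
      unfolding sb by (simp add: algebra_simps)
    ultimately show "cmod (of_real (a z) * cnj (f z) - f z * (sx z + \<i> * sy z)) \<le> \<epsilon>"
      unfolding eq
      using 2 3 norm_triangle_ineq[of "of_real (a z) * cnj (f z) - f z * \<kappa> z" "f z * (\<kappa> z - b z)"] by linarith
  qed
qed

text \<open>The nodes enter through the partial fraction expansion of \<open>1 / \<Prod>(\<zeta> - w)\<close> over the nodes and the
  centre \<open>c\<close>, integrated against \<open>f e\<^sup>-\<^sup>s\<close>: this is Lagrange interpolation with Hermite's remainder.\<close>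

lemma vekua_interpolation_estimate:
  fixes f :: "complex \<Rightarrow> complex" and a :: "complex \<Rightarrow> real" and x :: "nat \<Rightarrow> complex"
  assumes \<rho>: "0 < \<rho>" and A: "0 < A"
    and f: "C1_on U f fx fy" and U: "cball c (2 * \<rho>) \<subseteq> U"
    and ac: "continuous_on (cball c (2 * \<rho>)) a"
    and aA: "\<And>z. z \<in> cball c (2 * \<rho>) \<Longrightarrow> \<bar>a z\<bar> \<le> A"
    and eq: "\<And>z. z \<in> cball c \<rho> \<Longrightarrow> fx z + \<i> * fy z = of_real (a z) * cnj (f z)"
    and N: "0 < N" and inj: "inj_on x {..<N}"
    and xc: "\<And>j. j < N \<Longrightarrow> dist c (x j) \<le> \<rho> / 5"
    and M: "\<And>z. z \<in> sphere c \<rho> \<Longrightarrow> cmod (f z) \<le> M"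
    and \<delta>: "\<And>j. j < N \<Longrightarrow> cmod (f (x j)) \<le> \<delta>"
    and L: "1 \<le> L" "\<And>j. j < N \<Longrightarrow> (\<Prod>i\<in>{..<N} - {j}. dist c (x i) / dist (x j) (x i)) \<le> L"
  shows "cmod (f c) \<le> exp (12 * A * \<rho>) * (N * L * \<delta> + M / 4 ^ N)"
proof -
  have "c + of_real \<rho> \<in> sphere c \<rho>" using \<rho> by (simp add: dist_norm)
  from order_trans[OF norm_ge_zero M[OF this]] have M0: "0 \<le> M" .
  have \<delta>0: "0 \<le> \<delta>" by (rule order_trans[OF norm_ge_zero \<delta>[OF N]])
  show ?thesis
  \<comment> \<open>If the centre is itself a node, the partial fractions would meet a double root,
    but then \<open>\<delta>\<close> bounds \<open>f c\<close> directly.\<close>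
  proof (cases "c \<in> x ` {..<N}")
    case True
    then obtain j where j: "j < N" "c = x j" by auto
    have "1 * 1 \<le> real N * L" using N L by (intro mult_mono) auto
    hence "1 * \<delta> \<le> (N * L) * \<delta>" using \<delta>0 by (intro mult_right_mono) auto
    hence "\<delta> \<le> N * L * \<delta>" by simp
    moreover have "cmod (f c) \<le> \<delta>" using \<delta>[OF j(1)] j(2) by simp
    moreover have Mp: "0 \<le> M / 4 ^ N" using M0 by simp
    ultimately have "cmod (f c) \<le> 1 * (N * L * \<delta> + M / 4 ^ N)"
      unfolding mult_1_left using add_increasing2[of "M / 4 ^ N" "cmod (f c)" "N * L * \<delta>"] by linarith
    also have "\<dots> \<le> exp (12 * A * \<rho>) * (N * L * \<delta> + M / 4 ^ N)"
      using L \<delta>0 Mp A \<rho> by (intro mult_right_mono) auto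
    finally show ?thesis .
  next
    case cx: False
    define X where "X = x ` {..<N}"
    define W where "W = insert c X"
    have Wf: "finite W" "W \<noteq> {}" "finite X" "c \<notin> X" unfolding W_def X_def using cx by auto
    have Wball: "w \<in> ball c \<rho>" if "w \<in> W" for w
    proof -
      have "dist c w \<le> \<rho> / 5" using that xc \<rho> unfolding W_def X_def by auto
      thus ?thesis using \<rho> by simp
    qed
    have sW: "z \<notin> W" if "z \<in> sphere c \<rho>" for z using Wball[of z] that by auto
    \<comment> \<open>Residues of the reciprocal node polynomial, that is, barycentric weights for
      the nodes together with \<open>c\<close>.\<close>
    define k where "k w = 1 / (\<Prod>u\<in>W - {w}. w - u)" for w
    \<comment> \<open>Multiplying by \<open>Q\<close> gives the weight of \<open>c\<close> modulus 1
      and turns the weights of the nodes into the moduli of the Lagrange basis polynomials at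
      \<open>c\<close>.\<close>
    define Q where "Q = (\<Prod>w\<in>X. dist c w)"
    have Q0: "Q > 0" unfolding Q_def using Wf by (intro prod_pos) auto
    have QN: "Q \<le> (\<rho> / 5) ^ N"
    proof -
      have "Q \<le> (\<Prod>w\<in>X. \<rho> / 5)" unfolding Q_def X_def using xc by (intro prod_mono) auto
      thus ?thesis unfolding X_def by (simp add: card_image[OF inj])
    qed
    have kc: "cmod (k c) = 1 / Q"
    proof -
      have "W - {c} = X" unfolding W_def using Wf by auto
      thus ?thesis unfolding k_def Q_def by (simp add: norm_divide prod_norm[symmetric] dist_norm)
    qed
    have kx: "Q * cmod (k (x j)) \<le> L" if j: "j < N" for j
    proof -
      have "W - {x j} = insert c (x ` ({..<N} - {j}))"
        unfolding W_def X_def using inj j cx by (auto simp: inj_on_def)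
      moreover have "c \<notin> x ` ({..<N} - {j})" using cx by auto
      ultimately have "(\<Prod>u\<in>W - {x j}. x j - u) = (x j - c) * (\<Prod>i\<in>{..<N} - {j}. x j - x i)"
        by (simp add: prod.reindex[OF inj_on_subset[OF inj, of "{..<N} - {j}"]] comp_def)
      hence kj: "cmod (k (x j)) = 1 / (dist (x j) c * (\<Prod>i\<in>{..<N} - {j}. dist (x j) (x i)))"
        unfolding k_def by (simp add: norm_divide norm_mult prod_norm[symmetric] dist_norm)
      moreover have Qj: "Q = dist c (x j) * (\<Prod>i\<in>{..<N} - {j}. dist c (x i))"
        unfolding Q_def X_def prod.reindex[OF inj] comp_def using j by (intro prod.remove) auto
      moreover have d: "dist c (x j) \<noteq> 0" using j cx by auto
      ultimately have "Q * cmod (k (x j)) = (\<Prod>i\<in>{..<N} - {j}. dist c (x i) / dist (x j) (x i))"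
        unfolding kj Qj dist_commute[of "x j" c] prod_dividef using d by simp
      thus ?thesis using L(2)[OF j] by simp
    qed
    define S where "S = 6 * A * \<rho>"
    define T where "T = (\<Sum>w\<in>W. cmod (k w))"
    have "cmod (f c) * exp (- S) \<le> exp S * (N * L * \<delta> + M / 4 ^ N) + e" if e: "e > 0" for e
    proof -
      \<comment> \<open>Chosen so that the deviation of \<open>G\<close> from holomorphy, summed
        over all weights and multiplied by \<open>Q\<close>, contributes at most e T/(T +
        1).\<close>
      define \<epsilon> where "\<epsilon> = e / (Q * \<rho> * exp S * (T + 1))"
      have T0: "T \<ge> 0" unfolding T_def by (intro sum_nonneg) auto
      have \<epsilon>: "\<epsilon> > 0" unfolding \<epsilon>_def using e Q0 \<rho> T0 by auto
      obtain s sx sy where s: "C1_on UNIV s sx sy" "\<And>z. cmod (s z) \<le> S"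
        "\<And>z. z \<in> cball c \<rho> \<Longrightarrow> cmod (of_real (a z) * cnj (f z) - f z * (sx z + \<i> * sy z)) \<le> \<epsilon>"
        using approximate_similarity[OF \<rho> A continuous_on_subset[OF C1_onD(4)[OF f] U] ac aA \<epsilon>]
        unfolding S_def by blast
      define G where "G z = f z * exp (- s z)" for z
      obtain Gx Gy where GC: "C1_on U G Gx Gy" and Gd: "\<And>z. Gx z + \<i> * Gy z = exp (- s z) * ((fx z + \<i> * fy z) - f z * (sx z + \<i> * sy z))"
        using C1_on_mult[OF f C1_on_exp[OF C1_on_uminus[OF C1_on_subset[OF s(1) subset_UNIV]]], folded G_def]
        by (rule that) (simp add: algebra_simps)
      have es: "cmod (exp (- s z)) \<le> exp S" "exp (- S) \<le> cmod (exp (- s z))" for z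
        using s(2)[of z] abs_Re_le_cmod[of "s z"] by auto
      have Gle: "cmod (G z) \<le> cmod (f z) * exp S" for z
        unfolding G_def norm_mult using es by (intro mult_left_mono) auto
      have GdB: "cmod (Gx z + \<i> * Gy z) \<le> exp S * \<epsilon>" if "z \<in> cball c \<rho>" for z
        unfolding Gd eq[OF that] norm_mult using es s(3)[OF that] by (intro mult_mono) auto
      have Usub: "cball c \<rho> \<subseteq> U" using U \<rho> by (auto intro: order_trans)
      have Gcont: "continuous_on (sphere c \<rho>) G"
        using C1_onD(4)[OF GC] Usub by (rule continuous_on_subset[OF _ order_trans[OF sphere_cball]])
      have ci: "(\<lambda>\<zeta>. G \<zeta> / (\<zeta> - w)) contour_integrable_on circlepath c \<rho>" if "w \<in> W" for w
        using Wball[OF that] \<rho> by (intro contour_integrable_continuous_circlepath continuous_intros continuous_on_subset[OF Gcont]) auto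
      have main: "cmod (contour_integral (circlepath c \<rho>) (\<lambda>\<zeta>. G \<zeta> / (\<zeta> - w)) - 2 * pi * \<i> * G w) \<le> 2 * pi * \<rho> * (exp S * \<epsilon>)"
        if "w \<in> W" for w
        using Cauchy_integral_almost_holomorphic[OF GC Usub Wball[OF that] GdB] .
      define I where "I = contour_integral (circlepath c \<rho>) (\<lambda>\<zeta>. G \<zeta> * (1 / (\<Prod>w\<in>W. \<zeta> - w)))"
      have Ieq: "I = (\<Sum>w\<in>W. k w * contour_integral (circlepath c \<rho>) (\<lambda>\<zeta>. G \<zeta> / (\<zeta> - w)))"
      proof -
        have "I = contour_integral (circlepath c \<rho>) (\<lambda>\<zeta>. \<Sum>w\<in>W. k w * (G \<zeta> / (\<zeta> - w)))"
          unfolding I_def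
        proof (rule contour_integral_eq)
          fix \<zeta> assume "\<zeta> \<in> path_image (circlepath c \<rho>)"
          hence \<zeta>W: "\<zeta> \<notin> W" using sW \<rho> by auto
          show "G \<zeta> * (1 / (\<Prod>w\<in>W. \<zeta> - w)) = (\<Sum>w\<in>W. k w * (G \<zeta> / (\<zeta> - w)))"
            unfolding partial_fractions_distinct_roots[OF Wf(1,2) \<zeta>W, symmetric] sum_distrib_left k_def
            by (rule sum.cong) auto
        qed
        also have "\<dots> = (\<Sum>w\<in>W. contour_integral (circlepath c \<rho>) (\<lambda>\<zeta>. k w * (G \<zeta> / (\<zeta> - w))))"
          using ci by (intro contour_integral_sum Wf(1) contour_integrable_lmul)
        also have "\<dots> = (\<Sum>w\<in>W. k w * contour_integral (circlepath c \<rho>) (\<lambda>\<zeta>. G \<zeta> / (\<zeta> - w)))"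
          using ci by (intro sum.cong contour_integral_lmul) auto
        finally show ?thesis .
      qed
      \<comment> \<open>This is Hermite's remainder. On the circle every node is at distance at
        least 4\<rho>/5, while nodes are within \<rho>/5 of the centre; after multiplication by
        \<open>Q\<close> each node gains a factor 1/4.\<close>
      have IB: "cmod I \<le> (M * exp S / (\<rho> * (4 * \<rho> / 5) ^ N)) * (2 * pi * \<rho>)"
        unfolding I_def
      proof (rule has_contour_integral_bound_circlepath[OF has_contour_integral_integral])
        have "continuous_on (sphere c \<rho>) (\<lambda>\<zeta>. G \<zeta> * (1 / (\<Prod>w\<in>W. \<zeta> - w)))"
          using Wf(1) sW by (intro continuous_intros Gcont) auto
        thus "(\<lambda>\<zeta>. G \<zeta> * (1 / (\<Prod>w\<in>W. \<zeta> - w))) contour_integrable_on circlepath c \<rho>"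
          using \<rho> by (intro contour_integrable_continuous_circlepath) auto
        show "0 \<le> M * exp S / (\<rho> * (4 * \<rho> / 5) ^ N)" using M0 \<rho> by auto
        fix z assume z: "cmod (z - c) = \<rho>"
        hence zs: "z \<in> sphere c \<rho>" by (simp add: dist_norm norm_minus_commute)
        have "\<rho> * (4 * \<rho> / 5) ^ N \<le> cmod (\<Prod>w\<in>W. z - w)"
        proof -
          have "(\<Prod>w\<in>X. 4 * \<rho> / 5) \<le> (\<Prod>w\<in>X. cmod (z - w))"
          proof (rule prod_mono)
            fix w assume "w \<in> X"
            hence "dist c w \<le> \<rho> / 5" using xc unfolding X_def by auto
            moreover have "dist c z \<le> dist c w + dist w z" by (rule dist_triangle)
            ultimately show "0 \<le> 4 * \<rho> / 5 \<and> 4 * \<rho> / 5 \<le> cmod (z - w)"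
              using zs \<rho> by (simp add: dist_norm norm_minus_commute)
          qed
          hence "(4 * \<rho> / 5) ^ N \<le> (\<Prod>w\<in>X. cmod (z - w))" unfolding X_def by (simp add: card_image[OF inj])
          hence "\<rho> * (4 * \<rho> / 5) ^ N \<le> cmod (z - c) * (\<Prod>w\<in>X. cmod (z - w))"
            unfolding z using \<rho> by simp
          thus ?thesis unfolding W_def using Wf by (simp add: norm_mult prod_norm)
        qed
        moreover have "cmod (G z) \<le> M * exp S" using Gle[of z] M[OF zs] by (meson exp_ge_zero mult_right_mono order_trans)
        ultimately have "cmod (G z) / cmod (\<Prod>w\<in>W. z - w) \<le> M * exp S / (\<rho> * (4 * \<rho> / 5) ^ N)"
          using M0 \<rho> by (intro frac_le) auto
        thus "cmod (G z * (1 / (\<Prod>w\<in>W. z - w))) \<le> M * exp S / (\<rho> * (4 * \<rho> / 5) ^ N)"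
          by (simp add: norm_divide)
      qed (use \<rho> in auto)
      have "cmod (I - 2 * pi * \<i> * (\<Sum>w\<in>W. k w * G w))
          = cmod (\<Sum>w\<in>W. k w * (contour_integral (circlepath c \<rho>) (\<lambda>\<zeta>. G \<zeta> / (\<zeta> - w)) - 2 * pi * \<i> * G w))"
        unfolding Ieq sum_distrib_left right_diff_distrib sum_subtractf by (simp add: mult_ac)
      also have "\<dots> \<le> (\<Sum>w\<in>W. cmod (k w) * (2 * pi * \<rho> * (exp S * \<epsilon>)))"
        by (rule sum_norm_le) (use main in \<open>auto simp: norm_mult intro!: mult_left_mono\<close>)
      also have "\<dots> = 2 * pi * (\<rho> * exp S * \<epsilon> * T)" unfolding T_def sum_distrib_right[symmetric] by simp
      finally have "2 * pi * cmod (\<Sum>w\<in>W. k w * G w) \<le> cmod I + 2 * pi * (\<rho> * exp S * \<epsilon> * T)"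
        using norm_triangle_ineq2[of "2 * pi * \<i> * (\<Sum>w\<in>W. k w * G w)" I]
        by (simp add: norm_mult norm_minus_commute)
      also have "\<dots> \<le> 2 * pi * (M * exp S / (4 * \<rho> / 5) ^ N + \<rho> * exp S * \<epsilon> * T)"
        using IB \<rho> by (simp add: algebra_simps)
      finally have sumB: "cmod (\<Sum>w\<in>W. k w * G w) \<le> M * exp S / (4 * \<rho> / 5) ^ N + \<rho> * exp S * \<epsilon> * T"
        by (simp add: mult_le_cancel_left)
      have "(\<Sum>w\<in>W. k w * G w) = k c * G c + (\<Sum>w\<in>X. k w * G w)"
        unfolding W_def using Wf by simp
      hence "cmod (k c * G c) \<le> cmod (\<Sum>w\<in>W. k w * G w) + cmod (\<Sum>w\<in>X. k w * G w)"
        using norm_triangle_ineq4[of "\<Sum>w\<in>W. k w * G w" "\<Sum>w\<in>X. k w * G w"] by simp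
      moreover have "cmod (\<Sum>w\<in>X. k w * G w) \<le> (\<Sum>j<N. cmod (k (x j)) * (\<delta> * exp S))"
        unfolding X_def sum.reindex[OF inj] comp_def
      proof (rule sum_norm_le)
        fix j assume "j \<in> {..<N}"
        hence "cmod (G (x j)) \<le> \<delta> * exp S" using Gle[of "x j"] \<delta>[of j] by (meson exp_ge_zero lessThan_iff mult_right_mono order_trans)
        thus "cmod (k (x j) * G (x j)) \<le> cmod (k (x j)) * (\<delta> * exp S)" unfolding norm_mult by (intro mult_left_mono) auto
      qed
      ultimately have "Q * (cmod (k c * G c)) \<le> Q * ((M * exp S / (4 * \<rho> / 5) ^ N + \<rho> * exp S * \<epsilon> * T) + (\<Sum>j<N. cmod (k (x j)) * (\<delta> * exp S)))"
        using sumB Q0 by (intro mult_left_mono) auto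
      also have "\<dots> = exp S * M * (Q / (4 * \<rho> / 5) ^ N) + Q * \<rho> * exp S * T * \<epsilon> + (\<Sum>j<N. Q * cmod (k (x j)) * (\<delta> * exp S))"
        by (simp add: algebra_simps sum_distrib_left)
      also have "Q * \<rho> * exp S * T * \<epsilon> = e * (T / (T + 1))"
      proof -
        define d where "d = Q * \<rho> * exp S"
        have "d \<noteq> 0" unfolding d_def using Q0 \<rho> by simp
        thus ?thesis unfolding \<epsilon>_def d_def[symmetric] by simp
      qed
      also have "e * (T / (T + 1)) \<le> e * 1" using e T0 by (intro mult_left_mono) auto
      also have "(\<Sum>j<N. Q * cmod (k (x j)) * (\<delta> * exp S)) \<le> (\<Sum>j<N. L * (\<delta> * exp S))"
        using kx \<delta>0 by (intro sum_mono mult_right_mono) auto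
      also have "exp S * M * (Q / (4 * \<rho> / 5) ^ N) \<le> exp S * M * (1 / 4 ^ N)"
      proof (rule mult_left_mono)
        have "Q / (4 * \<rho> / 5) ^ N \<le> (\<rho> / 5) ^ N / (4 * \<rho> / 5) ^ N" using QN \<rho> by (intro divide_right_mono) auto
        also have "\<dots> = 1 / 4 ^ N" using \<rho> by (simp add: power_divide power_mult_distrib)
        finally show "Q / (4 * \<rho> / 5) ^ N \<le> 1 / 4 ^ N" .
      qed (use M0 in auto)
      finally have "Q * cmod (k c * G c) \<le> exp S * (N * L * \<delta> + M / 4 ^ N) + e"
        by (simp add: algebra_simps)
      moreover have "Q * cmod (k c * G c) = cmod (G c)" using kc Q0 by (simp add: norm_mult)
      moreover have "cmod (f c) * exp (- S) \<le> cmod (G c)" unfolding G_def norm_mult using es by (intro mult_left_mono) auto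
      ultimately show ?thesis by linarith
    qed
    \<comment> \<open>The arbitrary error e is gone. The factor exp S enters twice, once in passing
      from \<open>f\<close> to \<open>G\<close> on the circle and at the nodes, once in returning at
      the centre.\<close>
    hence "cmod (f c) * exp (- S) \<le> exp S * (N * L * \<delta> + M / 4 ^ N)" by (rule field_le_epsilon)
    hence "cmod (f c) * exp (- S) * exp S \<le> exp S * (N * L * \<delta> + M / 4 ^ N) * exp S" by (rule mult_right_mono) auto
    also have "exp S * (N * L * \<delta> + M / 4 ^ N) * exp S = exp (S + S) * (N * L * \<delta> + M / 4 ^ N)"
      unfolding exp_add by (simp only: mult_ac)
    also have "S + S = 12 * A * \<rho>" unfolding S_def by simp
    also have "cmod (f c) * exp (- S) * exp S = cmod (f c)" by (simp add: exp_minus)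
    finally show ?thesis .
  qed
qed

section \<open>Primitives of bounded integrable functions\<close>

text \<open>Lipschitz functions given as indefinite integrals. The identity is integrated because V
  need not be continuous, and the bound is pointwise, so Lipschitz estimates need no exceptional
  sets.\<close>

definition primitive_on :: "real \<Rightarrow> real \<Rightarrow> (real \<Rightarrow> real) \<Rightarrow> (real \<Rightarrow> real) \<Rightarrow> bool"
  where "primitive_on a b F f \<longleftrightarrow>
    (\<forall>x y. a \<le> x \<longrightarrow> x \<le> y \<longrightarrow> y \<le> b \<longrightarrow> (f has_integral (F y - F x)) {x..y}) \<and>
    (\<exists>M. \<forall>x\<in>{a..b}. \<bar>f x\<bar> \<le> M)"

lemma primitive_onD:
  "primitive_on a b F f \<Longrightarrow> a \<le> x \<Longrightarrow> x \<le> y \<Longrightarrow> y \<le> b \<Longrightarrow> (f has_integral (F y - F x)) {x..y}"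
  unfolding primitive_on_def by blast

lemma primitive_on_bounded:
  assumes "primitive_on a b F f"
  obtains M where "M > 0" "\<And>x. x \<in> {a..b} \<Longrightarrow> \<bar>f x\<bar> \<le> M"
proof -
  obtain M where M: "\<forall>x\<in>{a..b}. \<bar>f x\<bar> \<le> M" using assms unfolding primitive_on_def by blast
  show thesis by (rule that[of "max 1 M"]) (use M in \<open>auto simp: le_max_iff_disj\<close>)
qed

lemma has_integral_abs_le:
  fixes f :: "real \<Rightarrow> real"
  assumes "(f has_integral I) {x..y}" "\<And>t. t \<in> {x..y} \<Longrightarrow> \<bar>f t\<bar> \<le> B" "x \<le> y" "0 \<le> B"
  shows "\<bar>I\<bar> \<le> B * (y - x)"
  using has_integral_bound[of B f I x y] assms by (simp add: cbox_interval)

lemma primitive_on_lipschitz: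
  assumes "primitive_on a b F f" "\<And>x. x \<in> {a..b} \<Longrightarrow> \<bar>f x\<bar> \<le> M" "x \<in> {a..b}" "y \<in> {a..b}" "0 \<le> M"
  shows "\<bar>F x - F y\<bar> \<le> M * \<bar>x - y\<bar>"
proof -
  have le: "\<bar>F v - F u\<bar> \<le> M * (v - u)" if "u \<le> v" "u \<in> {a..b}" "v \<in> {a..b}" for u v
    by (rule has_integral_abs_le[OF primitive_onD[OF assms(1)]]) (use assms that in auto)
  show ?thesis using le[of x y] le[of y x] assms(3,4) by (cases "x \<le> y") (auto simp: abs_minus_commute)
qed

lemma primitive_on_continuous:
  assumes "primitive_on a b F f"
  shows "continuous_on {a..b} F"
proof -
  obtain M where M: "M > 0" "\<And>x. x \<in> {a..b} \<Longrightarrow> \<bar>f x\<bar> \<le> M" using primitive_on_bounded[OF assms] by blast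
  have "M-lipschitz_on {a..b} F"
    unfolding lipschitz_on_def dist_real_def using primitive_on_lipschitz[OF assms M(2)] M(1) by auto
  thus ?thesis by (rule lipschitz_on_continuous_on)
qed

lemma bounded_integrable_mult_continuous:
  fixes f G :: "real \<Rightarrow> real"
  assumes "f integrable_on {x..y}" "\<And>t. t \<in> {x..y} \<Longrightarrow> \<bar>f t\<bar> \<le> M" "continuous_on {x..y} G"
  shows "(\<lambda>t. f t * G t) integrable_on {x..y}"
proof -
  have "f absolutely_integrable_on {x..y}"
    by (rule absolutely_integrable_integrable_bound[of _ _ "\<lambda>_. M"]) (use assms in auto)
  moreover have "bounded (G ` {x..y})" using assms(3) by (simp add: compact_continuous_image compact_imp_bounded)
  moreover have "G \<in> borel_measurable (lebesgue_on {x..y})"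
    using assms(3) by (simp add: continuous_imp_measurable_on_sets_lebesgue)
  ultimately have "(\<lambda>t. G t * f t) absolutely_integrable_on {x..y}"
    by (intro absolutely_integrable_bounded_measurable_product_real) auto
  from set_lebesgue_integral_eq_integral(1)[OF this] show ?thesis by (simp add: mult.commute)
qed

text \<open>Integration by parts without pointwise derivatives: the difference \<open>D\<close>
  between the product and the integral of the expected derivative has increments of second order in
  y - x, so its derivative is 0 everywhere and it is constant.\<close>

lemma primitive_on_mult:
  assumes F: "primitive_on a b F f" and G: "primitive_on a b G g"
  shows "primitive_on a b (\<lambda>x. F x * G x) (\<lambda>x. f x * G x + F x * g x)"
proof -
  obtain Mf where Mf: "Mf > 0" "\<And>x. x \<in> {a..b} \<Longrightarrow> \<bar>f x\<bar> \<le> Mf" using primitive_on_bounded[OF F] by blast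
  obtain Mg where Mg: "Mg > 0" "\<And>x. x \<in> {a..b} \<Longrightarrow> \<bar>g x\<bar> \<le> Mg" using primitive_on_bounded[OF G] by blast
  note Fc = primitive_on_continuous[OF F] and Gc = primitive_on_continuous[OF G]
  obtain BF BG where B: "\<And>x. x \<in> {a..b} \<Longrightarrow> \<bar>F x\<bar> \<le> BF" "\<And>x. x \<in> {a..b} \<Longrightarrow> \<bar>G x\<bar> \<le> BG"
    using compact_continuous_image[OF Fc] compact_continuous_image[OF Gc]
    by (metis compact_Icc compact_imp_bounded bounded_real imageI)
  define h where "h x = f x * G x + F x * g x" for x
  have hB: "\<bar>h x\<bar> \<le> Mf * BG + BF * Mg" if "x \<in> {a..b}" for x
  proof -
    have "\<bar>f x * G x\<bar> \<le> Mf * BG" "\<bar>F x * g x\<bar> \<le> BF * Mg"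
      unfolding abs_mult using Mf Mg B that by (auto intro!: mult_mono intro: order_trans[OF abs_ge_zero])
    thus ?thesis unfolding h_def by linarith
  qed
  have hint: "h integrable_on {x..y}" if "a \<le> x" "x \<le> y" "y \<le> b" for x y
  proof -
    have s: "{x..y} \<subseteq> {a..b}" using that by auto
    have "(\<lambda>t. f t * G t) integrable_on {x..y}"
      by (rule bounded_integrable_mult_continuous[where M=Mf, OF _ _ continuous_on_subset[OF Gc s]])
        (use primitive_onD[OF F that] Mf(2) s in auto)
    moreover have "(\<lambda>t. g t * F t) integrable_on {x..y}"
      by (rule bounded_integrable_mult_continuous[where M=Mg, OF _ _ continuous_on_subset[OF Fc s]])
        (use primitive_onD[OF G that] Mg(2) s in auto)
    ultimately show ?thesis unfolding h_def using integrable_add by (simp add: mult.commute)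
  qed
  define D where "D x = F x * G x - integral {a..x} h" for x
  have quad: "\<bar>D y - D x\<bar> \<le> 2 * Mf * Mg * (y - x)\<^sup>2" if xy: "a \<le> x" "x \<le> y" "y \<le> b" for x y
  proof -
    have "integral {a..x} h + integral {x..y} h = integral {a..y} h"
      by (rule Henstock_Kurzweil_Integration.integral_combine) (use xy hint[of a y] in auto)
    hence Dd: "D y - D x = F y * (G y - G x) + (F y - F x) * G x - integral {x..y} h"
      unfolding D_def by (simp add: algebra_simps)
    have "((\<lambda>t. F y * g t + f t * G x - h t) has_integral (F y * (G y - G x) + (F y - F x) * G x - integral {x..y} h)) {x..y}"
      by (intro has_integral_diff has_integral_add has_integral_mult_right has_integral_mult_left
          primitive_onD[OF F xy] primitive_onD[OF G xy] integrable_integral hint[OF xy])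
    moreover have "\<bar>F y * g t + f t * G x - h t\<bar> \<le> 2 * Mf * Mg * (y - x)" if t: "t \<in> {x..y}" for t
    proof -
      have "F y * g t + f t * G x - h t = (F y - F t) * g t + f t * (G x - G t)"
        unfolding h_def by (simp add: algebra_simps)
      moreover have "\<bar>(F y - F t) * g t\<bar> \<le> (Mf * (y - x)) * Mg"
        unfolding abs_mult
        using primitive_on_lipschitz[OF F Mf(2), of y t] Mf Mg(2)[of t] t xy
        by (intro mult_mono) (auto intro: order_trans mult_left_mono)
      moreover have "\<bar>f t * (G x - G t)\<bar> \<le> Mf * (Mg * (y - x))"
        unfolding abs_mult
        using primitive_on_lipschitz[OF G Mg(2), of x t] Mg Mf(2)[of t] Mf(1) t xy
        by (intro mult_mono) (auto intro: order_trans mult_left_mono)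
      ultimately show ?thesis by (simp add: algebra_simps)
    qed
    ultimately have "\<bar>D y - D x\<bar> \<le> 2 * Mf * Mg * (y - x) * (y - x)"
      unfolding Dd by (rule has_integral_abs_le) (use Mf Mg xy in auto)
    thus ?thesis by (simp add: power2_eq_square mult.assoc)
  qed
  have quad': "\<bar>D y - D x\<bar> \<le> 2 * Mf * Mg * (y - x)\<^sup>2" if "x \<in> {a..b}" "y \<in> {a..b}" for x y
    using quad[of x y] quad[of y x] that by (cases "x \<le> y") (auto simp: abs_minus_commute power2_commute)
  have "\<exists>c. \<forall>x\<in>{a..b}. D x = c"
  proof (rule has_field_derivative_zero_constant)
    fix x assume x: "x \<in> {a..b}"
    have "((\<lambda>y. (D y - D x) / (y - x)) \<longlongrightarrow> 0) (at x within {a..b})"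
    proof (rule Lim_null_comparison)
      have "\<bar>(D y - D x) / (y - x)\<bar> \<le> 2 * Mf * Mg * \<bar>y - x\<bar>" if "y \<in> {a..b}" "y \<noteq> x" for y
      proof -
        have "\<bar>(D y - D x) / (y - x)\<bar> \<le> 2 * Mf * Mg * (y - x)\<^sup>2 / \<bar>y - x\<bar>"
          unfolding abs_divide using quad'[OF x that(1)] by (intro divide_right_mono) auto
        also have "\<dots> = 2 * Mf * Mg * \<bar>y - x\<bar>"
        proof -
          define u where "u = \<bar>y - x\<bar>"
          have "u \<noteq> 0" "(y - x)\<^sup>2 = u * u" unfolding u_def using that by (auto simp: power2_eq_square)
          thus ?thesis unfolding u_def[symmetric] by simp
        qed
        finally show ?thesis .
      qed
      thus "\<forall>\<^sub>F y in at x within {a..b}. norm ((D y - D x) / (y - x)) \<le> 2 * Mf * Mg * \<bar>y - x\<bar>"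
        unfolding eventually_at by (auto intro!: exI[of _ 1])
      show "((\<lambda>y. 2 * Mf * Mg * \<bar>y - x\<bar>) \<longlongrightarrow> 0) (at x within {a..b})"
        by (auto intro!: tendsto_eq_intros)
    qed
    thus "(D has_field_derivative 0) (at x within {a..b})"
      unfolding has_field_derivative_iff .
  qed auto
  then obtain c where c: "\<And>x. x \<in> {a..b} \<Longrightarrow> D x = c" by blast
  show ?thesis unfolding primitive_on_def h_def[symmetric]
  proof (intro conjI allI impI exI ballI)
    fix x y assume xy: "a \<le> x" "x \<le> y" "y \<le> b"
    have "integral {a..x} h + integral {x..y} h = integral {a..y} h"
      by (rule Henstock_Kurzweil_Integration.integral_combine) (use xy hint[of a y] in auto)
    moreover have "D x = D y" using c[of x] c[of y] xy by auto
    ultimately have "integral {x..y} h = F y * G y - F x * G x" unfolding D_def by linarith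
    thus "(h has_integral (F y * G y - F x * G x)) {x..y}"
      using integrable_integral[OF hint[OF xy]] by simp
  qed (use hB in auto)
qed

lemma primitive_on_add:
  assumes "primitive_on a b F f" "primitive_on a b G g"
  shows "primitive_on a b (\<lambda>x. F x + G x) (\<lambda>x. f x + g x)"
proof -
  obtain M N where "\<And>x. x \<in> {a..b} \<Longrightarrow> \<bar>f x\<bar> \<le> M" "\<And>x. x \<in> {a..b} \<Longrightarrow> \<bar>g x\<bar> \<le> N"
    using primitive_on_bounded[OF assms(1)] primitive_on_bounded[OF assms(2)] by metis
  hence "\<And>x. x \<in> {a..b} \<Longrightarrow> \<bar>f x + g x\<bar> \<le> M + N" by (meson abs_triangle_ineq add_mono order_trans)
  moreover have "((\<lambda>x. f x + g x) has_integral (F y + G y - (F x + G x))) {x..y}" if "a \<le> x" "x \<le> y" "y \<le> b" for x y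
    using has_integral_add[OF primitive_onD[OF assms(1) that] primitive_onD[OF assms(2) that]]
    by (simp add: algebra_simps)
  ultimately show ?thesis unfolding primitive_on_def by blast
qed

lemma primitive_on_const: "primitive_on a b (\<lambda>x. c) (\<lambda>x. 0)"
  unfolding primitive_on_def by auto

lemma primitive_on_cmult: "primitive_on a b F f \<Longrightarrow> primitive_on a b (\<lambda>x. c * F x) (\<lambda>x. c * f x)"
  using primitive_on_mult[OF primitive_on_const] by simp

lemma primitive_on_diff:
  assumes "primitive_on a b F f" "primitive_on a b G g"
  shows "primitive_on a b (\<lambda>x. F x - G x) (\<lambda>x. f x - g x)"
  using primitive_on_add[OF assms(1) primitive_on_cmult[OF assms(2), of "-1"]] by simp

lemma primitive_on_sum:
  assumes "\<And>i. i \<in> I \<Longrightarrow> primitive_on a b (F i) (f i)"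
  shows "primitive_on a b (\<lambda>x. \<Sum>i\<in>I. F i x) (\<lambda>x. \<Sum>i\<in>I. f i x)"
  using assms
proof (induction I rule: infinite_finite_induct)
  case (insert i I)
  thus ?case using primitive_on_add[of a b "F i" "f i"] by simp
qed (auto intro: primitive_on_const)

lemma primitive_on_cong:
  assumes "primitive_on a b F f" "\<And>x. x \<in> {a..b} \<Longrightarrow> f x = g x" "\<And>x. x \<in> {a..b} \<Longrightarrow> F x = G x"
  shows "primitive_on a b G g"
  unfolding primitive_on_def
proof (intro conjI allI impI)
  fix x y assume xy: "a \<le> x" "x \<le> y" "y \<le> b"
  have "(g has_integral (F y - F x)) {x..y}"
    using has_integral_eq[of "{x..y}" f g, OF _ primitive_onD[OF assms(1) xy]] assms(2) xy by auto
  thus "(g has_integral (G y - G x)) {x..y}" using assms(3) xy by auto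
next
  obtain M where "\<And>x. x \<in> {a..b} \<Longrightarrow> \<bar>f x\<bar> \<le> M" using primitive_on_bounded[OF assms(1)] by blast
  thus "\<exists>M. \<forall>x\<in>{a..b}. \<bar>g x\<bar> \<le> M" using assms(2) by (intro exI[of _ M]) auto
qed

lemma primitive_on_C1:
  assumes "\<And>x. x \<in> {a..b} \<Longrightarrow> (F has_real_derivative f x) (at x)" "continuous_on {a..b} f"
  shows "primitive_on a b F f"
  unfolding primitive_on_def
proof (intro conjI allI impI)
  fix x y assume xy: "a \<le> x" "x \<le> y" "y \<le> b"
  show "(f has_integral (F y - F x)) {x..y}"
    by (rule fundamental_theorem_of_calculus)
      (use xy assms(1) in \<open>auto simp: has_real_derivative_iff_has_vector_derivative[symmetric] intro: has_field_derivative_at_within\<close>)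
next
  have "bounded (f ` {a..b})" using assms(2) by (simp add: compact_continuous_image compact_imp_bounded)
  thus "\<exists>M. \<forall>x\<in>{a..b}. \<bar>f x\<bar> \<le> M" by (metis bounded_real imageI)
qed

text \<open>Recovers a classical derivative when the discontinuities of V have cancelled, as they do
  for the conjugate function built from the Riccati solution.\<close>

lemma primitive_on_DERIV:
  assumes F: "primitive_on a b F f" and f: "continuous_on {a..b} f" and x: "a < x" "x < b"
  shows "(F has_real_derivative f x) (at x)"
proof -
  have "((\<lambda>y. integral {a..y} f) has_real_derivative f x) (at x within {a..b})"
    by (rule integral_has_real_derivative[OF f]) (use x in auto)
  hence "((\<lambda>y. F a + integral {a..y} f) has_real_derivative f x) (at x within {a..b})"
    by (auto intro!: derivative_eq_intros)
  hence "(F has_real_derivative f x) (at x within {a..b})"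
  proof (rule has_field_derivative_transform_within[OF _ zero_less_one])
    fix y assume "y \<in> {a..b}"
    thus "F a + integral {a..y} f = F y"
      using integral_unique[OF primitive_onD[OF F, of a y]] by auto
  qed (use x in auto)
  thus ?thesis using x by (simp add: at_within_Icc_at)
qed

section \<open>The Riccati equation\<close>

text \<open>Picard iteration for the Riccati equation with the square truncated to \<open>[0, B\<^sup>2]\<close>, in the norm with
  weight \<open>exp (- 4 B x)\<close>; the comparison with the constants \<open>0\<close> and \<open>B\<close> shows that the
  truncation is never active.\<close>

lemma riccati_solution:
  fixes V :: "real \<Rightarrow> real"
  assumes ab: "\<alpha> \<le> \<beta>" and Vint: "V integrable_on {\<alpha>..\<beta>}" and B: "0 < B"
    and V: "\<And>x. x \<in> {\<alpha>..\<beta>} \<Longrightarrow> 0 \<le> V x \<and> V x \<le> B\<^sup>2"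
  obtains a where "primitive_on \<alpha> \<beta> a (\<lambda>x. V x - (a x)\<^sup>2)" "\<And>x. x \<in> {\<alpha>..\<beta>} \<Longrightarrow> 0 \<le> a x \<and> a x \<le> B"
proof -
  define c where "c y = min (max y 0) B" for y
  have c01: "0 \<le> c y" "c y \<le> B" for y unfolding c_def using B by auto
  have cl: "\<bar>c y - c z\<bar> \<le> \<bar>y - z\<bar>" for y z unfolding c_def by linarith
  define h where "h y = (c y)\<^sup>2" for y
  have h0: "0 \<le> h y" "h y \<le> B\<^sup>2" for y unfolding h_def using c01[of y] by (auto intro: power_mono)
  have hl: "\<bar>h y - h z\<bar> \<le> 2 * B * \<bar>y - z\<bar>" for y z
  proof -
    have "\<bar>h y - h z\<bar> = \<bar>c y + c z\<bar> * \<bar>c y - c z\<bar>"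
      unfolding h_def by (simp add: power2_eq_square abs_mult[symmetric] algebra_simps)
    also have "\<dots> \<le> (2 * B) * \<bar>y - z\<bar>" using c01[of y] c01[of z] cl[of y z] by (intro mult_mono) auto
    finally show ?thesis .
  qed
  have hc: "continuous_on S (\<lambda>x. h (g x))" if "continuous_on S g" for S :: "real set" and g
    unfolding h_def c_def by (intro continuous_intros that)
  \<comment> \<open>Clamping the argument extends functions on the interval to bounded continuous
    functions on the whole line, where Banach's fixed point theorem applies.\<close>
  define k where "k x = max \<alpha> (min \<beta> x)" for x
  have k: "k x \<in> {\<alpha>..\<beta>}" for x unfolding k_def using ab by auto
  have kid: "k x = x" if "x \<in> {\<alpha>..\<beta>}" for x unfolding k_def using that by auto
  have kc: "continuous_on S k" for S unfolding k_def by (intro continuous_intros)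
  \<comment> \<open>The truncated square is 2B-Lipschitz, and integrating the weight exp(K x) gains
    1/K; K = 4B makes the contraction factor 2B/K = 1/2.\<close>
  define K where "K = 4 * B"
  have K: "K > 0" unfolding K_def using B by simp
  define G where "G w y = V y - h (exp (K * (y - \<alpha>)) * apply_bcontfun w y)" for w :: "real \<Rightarrow>\<^sub>C real" and y
  have hw: "continuous_on S (\<lambda>y. h (exp (K * (y - \<alpha>)) * apply_bcontfun w y))" for S and w :: "real \<Rightarrow>\<^sub>C real"
    by (intro hc continuous_intros continuous_on_apply_bcontfun)
  have Gint: "G w integrable_on {\<alpha>..x}" if "x \<in> {\<alpha>..\<beta>}" for w x
  proof -
    have "V integrable_on {\<alpha>..x}" by (rule integrable_on_subinterval[OF Vint]) (use that in auto)
    thus ?thesis unfolding G_def by (rule integrable_diff) (intro integrable_continuous_interval hw)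
  qed
  have GB: "\<bar>G w y\<bar> \<le> B\<^sup>2" if "y \<in> {\<alpha>..\<beta>}" for w y
    using V[OF that] h0[of "exp (K * (y - \<alpha>)) * apply_bcontfun w y"] unfolding G_def by linarith
  define T0 where "T0 w x = exp (- K * (k x - \<alpha>)) * integral {\<alpha>..k x} (G w)" for w x
  have T0c: "continuous_on UNIV (T0 w)" for w
  proof -
    have "continuous_on {\<alpha>..\<beta>} (\<lambda>x. integral {\<alpha>..x} (G w))"
      by (rule indefinite_integral_continuous_1) (use Gint[of \<beta>] ab in auto)
    from continuous_on_compose2[OF this kc[of UNIV]] k
    have "continuous_on UNIV (\<lambda>x. integral {\<alpha>..k x} (G w))" by (simp add: image_subset_iff)
    thus ?thesis unfolding T0_def by (intro continuous_intros kc)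
  qed
  have expK: "exp (- K * (k x - \<alpha>)) \<le> 1" for x using k[of x] K by simp
  have T0B: "\<bar>T0 w x\<bar> \<le> B\<^sup>2 * (\<beta> - \<alpha>)" for w x
  proof -
    have "\<bar>integral {\<alpha>..k x} (G w)\<bar> \<le> B\<^sup>2 * (k x - \<alpha>)"
      by (rule has_integral_abs_le[OF integrable_integral[OF Gint[OF k]]]) (use GB k[of x] in auto)
    also have "\<dots> \<le> B\<^sup>2 * (\<beta> - \<alpha>)" using k[of x] by (intro mult_left_mono) auto
    finally have "exp (- K * (k x - \<alpha>)) * \<bar>integral {\<alpha>..k x} (G w)\<bar> \<le> 1 * (B\<^sup>2 * (\<beta> - \<alpha>))"
      using expK[of x] by (intro mult_mono) auto
    thus ?thesis unfolding T0_def abs_mult by simp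
  qed
  define T where "T w = Bcontfun (T0 w)" for w
  have T: "apply_bcontfun (T w) x = T0 w x" for w x
    unfolding T_def using bcontfun_normI[OF T0c, of w "B\<^sup>2 * (\<beta> - \<alpha>)"] T0B by (simp add: Bcontfun_inverse)
  have "dist (T w) (T w') \<le> 1/2 * dist w w'" for w w'
  proof (rule dist_bound)
    fix x
    define d where "d = dist w w'"
    have d: "\<bar>apply_bcontfun w y - apply_bcontfun w' y\<bar> \<le> d" for y
      using dist_bounded[of w y w'] unfolding d_def dist_real_def .
    have d0: "d \<ge> 0" unfolding d_def by simp
    have E: "((\<lambda>y. 2 * B * d * exp (K * (y - \<alpha>))) has_integral (2 * B * d * exp (K * (k x - \<alpha>)) / K - 2 * B * d * exp (K * (\<alpha> - \<alpha>)) / K)) {\<alpha>..k x}"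
      by (rule fundamental_theorem_of_calculus)
        (use k[of x] K in \<open>auto simp: has_real_derivative_iff_has_vector_derivative[symmetric] intro!: derivative_eq_intros\<close>)
    have "norm (integral {\<alpha>..k x} (\<lambda>y. G w y - G w' y)) \<le> integral {\<alpha>..k x} (\<lambda>y. 2 * B * d * exp (K * (y - \<alpha>)))"
    proof (rule integral_norm_bound_integral)
      fix y assume "y \<in> {\<alpha>..k x}"
      have "norm (G w y - G w' y) \<le> 2 * B * \<bar>exp (K * (y - \<alpha>)) * apply_bcontfun w' y - exp (K * (y - \<alpha>)) * apply_bcontfun w y\<bar>"
        unfolding G_def using hl[of "exp (K * (y - \<alpha>)) * apply_bcontfun w' y" "exp (K * (y - \<alpha>)) * apply_bcontfun w y"] by simp
      also have "\<dots> = 2 * B * (exp (K * (y - \<alpha>)) * \<bar>apply_bcontfun w y - apply_bcontfun w' y\<bar>)"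
        by (simp add: right_diff_distrib[symmetric] abs_mult abs_minus_commute)
      also have "\<dots> \<le> 2 * B * (exp (K * (y - \<alpha>)) * d)" using d[of y] B by (intro mult_left_mono) auto
      finally show "norm (G w y - G w' y) \<le> 2 * B * d * exp (K * (y - \<alpha>))" by (simp add: mult_ac)
    qed (use E Gint[OF k] in \<open>auto intro: integrable_diff\<close>)
    also have "\<dots> \<le> 2 * B * d * exp (K * (k x - \<alpha>)) / K"
      unfolding integral_unique[OF E] using B d0 K by simp
    also have "\<dots> = exp (K * (k x - \<alpha>)) * (1/2 * d)" unfolding K_def using B by simp
    finally have "exp (- K * (k x - \<alpha>)) * \<bar>integral {\<alpha>..k x} (\<lambda>y. G w y - G w' y)\<bar>
        \<le> exp (- K * (k x - \<alpha>)) * (exp (K * (k x - \<alpha>)) * (1/2 * d))" by (intro mult_left_mono) auto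
    also have "\<dots> = 1/2 * d" by (simp add: exp_minus)
    finally show "dist (apply_bcontfun (T w) x) (apply_bcontfun (T w') x) \<le> 1/2 * dist w w'"
      unfolding T T0_def dist_real_def right_diff_distrib[symmetric] d_def[symmetric]
      by (simp add: integral_diff[OF Gint[OF k] Gint[OF k]] abs_mult)
  qed
  then obtain w where w: "T w = w" using banach_fix_type[of "1/2" T] by auto
  define a where "a x = integral {\<alpha>..x} (G w)" for x
  have aw: "exp (K * (y - \<alpha>)) * apply_bcontfun w y = a y" if "y \<in> {\<alpha>..\<beta>}" for y
  proof -
    have "apply_bcontfun w y = exp (- K * (y - \<alpha>)) * a y" using T[of w y] unfolding w T0_def a_def kid[OF that] .
    thus ?thesis by (simp add: exp_minus)
  qed
  have Ga: "G w y = V y - h (a y)" if "y \<in> {\<alpha>..\<beta>}" for y unfolding G_def aw[OF that] ..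
  have ai: "((\<lambda>y. V y - h (a y)) has_integral (a y - a x)) {x..y}" if "\<alpha> \<le> x" "x \<le> y" "y \<le> \<beta>" for x y
  proof -
    have Gi: "G w integrable_on {x..y}" by (rule integrable_on_subinterval[OF Gint[of \<beta>]]) (use that ab in auto)
    have "integral {\<alpha>..x} (G w) + integral {x..y} (G w) = integral {\<alpha>..y} (G w)"
      by (rule Henstock_Kurzweil_Integration.integral_combine) (use that Gint[of y] in auto)
    hence "(G w has_integral (a y - a x)) {x..y}" using integrable_integral[OF Gi] unfolding a_def
      by (metis add_diff_cancel_left')
    thus ?thesis by (rule has_integral_eq[rotated]) (use Ga that in auto)
  qed
  have ac: "continuous_on {\<alpha>..\<beta>} a"
    unfolding a_def by (rule indefinite_integral_continuous_1) (use Gint[of \<beta>] ab in auto)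
  have a\<alpha>: "a \<alpha> = 0" unfolding a_def by simp
  \<comment> \<open>Barrier argument: after the last time at which \<open>g\<close> is nonpositive,
    \<open>g\<close> is positive and therefore cannot increase, so it cannot be positive at
    \<open>x\<close>. It is applied to -a and to a - B.\<close>
  have comp: False if g: "continuous_on {\<alpha>..\<beta>} g" "g \<alpha> \<le> 0" "x \<in> {\<alpha>..\<beta>}" "g x > (0::real)"
    and dec: "\<And>u v. \<alpha> \<le> u \<Longrightarrow> u \<le> v \<Longrightarrow> v \<le> \<beta> \<Longrightarrow> (\<And>t. u < t \<Longrightarrow> t \<le> v \<Longrightarrow> g t > 0) \<Longrightarrow> g v \<le> g u" for g x
  proof -
    define S where "S = {t \<in> {\<alpha>..x}. g t \<le> 0}"
    have "S = {\<alpha>..x} \<inter> g -` {..0}" unfolding S_def by auto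
    moreover have "continuous_on {\<alpha>..x} g" using g by (auto intro: continuous_on_subset)
    ultimately have "closed S" using continuous_closed_preimage[of "{\<alpha>..x}" g "{..0}"] by simp
    moreover have "S \<noteq> {}" "bdd_above S" unfolding S_def using g by (auto intro!: bdd_aboveI[of _ x])
    ultimately have u: "Sup S \<in> S" by (intro closed_contains_Sup)
    have "g t > 0" if "Sup S < t" "t \<le> x" for t
    proof (rule ccontr)
      assume "\<not> g t > 0"
      hence "t \<in> S" using that u unfolding S_def by auto
      hence "t \<le> Sup S" using \<open>bdd_above S\<close> by (rule cSup_upper)
      thus False using that by simp
    qed
    hence "g x \<le> g (Sup S)" using u g unfolding S_def by (intro dec) auto
    thus False using u g unfolding S_def by simp
  qed
  have a0: "0 \<le> a x" if x: "x \<in> {\<alpha>..\<beta>}" for x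
  proof (rule ccontr)
    assume "\<not> 0 \<le> a x"
    show False
    proof (rule comp[of "\<lambda>t. - a t" x])
      fix u v assume uv: "\<alpha> \<le> u" "u \<le> v" "v \<le> \<beta>" and n: "\<And>t. u < t \<Longrightarrow> t \<le> v \<Longrightarrow> - a t > 0"
      have "0 \<le> a v - a u"
      \<comment> \<open>The sign of \<open>a\<close> is known only strictly to the right of
        \<open>u\<close>, so the integrand is reset at that one point.\<close>
      proof (rule has_integral_nonneg[OF has_integral_spike_finite[OF _ _ ai[OF uv], of "{u}" "\<lambda>y. if y = u then 0 else V y - h (a y)"]])
        fix t assume t: "t \<in> {u..v}"
        show "0 \<le> (if t = u then 0 else V t - h (a t))"
        proof (cases "t = u")
          case False
          hence "a t < 0" using n[of t] t by simp
          hence "h (a t) = 0" unfolding h_def c_def using B by simp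
          thus ?thesis using V[of t] t uv by simp
        qed simp
      qed auto
      thus "- a v \<le> - a u" by simp
    qed (use x ac a\<alpha> \<open>\<not> 0 \<le> a x\<close> in \<open>auto intro!: continuous_intros\<close>)
  qed
  have aB: "a x \<le> B" if x: "x \<in> {\<alpha>..\<beta>}" for x
  proof (rule ccontr)
    assume "\<not> a x \<le> B"
    show False
    proof (rule comp[of "\<lambda>t. a t - B" x])
      fix u v assume uv: "\<alpha> \<le> u" "u \<le> v" "v \<le> \<beta>" and n: "\<And>t. u < t \<Longrightarrow> t \<le> v \<Longrightarrow> a t - B > 0"
      have "0 \<le> - (a v - a u)"
      proof (rule has_integral_nonneg[OF has_integral_spike_finite[OF _ _ has_integral_neg[OF ai[OF uv]], of "{u}" "\<lambda>y. if y = u then 0 else - (V y - h (a y))"]])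
        fix t assume t: "t \<in> {u..v}"
        show "0 \<le> (if t = u then 0 else - (V t - h (a t)))"
        proof (cases "t = u")
          case False
          hence "a t > B" using n[of t] t by simp
          hence "h (a t) = B\<^sup>2" unfolding h_def c_def using B by simp
          thus ?thesis using V[of t] t uv by simp
        qed simp
      qed auto
      thus "a v - B \<le> a u - B" by simp
    qed (use x ac a\<alpha> B \<open>\<not> a x \<le> B\<close> in \<open>auto intro!: continuous_intros\<close>)
  qed
  have ha: "h (a x) = (a x)\<^sup>2" if "x \<in> {\<alpha>..\<beta>}" for x
    unfolding h_def c_def using a0[OF that] aB[OF that] by simp
  have "primitive_on \<alpha> \<beta> a (\<lambda>x. V x - h (a x))"
    unfolding primitive_on_def
  proof (intro conjI allI impI exI ballI)
    fix x assume "x \<in> {\<alpha>..\<beta>}"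
    thus "\<bar>V x - h (a x)\<bar> \<le> B\<^sup>2" using V[of x] h0[of "a x"] by auto
  qed (use ai in auto)
  hence "primitive_on \<alpha> \<beta> a (\<lambda>x. V x - (a x)\<^sup>2)" by (rule primitive_on_cong) (use ha in auto)
  thus thesis using that a0 aB by blast
qed

section \<open>The ghost dimension\<close>

lemma has_derivative_Re_Im_product:
  assumes "(g has_real_derivative g') (at (Re z))" "(k has_real_derivative k') (at (Im z))"
  shows "((\<lambda>z. g (Re z) * k (Im z)) has_derivative (\<lambda>h. Re h * (g' * k (Im z)) + Im h * (g (Re z) * k'))) (at z)"
proof -
  have "((\<lambda>z. g (Re z)) has_derivative (\<lambda>h. g' * Re h)) (at z)"
    using has_derivative_compose[OF bounded_linear_imp_has_derivative[OF bounded_linear_Re] assms(1)[unfolded has_field_derivative_def]] .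
  moreover have "((\<lambda>z. k (Im z)) has_derivative (\<lambda>h. k' * Im h)) (at z)"
    using has_derivative_compose[OF bounded_linear_imp_has_derivative[OF bounded_linear_Im] assms(2)[unfolded has_field_derivative_def]] .
  ultimately show ?thesis
    by (rule has_derivative_eq_rhs[OF has_derivative_mult]) (simp add: algebra_simps)
qed

lemma C1_on_Complex:
  assumes "\<And>z. z \<in> S \<Longrightarrow> (U has_derivative (\<lambda>h. Re h * Ux z + Im h * Uy z)) (at z)"
    "\<And>z. z \<in> S \<Longrightarrow> (W has_derivative (\<lambda>h. Re h * Wx z + Im h * Wy z)) (at z)"
    "continuous_on S Ux" "continuous_on S Uy" "continuous_on S Wx" "continuous_on S Wy"
  shows "C1_on S (\<lambda>z. Complex (U z) (W z)) (\<lambda>z. Complex (Ux z) (Wx z)) (\<lambda>z. Complex (Uy z) (Wy z))"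
  unfolding C1_on_def Complex_eq
proof (intro conjI ballI)
  fix z assume z: "z \<in> S"
  show "((\<lambda>z. of_real (U z) + \<i> * of_real (W z)) has_derivative
      (\<lambda>h. of_real (Re h) * (of_real (Ux z) + \<i> * of_real (Wx z)) + of_real (Im h) * (of_real (Uy z) + \<i> * of_real (Wy z)))) (at z)"
    by (rule has_derivative_eq_rhs[OF has_derivative_add[OF has_derivative_of_real[OF assms(1)[OF z]]
          has_derivative_mult_right[OF has_derivative_of_real[OF assms(2)[OF z]]]]])
      (simp add: algebra_simps)
qed (intro continuous_intros assms)+

text \<open>\<open>\<Sum> \<psi> \<mu> x cosh (\<surd>\<mu> t)\<close> solves \<open>u\<^sub>x\<^sub>x + u\<^sub>t\<^sub>t = V u\<close> and agrees with \<open>\<Sum> \<psi> \<mu>\<close> at \<open>t = 0\<close>. A solution \<open>a\<close> of the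
  Riccati equation factors \<open>\<partial>\<^sub>x\<^sup>2 - V = (\<partial>\<^sub>x + a) (\<partial>\<^sub>x - a)\<close> and supplies the conjugate function.\<close>

lemma ghost_vekua:
  fixes \<psi> \<psi>' :: "real \<Rightarrow> real \<Rightarrow> real"
  assumes M: "finite M" "\<And>\<mu>. \<mu> \<in> M \<Longrightarrow> 0 < \<mu>"
    and ab: "\<alpha> \<le> \<beta>"
    and a: "primitive_on \<alpha> \<beta> a (\<lambda>x. V x - (a x)\<^sup>2)"
    and d: "\<And>\<mu> x. \<mu> \<in> M \<Longrightarrow> (\<psi> \<mu> has_real_derivative \<psi>' \<mu> x) (at x)"
    and dd: "\<And>\<mu>. \<mu> \<in> M \<Longrightarrow> primitive_on \<alpha> \<beta> (\<psi>' \<mu>) (\<lambda>x. (V x - \<mu>) * \<psi> \<mu> x)"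
  defines "f \<equiv> \<lambda>z. Complex (\<Sum>\<mu>\<in>M. \<psi> \<mu> (Re z) * cosh (sqrt \<mu> * Im z))
      (\<Sum>\<mu>\<in>M. (\<psi>' \<mu> (Re z) - a (Re z) * \<psi> \<mu> (Re z)) * (sinh (sqrt \<mu> * Im z) / sqrt \<mu>))"
  obtains fx fy where "C1_on {z. \<alpha> < Re z \<and> Re z < \<beta>} f fx fy"
    "\<And>z. \<alpha> < Re z \<Longrightarrow> Re z < \<beta> \<Longrightarrow> fx z + \<i> * fy z = of_real (a (Re z)) * cnj (f z)"
proof -
  define S where "S = {z. \<alpha> < Re z \<and> Re z < \<beta>}"
  have ac: "continuous_on {\<alpha>..\<beta>} a" by (rule primitive_on_continuous[OF a])
  have \<psi>c: "continuous_on T (\<psi> \<mu>)" if "\<mu> \<in> M" for T \<mu>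
    using d[OF that] by (meson DERIV_isCont continuous_at_imp_continuous_on)
  have \<psi>'c: "continuous_on {\<alpha>..\<beta>} (\<psi>' \<mu>)" if "\<mu> \<in> M" for \<mu>
    by (rule primitive_on_continuous[OF dd[OF that]])
  define \<eta> where "\<eta> \<mu> x = \<psi>' \<mu> x - a x * \<psi> \<mu> x" for \<mu> x
  \<comment> \<open>The derivative of \<psi>' - a \<psi> is (V - \<mu>) \<psi> - (V - a^2) \<psi> -
    a \<psi>'. V drops out, which leaves a continuous function.\<close>
  define \<eta>' where "\<eta>' \<mu> x = - \<mu> * \<psi> \<mu> x - a x * \<eta> \<mu> x" for \<mu> x
  have \<eta>c: "continuous_on {\<alpha>..\<beta>} (\<eta> \<mu>)" and \<eta>'c: "continuous_on {\<alpha>..\<beta>} (\<eta>' \<mu>)" if "\<mu> \<in> M" for \<mu>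
    unfolding \<eta>'_def \<eta>_def by (intro continuous_intros ac \<psi>c \<psi>'c that)+
  have \<eta>d: "(\<eta> \<mu> has_real_derivative \<eta>' \<mu> x) (at x)" if "\<mu> \<in> M" "\<alpha> < x" "x < \<beta>" for \<mu> x
  proof (rule primitive_on_DERIV[OF _ \<eta>'c[OF that(1)] that(2,3)])
    have "primitive_on \<alpha> \<beta> (\<psi> \<mu>) (\<psi>' \<mu>)" by (rule primitive_on_C1[OF d \<psi>'c]) (use that in auto)
    from primitive_on_diff[OF dd[OF that(1)] primitive_on_mult[OF a this]]
    show "primitive_on \<alpha> \<beta> (\<eta> \<mu>) (\<eta>' \<mu>)"
      by (rule primitive_on_cong) (auto simp: \<eta>_def \<eta>'_def power2_eq_square algebra_simps)
  qed
  define C where "C \<mu> y = cosh (sqrt \<mu> * y)" for \<mu> y :: real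
  define Sh where "Sh \<mu> y = sinh (sqrt \<mu> * y) / sqrt \<mu>" for \<mu> y :: real
  have Cd: "(C \<mu> has_real_derivative \<mu> * Sh \<mu> y) (at y)" and Shd: "(Sh \<mu> has_real_derivative C \<mu> y) (at y)" if "\<mu> \<in> M" for \<mu> y
    unfolding C_def Sh_def using M(2)[OF that]
    by (auto intro!: derivative_eq_intros simp: real_div_sqrt field_simps)
  have CSc: "continuous_on T (C \<mu>)" "continuous_on T (Sh \<mu>)" if "\<mu> \<in> M" for \<mu> T
    using Cd[OF that] Shd[OF that] by (meson DERIV_isCont continuous_at_imp_continuous_on)+
  have gc: "continuous_on S (\<lambda>z. g (Re z))" if "continuous_on {\<alpha>..\<beta>} g" for g :: "real \<Rightarrow> real"
    by (rule continuous_on_compose2[OF that continuous_on_Re[OF continuous_on_id]]) (auto simp: S_def)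
  have kc: "continuous_on S (\<lambda>z. g (Im z))" if "continuous_on UNIV g" for g :: "real \<Rightarrow> real"
    by (rule continuous_on_compose2[OF that continuous_on_Im[OF continuous_on_id]]) auto
  have f: "f = (\<lambda>z. Complex (\<Sum>\<mu>\<in>M. \<psi> \<mu> (Re z) * C \<mu> (Im z)) (\<Sum>\<mu>\<in>M. \<eta> \<mu> (Re z) * Sh \<mu> (Im z)))"
    unfolding f_def C_def Sh_def \<eta>_def ..
  define Ux where "Ux z = (\<Sum>\<mu>\<in>M. \<psi>' \<mu> (Re z) * C \<mu> (Im z))" for z
  define Uy where "Uy z = (\<Sum>\<mu>\<in>M. \<psi> \<mu> (Re z) * (\<mu> * Sh \<mu> (Im z)))" for z
  define Wx where "Wx z = (\<Sum>\<mu>\<in>M. \<eta>' \<mu> (Re z) * Sh \<mu> (Im z))" for z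
  define Wy where "Wy z = (\<Sum>\<mu>\<in>M. \<eta> \<mu> (Re z) * C \<mu> (Im z))" for z
  have C1: "C1_on S f (\<lambda>z. Complex (Ux z) (Wx z)) (\<lambda>z. Complex (Uy z) (Wy z))"
    unfolding f
  proof (rule C1_on_Complex)
    fix z assume z: "z \<in> S"
    show "((\<lambda>z. \<Sum>\<mu>\<in>M. \<psi> \<mu> (Re z) * C \<mu> (Im z)) has_derivative (\<lambda>h. Re h * Ux z + Im h * Uy z)) (at z)"
      by (rule has_derivative_eq_rhs[OF has_derivative_sum[OF has_derivative_Re_Im_product[OF d Cd]]])
        (auto simp: Ux_def Uy_def sum_distrib_left sum.distrib)
    show "((\<lambda>z. \<Sum>\<mu>\<in>M. \<eta> \<mu> (Re z) * Sh \<mu> (Im z)) has_derivative (\<lambda>h. Re h * Wx z + Im h * Wy z)) (at z)"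
      by (rule has_derivative_eq_rhs[OF has_derivative_sum[OF has_derivative_Re_Im_product[OF \<eta>d Shd]]])
        (use z in \<open>auto simp: Wx_def Wy_def S_def sum_distrib_left sum.distrib\<close>)
  qed (auto simp: Ux_def Uy_def Wx_def Wy_def intro!: continuous_intros gc kc \<psi>c \<psi>'c \<eta>c \<eta>'c CSc)
  have "Complex (Ux z) (Wx z) + \<i> * Complex (Uy z) (Wy z) = of_real (a (Re z)) * cnj (f z)" for z
  proof -
    have "Ux z - Wy z = a (Re z) * (\<Sum>\<mu>\<in>M. \<psi> \<mu> (Re z) * C \<mu> (Im z))"
      unfolding Ux_def Wy_def \<eta>_def by (simp add: sum_subtractf[symmetric] sum_distrib_left algebra_simps)
    moreover have "Wx z + Uy z = - a (Re z) * (\<Sum>\<mu>\<in>M. \<eta> \<mu> (Re z) * Sh \<mu> (Im z))"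
      unfolding Wx_def Uy_def \<eta>'_def sum.distrib[symmetric] sum_distrib_left
      by (rule sum.cong) (auto simp: algebra_simps)
    ultimately show ?thesis unfolding f by (simp add: complex_eq_iff)
  qed
  with C1 show thesis unfolding S_def by (intro that) auto
qed

section \<open>Size of the Lagrange coefficients and the estimate on one window\<close>

lemma prod_abs_diff_ge:
  assumes j: "j < N"
  shows "fact (N - 1) / 2 ^ (N - 1) \<le> (\<Prod>i\<in>{..<N} - {j}. \<bar>real j - real i\<bar>)"
proof -
  define n where "n = N - 1"
  have N: "N = Suc n" "j \<le> n" unfolding n_def using j by auto
  have "{..<N} - {j} = {..<j} \<union> {Suc j..<N}" using j by auto
  moreover have "(\<Prod>i\<in>{..<j} \<union> {Suc j..<N}. \<bar>real j - real i\<bar>)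
      = (\<Prod>i<j. \<bar>real j - real i\<bar>) * (\<Prod>i\<in>{Suc j..<N}. \<bar>real j - real i\<bar>)"
    by (rule prod.union_disjoint) auto
  moreover have "(\<Prod>i<j. \<bar>real j - real i\<bar>) = fact j"
  proof -
    have "(\<Prod>i<j. \<bar>real j - real i\<bar>) = (\<Prod>i<j. real (j - i))" by (rule prod.cong) (auto simp: of_nat_diff)
    also have "\<dots> = (\<Prod>i<j. real (Suc i))"
      by (rule prod.reindex_bij_witness[of _ "\<lambda>i. j - Suc i" "\<lambda>i. j - Suc i"]) (auto simp: Suc_diff_Suc)
    also have "\<dots> = fact j" by (simp add: fact_prod_Suc atLeast0LessThan)
    finally show ?thesis .
  qed
  moreover have "(\<Prod>i\<in>{Suc j..<N}. \<bar>real j - real i\<bar>) = fact (n - j)"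
  proof -
    have "(\<Prod>i\<in>{Suc j..<N}. \<bar>real j - real i\<bar>) = (\<Prod>i<n - j. real (Suc i))"
      using N by (intro prod.reindex_bij_witness[of _ "\<lambda>i. i + Suc j" "\<lambda>i. i - Suc j"]) auto
    also have "\<dots> = fact (n - j)" by (simp add: fact_prod_Suc atLeast0LessThan)
    finally show ?thesis .
  qed
  ultimately have P: "(\<Prod>i\<in>{..<N} - {j}. \<bar>real j - real i\<bar>) = fact j * fact (n - j)" by simp
  \<comment> \<open>The product j! (n - j)! is n! divided by a binomial coefficient, which is at
    most the full row sum 2^n.\<close>
  have "real (n choose j) \<le> 2 ^ n"
    using binomial_le_pow2[of n j] by (metis of_nat_le_iff of_nat_numeral of_nat_power)
  moreover have "fact n = fact j * fact (n - j) * real (n choose j)"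
    using binomial_fact_lemma[OF N(2)] by (metis of_nat_fact of_nat_mult)
  ultimately have "fact n \<le> (fact j * fact (n - j) :: real) * 2 ^ n" by (simp add: mult_left_mono)
  thus ?thesis unfolding P n_def[symmetric] by (simp add: divide_le_eq)
qed

text \<open>N^N / N! is a single term of the series for exp N; this replaces Stirling's
  formula.\<close>

lemma power_self_le_exp_fact: "real N ^ N \<le> exp (real N) * fact N"
proof -
  have s: "(\<lambda>n. real N ^ n /\<^sub>R fact n) sums exp (real N)" by (rule exp_converges)
  have "(\<Sum>n\<in>{N}. real N ^ n /\<^sub>R fact n) \<le> exp (real N)"
    unfolding sums_unique[OF s] by (rule sum_le_suminf[OF sums_summable[OF s]]) auto
  thus ?thesis by (simp add: field_simps)
qed

text \<open>The separation compares the denominators with those of equally spaced nodes, giving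
  (2Nr/m)^n 2^n/n! for n = N - 1. Since N^n/n! = N^N/N! \<le> e^N, only a constant per node remains:
  12 = 4 * 3 with e \<le> 3.\<close>

lemma lagrange_coefficient_bound:
  assumes m: "0 < m" "m \<le> 2 * r" and j: "j < N"
    and sep: "\<And>i. i < N \<Longrightarrow> \<bar>real i - real j\<bar> * m / (2 * real N) \<le> \<bar>x i - x j\<bar>"
    and near: "\<And>i. i < N \<Longrightarrow> \<bar>x0 - x i\<bar> \<le> r"
  shows "(\<Prod>i\<in>{..<N} - {j}. \<bar>x0 - x i\<bar> / \<bar>x j - x i\<bar>) \<le> (12 * r / m) ^ N"
proof -
  define n where "n = N - 1"
  have N: "N = Suc n" unfolding n_def using j by auto
  define J where "J = {..<N} - {j}"
  have cJ: "card J = n" unfolding J_def using j N by simp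
  define q where "q = 2 * real N * r / m"
  have q: "q > 0" unfolding q_def using m N by simp
  have "(\<Prod>i\<in>J. \<bar>x0 - x i\<bar> / \<bar>x j - x i\<bar>) \<le> (\<Prod>i\<in>J. q / \<bar>real j - real i\<bar>)"
  proof (rule prod_mono)
    fix i assume i: "i \<in> J"
    have p: "\<bar>real j - real i\<bar> * m / (2 * real N) > 0" using i m N unfolding J_def by auto
    have "\<bar>x0 - x i\<bar> / \<bar>x j - x i\<bar> \<le> r / (\<bar>real j - real i\<bar> * m / (2 * real N))"
      using sep[of i] near[of i] i p m unfolding J_def by (intro frac_le) (auto simp: abs_minus_commute)
    thus "0 \<le> \<bar>x0 - x i\<bar> / \<bar>x j - x i\<bar> \<and> \<bar>x0 - x i\<bar> / \<bar>x j - x i\<bar> \<le> q / \<bar>real j - real i\<bar>"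
      unfolding q_def by (simp add: field_simps)
  qed
  also have "\<dots> = q ^ n / (\<Prod>i\<in>J. \<bar>real j - real i\<bar>)" by (simp add: prod_dividef cJ)
  also have "\<dots> \<le> q ^ n / (fact n / 2 ^ n)"
  proof (rule divide_left_mono)
    have "0 < (\<Prod>i\<in>J. \<bar>real j - real i\<bar>)" unfolding J_def by (intro prod_pos) auto
    thus "0 < (\<Prod>i\<in>J. \<bar>real j - real i\<bar>) * (fact n / 2 ^ n)" by simp
  qed (use prod_abs_diff_ge[OF j] q in \<open>auto simp: J_def n_def\<close>)
  also have "\<dots> = (4 * r / m) ^ n * (real N ^ n / fact n)"
    unfolding q_def by (simp add: power_divide power_mult_distrib) (simp add: power_mult_distrib[symmetric])
  also have "real N ^ n / fact n = real N ^ N / fact N" unfolding N power_Suc fact_Suc by (simp del: of_nat_Suc)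
  also have "real N ^ N / fact N \<le> exp (real N)" using power_self_le_exp_fact[of N] by (simp add: divide_le_eq)
  also have "exp (real N) = exp 1 ^ N" by (simp add: exp_of_nat_mult[symmetric])
  also have "(exp 1 :: real) ^ N \<le> 3 ^ N" using exp_le by (intro power_mono) auto
  also have "(4 * r / m) ^ n \<le> (4 * r / m) ^ N" using m N by (intro power_increasing) (auto simp: field_simps)
  also have "(4 * r / m) ^ N * 3 ^ N = (12 * r / m) ^ N" by (simp add: power_mult_distrib[symmetric])
  finally show ?thesis using m unfolding J_def by (auto simp: mult_left_mono mult_right_mono)
qed

text \<open>The radii are nested: nodes within r must lie in a fifth of the disc, so \<rho> = 5r;
  the similarity principle uses the disc of radius 2\<rho> = 10r; the open strip of half-width 11r
  contains its closure. The factor 60 is 12 * 5, and P + Q1 + B Q2 bounds |Re f| + |Im f| on the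
  circle.\<close>

lemma local_propagation:
  fixes \<psi> \<psi>' :: "real \<Rightarrow> real \<Rightarrow> real"
  assumes M: "finite M" "\<And>\<mu>. \<mu> \<in> M \<Longrightarrow> 0 < \<mu>"
    and r: "0 < r" and B: "0 < B"
    and Vint: "V integrable_on {x0 - 11 * r..x0 + 11 * r}"
    and V: "\<And>x. x \<in> {x0 - 11 * r..x0 + 11 * r} \<Longrightarrow> 0 \<le> V x \<and> V x \<le> B\<^sup>2"
    and d: "\<And>\<mu> x. \<mu> \<in> M \<Longrightarrow> (\<psi> \<mu> has_real_derivative \<psi>' \<mu> x) (at x)"
    and dd: "\<And>\<mu>. \<mu> \<in> M \<Longrightarrow> primitive_on (x0 - 11 * r) (x0 + 11 * r) (\<psi>' \<mu>) (\<lambda>x. (V x - \<mu>) * \<psi> \<mu> x)"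
    and E: "E \<in> sets lebesgue" "E \<subseteq> {x0 - r..x0 + r}" and m: "0 < m" "m \<le> measure lebesgue E"
    and \<delta>: "\<And>x. x \<in> E \<Longrightarrow> \<bar>\<Sum>\<mu>\<in>M. \<psi> \<mu> x\<bar> \<le> \<delta>"
    and N: "0 < N"
    and P: "\<And>x t. \<bar>x - x0\<bar> \<le> 5 * r \<Longrightarrow> \<bar>t\<bar> \<le> 5 * r \<Longrightarrow> \<bar>\<Sum>\<mu>\<in>M. cosh (sqrt \<mu> * t) * \<psi> \<mu> x\<bar> \<le> P"
    and Q1: "\<And>x t. \<bar>x - x0\<bar> \<le> 5 * r \<Longrightarrow> \<bar>t\<bar> \<le> 5 * r \<Longrightarrow> \<bar>\<Sum>\<mu>\<in>M. sinh (sqrt \<mu> * t) / sqrt \<mu> * \<psi>' \<mu> x\<bar> \<le> Q1"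
    and Q2: "\<And>x t. \<bar>x - x0\<bar> \<le> 5 * r \<Longrightarrow> \<bar>t\<bar> \<le> 5 * r \<Longrightarrow> \<bar>\<Sum>\<mu>\<in>M. sinh (sqrt \<mu> * t) / sqrt \<mu> * \<psi> \<mu> x\<bar> \<le> Q2"
  shows "\<bar>\<Sum>\<mu>\<in>M. \<psi> \<mu> x0\<bar> \<le> exp (60 * B * r) * (N * (12 * r / m) ^ N * \<delta> + (P + Q1 + B * Q2) / 4 ^ N)"
proof -
  define \<alpha> where "\<alpha> = x0 - 11 * r"
  define \<beta> where "\<beta> = x0 + 11 * r"
  have ab: "\<alpha> \<le> \<beta>" unfolding \<alpha>_def \<beta>_def using r by simp
  obtain a where a: "primitive_on \<alpha> \<beta> a (\<lambda>x. V x - (a x)\<^sup>2)" "\<And>x. x \<in> {\<alpha>..\<beta>} \<Longrightarrow> 0 \<le> a x \<and> a x \<le> B"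
    using riccati_solution[OF ab Vint[folded \<alpha>_def \<beta>_def] B V[folded \<alpha>_def \<beta>_def]] by blast
  define f where "f z = Complex (\<Sum>\<mu>\<in>M. \<psi> \<mu> (Re z) * cosh (sqrt \<mu> * Im z))
      (\<Sum>\<mu>\<in>M. (\<psi>' \<mu> (Re z) - a (Re z) * \<psi> \<mu> (Re z)) * (sinh (sqrt \<mu> * Im z) / sqrt \<mu>))" for z
  obtain fx fy where f: "C1_on {z. \<alpha> < Re z \<and> Re z < \<beta>} f fx fy"
    "\<And>z. \<alpha> < Re z \<Longrightarrow> Re z < \<beta> \<Longrightarrow> fx z + \<i> * fy z = of_real (a (Re z)) * cnj (f z)"
    using ghost_vekua[OF M ab a(1) d dd[folded \<alpha>_def \<beta>_def]] unfolding f_def by blast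
  have f0: "cmod (f (of_real x)) = \<bar>\<Sum>\<mu>\<in>M. \<psi> \<mu> x\<bar>" for x unfolding f_def by (simp add: cmod_def)
  define c where "c = complex_of_real x0"
  have cb: "\<bar>Re z - x0\<bar> \<le> R \<and> \<bar>Im z\<bar> \<le> R" if "z \<in> cball c R" for z R
    using that abs_Re_le_cmod[of "c - z"] abs_Im_le_cmod[of "c - z"] unfolding c_def
    by (simp add: dist_norm abs_minus_commute)
  have U: "cball c (2 * (5 * r)) \<subseteq> {z. \<alpha> < Re z \<and> Re z < \<beta>}"
    using cb[of _ "10 * r"] r unfolding \<alpha>_def \<beta>_def by fastforce
  have U': "z \<in> cball c (2 * (5 * r))" if "z \<in> cball c (5 * r)" for z using that r by simp
  obtain y where y: "\<And>j. j < N \<Longrightarrow> y j \<in> E"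
    "\<And>i j. i < N \<Longrightarrow> j < N \<Longrightarrow> \<bar>real i - real j\<bar> * m / (2 * real N) \<le> \<bar>y i - y j\<bar>"
    using obtain_separated_nodes[OF E m N] by blast
  have near: "\<bar>x0 - y j\<bar> \<le> r" if "j < N" for j using y(1)[OF that] E(2) by fastforce
  have m2: "m \<le> 2 * r"
  proof -
    have "measure lebesgue E \<le> measure lebesgue {x0 - r..x0 + r}"
      by (rule measure_mono_fmeasurable) (use E in auto)
    thus ?thesis using m r by simp
  qed
  have L1: "1 \<le> (12 * r / m) ^ N" using m m2 by (intro one_le_power) (simp add: field_simps)
  have "cmod (f c) \<le> exp (12 * B * (5 * r)) * (N * (12 * r / m) ^ N * \<delta> + (P + Q1 + B * Q2) / 4 ^ N)"
  proof (rule vekua_interpolation_estimate[OF _ B f(1) U, where a="\<lambda>z. a (Re z)" and x="\<lambda>j. of_real (y j)"])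
    have "continuous_on {z. \<alpha> < Re z \<and> Re z < \<beta>} (\<lambda>z. a (Re z))"
      by (rule continuous_on_compose2[OF primitive_on_continuous[OF a(1)] continuous_on_Re[OF continuous_on_id]]) auto
    thus "continuous_on (cball c (2 * (5 * r))) (\<lambda>z. a (Re z))" using U by (rule continuous_on_subset)
    show "\<bar>a (Re z)\<bar> \<le> B" if "z \<in> cball c (2 * (5 * r))" for z
      using a(2)[of "Re z"] subsetD[OF U that] by auto
    show "fx z + \<i> * fy z = of_real (a (Re z)) * cnj (f z)" if "z \<in> cball c (5 * r)" for z
      using f(2)[of z] subsetD[OF U U'[OF that]] by auto
    show "inj_on (\<lambda>j. complex_of_real (y j)) {..<N}"
    proof (rule inj_onI)
      fix i j assume ij: "i \<in> {..<N}" "j \<in> {..<N}" "complex_of_real (y i) = complex_of_real (y j)"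
      hence "\<bar>real i - real j\<bar> * m / (2 * real N) \<le> 0" using y(2)[of i j] by simp
      moreover have "2 * real N > 0" using N by simp
      ultimately have "\<bar>real i - real j\<bar> * m \<le> 0" by (simp add: divide_le_0_iff)
      thus "i = j" using m by (simp add: mult_le_0_iff)
    qed
    show "dist c (complex_of_real (y j)) \<le> 5 * r / 5" if "j < N" for j
      using near[OF that] unfolding c_def dist_of_real by (simp add: dist_real_def)
    show "cmod (f (complex_of_real (y j))) \<le> \<delta>" if "j < N" for j unfolding f0 using \<delta>[OF y(1)[OF that]] .
    show "cmod (f z) \<le> P + Q1 + B * Q2" if "z \<in> sphere c (5 * r)" for z
    proof -
      have z: "\<bar>Re z - x0\<bar> \<le> 5 * r" "\<bar>Im z\<bar> \<le> 5 * r" and zb: "z \<in> cball c (5 * r)" using cb[of z "5 * r"] that by auto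
      have aB: "\<bar>a (Re z)\<bar> \<le> B" using a(2)[of "Re z"] subsetD[OF U U'[OF zb]] by auto
      have "Im (f z) = (\<Sum>\<mu>\<in>M. sinh (sqrt \<mu> * Im z) / sqrt \<mu> * \<psi>' \<mu> (Re z))
          - a (Re z) * (\<Sum>\<mu>\<in>M. sinh (sqrt \<mu> * Im z) / sqrt \<mu> * \<psi> \<mu> (Re z))"
        unfolding f_def by (simp add: sum_distrib_left sum_subtractf[symmetric] algebra_simps diff_divide_distrib)
      moreover have "\<bar>a (Re z) * (\<Sum>\<mu>\<in>M. sinh (sqrt \<mu> * Im z) / sqrt \<mu> * \<psi> \<mu> (Re z))\<bar> \<le> B * Q2"
        unfolding abs_mult using aB Q2[OF z] B by (intro mult_mono) auto
      ultimately have "\<bar>Im (f z)\<bar> \<le> Q1 + B * Q2" using Q1[OF z] by linarith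
      moreover have "\<bar>Re (f z)\<bar> \<le> P" using P[OF z] unfolding f_def by (simp add: mult.commute)
      ultimately show ?thesis using cmod_le[of "f z"] by linarith
    qed
    show "(\<Prod>i\<in>{..<N} - {j}. dist c (complex_of_real (y i)) / dist (complex_of_real (y j)) (complex_of_real (y i))) \<le> (12 * r / m) ^ N"
      if "j < N" for j
      using lagrange_coefficient_bound[OF m(1) m2 that, of y x0] y(2) that near
      unfolding c_def dist_of_real dist_real_def by auto
  qed (use r N L1 in auto)
  moreover have "12 * B * (5 * r) = 60 * B * r" by simp
  ultimately show ?thesis unfolding c_def f0 by simp
qed

section \<open>Integrable functions on the line and their boundary terms\<close>

lemma set_integral_le_integral:
  fixes p :: "real \<Rightarrow> real"
  assumes "integrable lebesgue p" "\<And>x. 0 \<le> p x" "S \<in> sets lebesgue"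
  shows "(LINT x:S|lebesgue. p x) \<le> (LINT x|lebesgue. p x)"
  unfolding set_lebesgue_integral_def
  by (rule integral_mono[OF integrable_mult_indicator[OF assms(3,1)] assms(1)]) (use assms(2) in \<open>auto simp: indicator_def\<close>)

lemma has_integral_Icc_lebesgue:
  fixes p :: "real \<Rightarrow> real"
  assumes "integrable lebesgue p"
  shows "(p has_integral (LINT x:{a..b}|lebesgue. p x)) {a..b}"
  by (rule has_integral_set_lebesgue) (auto simp: set_integrable_def intro!: integrable_mult_indicator[of _ lebesgue, OF _ assms, simplified])

text \<open>An integrable function need not tend to 0 at infinity, but it is small at arbitrarily
  distant points; boundary terms are evaluated at such points.\<close>

lemma positive_lower_bound_not_integrable:
  fixes w :: "real \<Rightarrow> real"
  assumes w: "integrable lebesgue w" "\<And>x. 0 \<le> w x" and c: "0 < c"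
  shows "\<exists>x\<ge>R. w x < c"
proof (rule ccontr)
  assume "\<not> ?thesis"
  hence ge: "c \<le> w x" if "R \<le> x" for x using that by force
  define S where "S = integral\<^sup>L lebesgue w"
  have S0: "0 \<le> S" unfolding S_def using w by (simp add: integral_nonneg_AE)
  define T where "T = (S + 1) / c"
  have T: "T > 0" unfolding T_def using S0 c by simp
  have "c * T = (LINT x|lebesgue. c * indicator {R..R + T} x)" using T by simp
  also have "\<dots> \<le> S" unfolding S_def
  proof (rule integral_mono)
    have "integrable lebesgue (indicat_real {R..R + T})" by (rule integrable_real_indicator) (use T in auto)
    thus "integrable lebesgue (\<lambda>x. c * indicat_real {R..R + T} x)" by (rule integrable_mult_right)
  qed (use w ge in \<open>auto simp: indicator_def\<close>)
  finally show False unfolding T_def using c by simp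
qed

text \<open>Makes integration by parts on the line free of boundary terms. The truncated integrals
  converge to the full one by dominated convergence, while the integrable function q(R) - q(-R) is
  small for some arbitrarily large R.\<close>

lemma integral_eq_0_of_integrable_primitive:
  fixes p q :: "real \<Rightarrow> real"
  assumes p: "integrable lebesgue p" and q: "integrable lebesgue q"
    and pq: "\<And>R. 0 \<le> R \<Longrightarrow> (p has_integral (q R - q (- R))) {- R..R}"
  shows "integral\<^sup>L lebesgue p = 0"
proof (rule ccontr)
  assume nz: "integral\<^sup>L lebesgue p \<noteq> 0"
  define L where "L = integral\<^sup>L lebesgue p"
  have s: "q R - q (- R) = (LINT x|lebesgue. indicator {- R..R} x *\<^sub>R p x)" if "0 \<le> R" for R
  proof -
    have "(p has_integral (LINT x:{- R..R}|lebesgue. p x)) {- R..R}" by (rule has_integral_Icc_lebesgue[OF p])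
    thus ?thesis using pq[OF that] has_integral_unique unfolding set_lebesgue_integral_def by blast
  qed
  have "((\<lambda>R. LINT x|lebesgue. indicator {- R..R} x *\<^sub>R p x) \<longlongrightarrow> L) at_top"
    unfolding L_def
  proof (rule integral_dominated_convergence_at_top[where w="\<lambda>x. \<bar>p x\<bar>"])
    show "(\<lambda>x. indicator {- R..R} x *\<^sub>R p x) \<in> borel_measurable lebesgue" for R
      by (rule borel_measurable_integrable[OF integrable_mult_indicator[OF _ p]]) simp
    show "AE x in lebesgue. ((\<lambda>R. indicator {- R..R} x *\<^sub>R p x) \<longlongrightarrow> p x) at_top"
    proof (rule AE_I2)
      fix x :: real
      have "\<forall>\<^sub>F R in at_top. indicator {- R..R} x *\<^sub>R p x = p x"
        using eventually_ge_at_top[of "\<bar>x\<bar>"] by eventually_elim (auto simp: indicator_def)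
      thus "((\<lambda>R. indicator {- R..R} x *\<^sub>R p x) \<longlongrightarrow> p x) at_top" by (rule tendsto_eventually)
    qed
  qed (use p in \<open>auto intro!: always_eventually simp: indicator_def\<close>)
  hence "\<forall>\<^sub>F R in at_top. dist (LINT x|lebesgue. indicator {- R..R} x *\<^sub>R p x) L < \<bar>L\<bar> / 2"
    by (rule tendstoD) (use nz in \<open>simp add: L_def\<close>)
  then obtain R0 where R0: "\<And>R. R \<ge> R0 \<Longrightarrow> dist (LINT x|lebesgue. indicator {- R..R} x *\<^sub>R p x) L < \<bar>L\<bar> / 2"
    unfolding eventually_at_top_linorder by blast
  have "integrable lebesgue (\<lambda>R. q (- R))"
    using lebesgue_integrable_real_affine[OF q, of "-1" 0] by simp
  hence "integrable lebesgue (\<lambda>R. \<bar>q R - q (- R)\<bar>)" using q by auto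
  hence "\<exists>R\<ge>max 0 R0. \<bar>q R - q (- R)\<bar> < \<bar>L\<bar> / 2"
    by (rule positive_lower_bound_not_integrable) (use nz in \<open>auto simp: L_def\<close>)
  then obtain R where "R \<ge> max 0 R0" "\<bar>q R - q (- R)\<bar> < \<bar>L\<bar> / 2" by blast
  moreover from this have "\<bar>(q R - q (- R)) - L\<bar> < \<bar>L\<bar> / 2" using R0[of R] s[of R] by (simp add: dist_real_def)
  ultimately show False by linarith
qed

text \<open>One-dimensional Sobolev embedding: the square is integrated back from a distant point
  where it is small, and -2 w w' \<le> w^2 + w'^2.\<close>

lemma sup_bound_H1:
  fixes w w' :: "real \<Rightarrow> real"
  assumes d: "\<And>x. (w has_real_derivative w' x) (at x)"
    and c: "continuous_on UNIV w'"
    and i: "integrable lebesgue (\<lambda>x. (w x)\<^sup>2)" "integrable lebesgue (\<lambda>x. (w' x)\<^sup>2)"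
  shows "(w x)\<^sup>2 \<le> (LINT x|lebesgue. (w x)\<^sup>2) + (LINT x|lebesgue. (w' x)\<^sup>2)"
proof (rule field_le_epsilon)
  fix e :: real assume "e > 0"
  with positive_lower_bound_not_integrable[OF i(1)]
  obtain y where y: "y \<ge> x" "(w y)\<^sup>2 < e" by (metis zero_le_power2)
  have wc: "continuous_on S w" for S using d by (meson DERIV_isCont continuous_at_imp_continuous_on)
  have "((\<lambda>t. - (2 * w t * w' t)) has_integral (- (w y)\<^sup>2 - - (w x)\<^sup>2)) {x..y}"
    by (rule fundamental_theorem_of_calculus)
      (use y d in \<open>auto simp: has_real_derivative_iff_has_vector_derivative[symmetric] intro!: derivative_eq_intros intro: has_field_derivative_at_within\<close>)
  moreover define p where "p t = (w t)\<^sup>2 + (w' t)\<^sup>2" for t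
  have pint: "integrable lebesgue p" unfolding p_def using i by auto
  have "(p has_integral (LINT t:{x..y}|lebesgue. p t)) {x..y}" by (rule has_integral_Icc_lebesgue[OF pint])
  ultimately have "(- (w y)\<^sup>2 - - (w x)\<^sup>2) \<le> (LINT t:{x..y}|lebesgue. p t)"
  proof (rule has_integral_le)
    fix t show "- (2 * w t * w' t) \<le> p t"
      unfolding p_def using zero_le_power2[of "w t + w' t"] by (simp add: power2_sum)
  qed
  also have "\<dots> \<le> (LINT t|lebesgue. p t)" by (rule set_integral_le_integral[OF pint]) (auto simp: p_def)
  also have "\<dots> = (LINT x|lebesgue. (w x)\<^sup>2) + (LINT x|lebesgue. (w' x)\<^sup>2)" unfolding p_def using i by simp
  finally show "(w x)\<^sup>2 \<le> (LINT x|lebesgue. (w x)\<^sup>2) + (LINT x|lebesgue. (w' x)\<^sup>2) + e" using y by simp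
qed

section \<open>Eigenfunctions\<close>

lemma integrable_product_L2:
  fixes f g :: "real \<Rightarrow> real"
  assumes "integrable lebesgue (\<lambda>x. (f x)\<^sup>2)" "integrable lebesgue (\<lambda>x. (g x)\<^sup>2)"
    and m: "f \<in> borel_measurable lebesgue" "g \<in> borel_measurable lebesgue"
  shows "integrable lebesgue (\<lambda>x. f x * g x)"
proof (rule Bochner_Integration.integrable_bound)
  show "integrable lebesgue (\<lambda>x. (f x)\<^sup>2 + (g x)\<^sup>2)" using assms by simp
  have "\<bar>a * b\<bar> \<le> a\<^sup>2 + b\<^sup>2" for a b :: real
  proof -
    have "2 * (\<bar>a\<bar> * \<bar>b\<bar>) \<le> a\<^sup>2 + b\<^sup>2" using zero_le_power2[of "\<bar>a\<bar> - \<bar>b\<bar>"] by (simp add: power2_diff)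
    moreover have "0 \<le> \<bar>a\<bar> * \<bar>b\<bar>" by simp
    ultimately show ?thesis unfolding abs_mult by linarith
  qed
  thus "AE x in lebesgue. norm (f x * g x) \<le> norm ((f x)\<^sup>2 + (g x)\<^sup>2)" by simp
qed (use m in measurable)

lemma continuous_imp_borel_lebesgue:
  fixes f :: "real \<Rightarrow> real"
  assumes "continuous_on UNIV f" shows "f \<in> borel_measurable lebesgue"
  using continuous_imp_measurable_on_sets_lebesgue[OF assms] by (simp add: lebesgue_on_UNIV_eq)

lemma integrable_of_bounded_integrals:
  fixes h :: "real \<Rightarrow> real"
  assumes h: "\<And>x. 0 \<le> h x" and hm: "h \<in> borel_measurable lebesgue"
    and hi: "\<And>n::nat. h integrable_on {- real n..real n}"
    and K: "\<And>n::nat. integral {- real n..real n} h \<le> K"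
  shows "integrable lebesgue h"
proof -
  define f where "f n x = indicator {- real n..real n} x *\<^sub>R h x" for n x
  have ai: "h absolutely_integrable_on {- real n..real n}" for n
    by (rule nonnegative_absolutely_integrable_1[OF hi]) (use h in auto)
  hence fi: "integrable lebesgue (f n)" for n unfolding f_def set_integrable_def .
  have fI: "integral\<^sup>L lebesgue (f n) = integral {- real n..real n} h" for n
    using set_lebesgue_integral_eq_integral(2)[OF ai[of n]] unfolding f_def set_lebesgue_integral_def by simp
  have mono: "f m x \<le> f n x" if "m \<le> n" for m n x
    unfolding f_def using that h[of x] by (auto simp: indicator_def)
  have inc: "incseq (\<lambda>n. integral\<^sup>L lebesgue (f n))"
    unfolding incseq_def using fi mono by (auto intro: integral_mono)
  obtain L where L: "(\<lambda>n. integral\<^sup>L lebesgue (f n)) \<longlonglongrightarrow> L"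
    by (rule incseq_convergent[OF inc, of K]) (use K in \<open>auto simp: fI\<close>)
  show ?thesis
  proof (rule integrable_monotone_convergence[OF fi _ _ L hm])
    show "AE x in lebesgue. mono (\<lambda>n. f n x)" using mono by (auto simp: mono_def)
    show "AE x in lebesgue. (\<lambda>i. f i x) \<longlonglongrightarrow> h x"
    proof (rule AE_I2)
      fix x
      obtain n0 :: nat where n0: "\<bar>x\<bar> \<le> real n0" using real_arch_simple by blast
      have "\<forall>\<^sub>F n in sequentially. f n x = h x"
        using eventually_ge_at_top[of n0]
      proof eventually_elim
        case (elim n)
        hence "real n0 \<le> real n" by simp
        hence "x \<in> {- real n..real n}" using n0 by auto
        thus ?case unfolding f_def by simp
      qed
      thus "(\<lambda>i. f i x) \<longlonglongrightarrow> h x" by (rule tendsto_eventually)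
    qed
  qed
qed

locale potential =
  fixes V :: "real \<Rightarrow> real"
  assumes V_meas: "V \<in> borel_measurable lebesgue"
    and V_nonneg: "\<And>x. 0 \<le> V x"
    and V_bounded: "\<And>R. \<exists>K. \<forall>x. \<bar>x\<bar> \<le> R \<longrightarrow> V x \<le> K"
begin

lemma V_integrable_Icc: "V integrable_on {a..b}"
proof -
  obtain K where K: "\<And>x. \<bar>x\<bar> \<le> max \<bar>a\<bar> \<bar>b\<bar> \<Longrightarrow> V x \<le> K" using V_bounded by blast
  have "V absolutely_integrable_on {a..b}"
  proof (rule measurable_bounded_by_integrable_imp_absolutely_integrable)
    show "V \<in> borel_measurable (lebesgue_on {a..b})" using V_meas by (rule measurable_restrict_space1)
    show "(\<lambda>_. K) integrable_on {a..b}" by (rule integrable_const_ivl)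
    show "norm (V x) \<le> K" if "x \<in> {a..b}" for x using K[of x] V_nonneg[of x] that by auto
  qed auto
  thus ?thesis by (rule set_lebesgue_integral_eq_integral(1))
qed

definition eigen_solution :: "real \<Rightarrow> (real \<Rightarrow> real) \<Rightarrow> (real \<Rightarrow> real) \<Rightarrow> bool"
  where "eigen_solution \<mu> u u' \<longleftrightarrow>
    (\<forall>x. (u has_real_derivative u' x) (at x)) \<and>
    (\<forall>a b. primitive_on a b u' (\<lambda>x. (V x - \<mu>) * u x)) \<and>
    integrable lebesgue (\<lambda>x. (u x)\<^sup>2)"

lemma eigen_solutionD:
  assumes "eigen_solution \<mu> u u'"
  shows "(u has_real_derivative u' x) (at x)" "primitive_on a b u' (\<lambda>x. (V x - \<mu>) * u x)"
    "integrable lebesgue (\<lambda>x. (u x)\<^sup>2)" "primitive_on a b u u'" "continuous_on S u" "continuous_on S u'"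
    "u \<in> borel_measurable lebesgue" "u' \<in> borel_measurable lebesgue"
proof -
  show d: "\<And>x. (u has_real_derivative u' x) (at x)" and p: "\<And>a b. primitive_on a b u' (\<lambda>x. (V x - \<mu>) * u x)"
    and "integrable lebesgue (\<lambda>x. (u x)\<^sup>2)"
    using assms unfolding eigen_solution_def by auto
  have uc: "continuous_on UNIV u" using d by (meson DERIV_isCont continuous_at_imp_continuous_on)
  have "isCont u' x" for x
    using primitive_on_continuous[OF p[of "x - 1" "x + 1"]] by (rule continuous_on_interior) auto
  hence u'c: "continuous_on UNIV u'" by (simp add: continuous_at_imp_continuous_on)
  show "continuous_on S u" "continuous_on S u'" by (rule continuous_on_subset[OF uc subset_UNIV], rule continuous_on_subset[OF u'c subset_UNIV])
  show "primitive_on a b u u'" by (rule primitive_on_C1[OF d continuous_on_subset[OF u'c subset_UNIV]])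
  show "u \<in> borel_measurable lebesgue" "u' \<in> borel_measurable lebesgue"
    by (rule continuous_imp_borel_lebesgue[OF uc], rule continuous_imp_borel_lebesgue[OF u'c])
qed

lemma eigen_solution_product_primitive:
  assumes u: "eigen_solution \<mu> u u'" and v: "eigen_solution \<nu> v v'"
  shows "primitive_on a b (\<lambda>x. u' x * v x) (\<lambda>x. u' x * v' x + (V x - \<mu>) * (u x * v x))"
  by (rule primitive_on_cong[OF primitive_on_mult[OF eigen_solutionD(2)[OF u] eigen_solutionD(4)[OF v]]])
    (auto simp: algebra_simps)

text \<open>If the energy of \<open>u\<close> were infinite, \<open>(u\<^sup>2)' = 2 u u'\<close> would stay above a positive constant near
  infinity, and \<open>u\<^sup>2\<close> would not be integrable.\<close>

lemma eigen_solution_energy: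
  assumes u: "eigen_solution \<mu> u u'"
  shows "integrable lebesgue (\<lambda>x. (u' x)\<^sup>2)" "integrable lebesgue (\<lambda>x. V x * (u x)\<^sup>2)"
proof -
  note uD = eigen_solutionD[OF u]
  define h where "h x = (u' x)\<^sup>2 + V x * (u x)\<^sup>2" for x
  have h0: "0 \<le> h x" for x unfolding h_def using V_nonneg[of x] by simp
  have hm: "h \<in> borel_measurable lebesgue" unfolding h_def using uD(7,8) V_meas by measurable
  define g where "g x = u' x * u x" for x
  have g: "((\<lambda>x. h x - \<mu> * (u x)\<^sup>2) has_integral (g y - g x)) {x..y}" if "x \<le> y" for x y
    using primitive_onD[OF eigen_solution_product_primitive[OF u u, of x y] order_refl that order_refl]
    unfolding g_def h_def by (simp add: power2_eq_square algebra_simps)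
  define S where "S = (LINT x|lebesgue. (u x)\<^sup>2)"
  have us: "((\<lambda>x. \<mu> * (u x)\<^sup>2) has_integral (\<mu> * (LINT t:{x..y}|lebesgue. (u t)\<^sup>2))) {x..y}" for x y
    by (intro has_integral_mult_right has_integral_Icc_lebesgue uD(3))
  define K where "K = \<bar>\<mu>\<bar> * S"
  have usK: "\<bar>\<mu> * (LINT t:{x..y}|lebesgue. (u t)\<^sup>2)\<bar> \<le> K" for x y
  proof -
    have "0 \<le> (LINT t:{x..y}|lebesgue. (u t)\<^sup>2)" unfolding set_lebesgue_integral_def
      by (rule integral_nonneg_AE) auto
    moreover have "(LINT t:{x..y}|lebesgue. (u t)\<^sup>2) \<le> S" unfolding S_def
      by (rule set_integral_le_integral[OF uD(3)]) auto
    ultimately show ?thesis unfolding K_def abs_mult by (intro mult_mono) auto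
  qed
  have hI: "(h has_integral (g y - g x + \<mu> * (LINT t:{x..y}|lebesgue. (u t)\<^sup>2))) {x..y}" if "x \<le> y" for x y
    using has_integral_add[OF g[OF that] us[of x y]] by simp
  \<comment> \<open>g = u u' = (u^2)'/2 would be increasing but for the mass term, whose integral
    over any interval is at most \<open>K\<close> in modulus. Thus \<open>g\<close> never falls by
    more than \<open>K\<close>, and a value above K + 1 keeps it above 1 from there on.\<close>
  have gmono: "g x - K \<le> g y" if "x \<le> y" for x y
  proof -
    have "0 \<le> g y - g x + \<mu> * (LINT t:{x..y}|lebesgue. (u t)\<^sup>2)"
      by (rule has_integral_nonneg[OF hI[OF that]]) (rule h0)
    thus ?thesis using usK[of x y] by linarith
  qed
  have du: "((\<lambda>x. (u x)\<^sup>2) has_real_derivative 2 * g x) (at x)" for x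
    unfolding g_def using uD(1)[of x] by (auto intro!: derivative_eq_intros)
  have upper: "g x \<le> K + 1" for x
  proof (rule ccontr)
    assume "\<not> ?thesis"
    hence g1: "1 \<le> g y" if "x \<le> y" for y using gmono[OF that] by linarith
    \<comment> \<open>A point at distance at least 1 with u^2 < 1: slope at least 2 would have
      raised u^2 to at least 2 there. The lower bound is the mirror image, to the left.\<close>
    from positive_lower_bound_not_integrable[OF uD(3), of 1 "x + 1"]
    obtain y where y: "y \<ge> x + 1" "(u y)\<^sup>2 < 1" by auto
    have "\<exists>z. x < z \<and> z < y \<and> (u y)\<^sup>2 - (u x)\<^sup>2 = (y - x) * (2 * g z)"
      by (rule MVT2) (use y du in auto)
    then obtain z where z: "x < z" "(u y)\<^sup>2 - (u x)\<^sup>2 = (y - x) * (2 * g z)" by auto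
    have "1 * 2 \<le> (y - x) * (2 * g z)" using y g1[of z] z by (intro mult_mono) auto
    hence "2 \<le> (u y)\<^sup>2 - (u x)\<^sup>2" using z(2) by linarith
    moreover have "0 \<le> (u x)\<^sup>2" by simp
    ultimately show False using y(2) by linarith
  qed
  have lower: "- (K + 1) \<le> g x" for x
  proof (rule ccontr)
    assume "\<not> ?thesis"
    hence g1: "g y \<le> - 1" if "y \<le> x" for y using gmono[OF that] by linarith
    have "integrable lebesgue (\<lambda>x. (u (- x))\<^sup>2)" using lebesgue_integrable_real_affine[OF uD(3), of "-1" 0] by simp
    from positive_lower_bound_not_integrable[OF this, of 1 "- x + 1"]
    obtain y' where y': "y' \<ge> - x + 1" "(u (- y'))\<^sup>2 < 1" by auto
    define y where "y = - y'"
    have y: "y \<le> x - 1" "(u y)\<^sup>2 < 1" using y' unfolding y_def by auto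
    have "\<exists>z. y < z \<and> z < x \<and> (u x)\<^sup>2 - (u y)\<^sup>2 = (x - y) * (2 * g z)"
      by (rule MVT2) (use y du in auto)
    then obtain z where z: "z < x" "(u x)\<^sup>2 - (u y)\<^sup>2 = (x - y) * (2 * g z)" by auto
    have "1 * 2 \<le> (x - y) * (2 * (- g z))" using y g1[of z] z by (intro mult_mono) auto
    hence "2 \<le> (u y)\<^sup>2 - (u x)\<^sup>2" using z(2) by simp
    moreover have "0 \<le> (u x)\<^sup>2" by simp
    ultimately show False using y(2) by linarith
  qed
  have "integral {- R..R} h \<le> 2 * (K + 1) + K" if "0 \<le> R" for R
  proof -
    have eq: "integral {- R..R} h = g R - g (- R) + \<mu> * (LINT t:{- R..R}|lebesgue. (u t)\<^sup>2)"
      by (rule integral_unique[OF hI]) (use that in simp)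
    show ?thesis unfolding eq
      using add_mono[OF diff_mono[OF upper[of R] lower[of "- R"]] abs_le_D1[OF usK[of "- R" R]]] by simp
  qed
  hence "integral {- real n..real n} h \<le> 2 * (K + 1) + K" for n :: nat by simp
  moreover have "h integrable_on {- real n..real n}" for n :: nat
    using hI[of "- real n" "real n"] by (auto simp: integrable_on_def)
  ultimately have hint: "integrable lebesgue h" using integrable_of_bounded_integrals[OF h0 hm] by blast
  show "integrable lebesgue (\<lambda>x. (u' x)\<^sup>2)"
    by (rule Bochner_Integration.integrable_bound[OF hint])
      (use uD(8) V_nonneg in \<open>auto simp: h_def\<close>)
  show "integrable lebesgue (\<lambda>x. V x * (u x)\<^sup>2)"
    by (rule Bochner_Integration.integrable_bound[OF hint])
      (use uD(7) V_meas V_nonneg in \<open>auto simp: h_def\<close>)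
qed

lemma eigen_solution_integrable_products:
  assumes u: "eigen_solution \<mu> u u'" and v: "eigen_solution \<nu> v v'"
  shows "integrable lebesgue (\<lambda>x. u x * v x)" "integrable lebesgue (\<lambda>x. u' x * v' x)"
    "integrable lebesgue (\<lambda>x. V x * (u x * v x))" "integrable lebesgue (\<lambda>x. u' x * v x)"
proof -
  note uD = eigen_solutionD[OF u] and vD = eigen_solutionD[OF v]
  note uE = eigen_solution_energy[OF u] and vE = eigen_solution_energy[OF v]
  show "integrable lebesgue (\<lambda>x. u x * v x)" "integrable lebesgue (\<lambda>x. u' x * v' x)" "integrable lebesgue (\<lambda>x. u' x * v x)"
    by (intro integrable_product_L2 uD(3,7,8) vD(3,7,8) uE(1) vE(1))+
  have s: "(\<lambda>x. sqrt (V x)) \<in> borel_measurable lebesgue" using V_meas by measurable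
  \<comment> \<open>The weight V is distributed evenly over both factors, each of which is square
    integrable by finiteness of the energy.\<close>
  have "integrable lebesgue (\<lambda>x. (sqrt (V x) * u x) * (sqrt (V x) * v x))"
    by (rule integrable_product_L2) (use uE vE uD(7) vD(7) s V_nonneg in \<open>auto simp: power_mult_distrib\<close>)
  moreover have "(sqrt (V x) * u x) * (sqrt (V x) * v x) = V x * (u x * v x)" for x
    using real_sqrt_mult_self[of "V x"] V_nonneg[of x] by (simp add: algebra_simps)
  ultimately show "integrable lebesgue (\<lambda>x. V x * (u x * v x))" by simp
qed

lemma eigen_solution_form:
  assumes u: "eigen_solution \<mu> u u'" and v: "eigen_solution \<nu> v v'"
  shows "(LINT x|lebesgue. u' x * v' x) + (LINT x|lebesgue. V x * (u x * v x)) = \<mu> * (LINT x|lebesgue. u x * v x)"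
proof -
  note I = eigen_solution_integrable_products[OF u v]
  have "(LINT x|lebesgue. u' x * v' x + (V x - \<mu>) * (u x * v x)) = 0"
  proof (rule integral_eq_0_of_integrable_primitive)
    show "integrable lebesgue (\<lambda>x. u' x * v' x + (V x - \<mu>) * (u x * v x))"
      unfolding left_diff_distrib using I by simp
    show "integrable lebesgue (\<lambda>x. u' x * v x)" by (rule I(4))
    show "((\<lambda>x. u' x * v' x + (V x - \<mu>) * (u x * v x)) has_integral (u' R * v R - u' (- R) * v (- R))) {- R..R}" if "0 \<le> R" for R
      using primitive_onD[OF eigen_solution_product_primitive[OF u v, of "- R" R] order_refl _ order_refl] that by simp
  qed
  thus ?thesis unfolding left_diff_distrib using I by simp
qed

text \<open>The energy form is symmetric, so both eigenvalues multiply the same inner product to the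
  same number.\<close>

lemma eigen_solution_orthogonal:
  assumes u: "eigen_solution \<mu> u u'" and v: "eigen_solution \<nu> v v'" and "\<mu> \<noteq> \<nu>"
  shows "(LINT x|lebesgue. u x * v x) = 0"
proof -
  have "\<mu> * (LINT x|lebesgue. u x * v x) = \<nu> * (LINT x|lebesgue. u x * v x)"
    using eigen_solution_form[OF u v] eigen_solution_form[OF v u] by (simp add: mult.commute)
  thus ?thesis using \<open>\<mu> \<noteq> \<nu>\<close> by simp
qed

end

text \<open>The factor |x| cancels the division in sinh(sqrt \<mu> t)/sqrt \<mu>, making that
  multiplier bounded uniformly as \<mu> tends to 0.\<close>

lemma abs_sinh_le: "\<bar>sinh x\<bar> \<le> \<bar>x\<bar> * exp \<bar>x\<bar>" for x :: real
proof -
  have *: "sinh y \<le> y * exp y" if "0 \<le> y" for y :: real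
  proof -
    have "1 - 2 * y \<le> exp (- (2 * y))" using exp_ge_add_one_self[of "- (2 * y)"] by simp
    hence "exp y * (1 - 2 * y) \<le> exp y * exp (- (2 * y))" by (intro mult_left_mono) auto
    also have "exp y * exp (- (2 * y)) = exp (- y)" unfolding exp_add[symmetric] by simp
    finally show ?thesis unfolding sinh_field_def by (simp add: algebra_simps)
  qed
  show ?thesis using *[of x] *[of "- x"] by (cases "0 \<le> x") auto
qed

lemma abs_cosh_le: "\<bar>cosh x\<bar> \<le> exp \<bar>x\<bar>" for x :: real
  unfolding cosh_field_def by (cases "0 \<le> x") auto

section \<open>Spectral multipliers on a finite orthogonal family\<close>

locale spectral_family = potential +
  fixes M :: "real set" and \<psi> \<psi>' :: "real \<Rightarrow> real \<Rightarrow> real" and l :: real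
  assumes M: "finite M" "\<And>\<mu>. \<mu> \<in> M \<Longrightarrow> 0 < \<mu>" "\<And>\<mu>. \<mu> \<in> M \<Longrightarrow> \<mu> \<le> l"
    and \<psi>: "\<And>\<mu>. \<mu> \<in> M \<Longrightarrow> eigen_solution \<mu> (\<psi> \<mu>) (\<psi>' \<mu>)"
    and l: "0 < l"
begin

text \<open>\<open>\<alpha>\<close> is a spectral multiplier acting on the sum of the family: 1
  gives the function itself, \<mu> applies the operator, and the \<open>cosh\<close> and
  \<open>sinh\<close> multipliers give the extension in the ghost variable at a fixed time.\<close>

definition comb :: "(real \<Rightarrow> real) \<Rightarrow> real \<Rightarrow> real"
  where "comb \<alpha> x = (\<Sum>\<mu>\<in>M. \<alpha> \<mu> * \<psi> \<mu> x)"

definition comb' :: "(real \<Rightarrow> real) \<Rightarrow> real \<Rightarrow> real"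
  where "comb' \<alpha> x = (\<Sum>\<mu>\<in>M. \<alpha> \<mu> * \<psi>' \<mu> x)"

definition total :: "real \<Rightarrow> real"
  where "total x = (\<Sum>\<mu>\<in>M. \<psi> \<mu> x)"

definition n2 :: real
  where "n2 = (LINT x|lebesgue. (total x)\<^sup>2)"

lemma total_comb: "total = comb (\<lambda>_. 1)"
  unfolding total_def comb_def by simp

lemma comb_deriv: "(comb \<alpha> has_real_derivative comb' \<alpha> x) (at x)"
  unfolding comb_def comb'_def by (auto intro!: derivative_eq_intros eigen_solutionD(1)[OF \<psi>] simp: mult.commute)

lemma comb_continuous: "continuous_on S (comb \<alpha>)" "continuous_on S (comb' \<alpha>)"
  unfolding comb_def comb'_def by (intro continuous_intros eigen_solutionD(5,6)[OF \<psi>], assumption)+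

lemma comb_measurable: "comb \<alpha> \<in> borel_measurable lebesgue" "comb' \<alpha> \<in> borel_measurable lebesgue"
  by (rule continuous_imp_borel_lebesgue[OF comb_continuous(1)], rule continuous_imp_borel_lebesgue[OF comb_continuous(2)])

lemma comb'_primitive: "primitive_on a b (comb' \<alpha>) (\<lambda>x. V x * comb \<alpha> x - comb (\<lambda>\<mu>. \<alpha> \<mu> * \<mu>) x)"
proof -
  have "primitive_on a b (comb' \<alpha>) (\<lambda>x. \<Sum>\<mu>\<in>M. \<alpha> \<mu> * ((V x - \<mu>) * \<psi> \<mu> x))"
    unfolding comb'_def by (intro primitive_on_sum primitive_on_cmult eigen_solutionD(2)[OF \<psi>])
  thus ?thesis by (rule primitive_on_cong) (auto simp: comb_def sum_distrib_left sum_subtractf[symmetric] algebra_simps)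
qed

lemma comb_square_integral:
  "integrable lebesgue (\<lambda>x. (comb \<alpha> x)\<^sup>2)"
  "(LINT x|lebesgue. (comb \<alpha> x)\<^sup>2) = (\<Sum>\<mu>\<in>M. (\<alpha> \<mu>)\<^sup>2 * (LINT x|lebesgue. (\<psi> \<mu> x)\<^sup>2))"
proof -
  have sq: "(comb \<alpha> x)\<^sup>2 = (\<Sum>i\<in>M. \<Sum>j\<in>M. \<alpha> i * \<alpha> j * (\<psi> i x * \<psi> j x))" for x
    unfolding comb_def power2_eq_square sum_product by (simp add: mult_ac)
  note I = eigen_solution_integrable_products(1)[OF \<psi> \<psi>]
  show "integrable lebesgue (\<lambda>x. (comb \<alpha> x)\<^sup>2)" unfolding sq
    by (intro Bochner_Integration.integrable_sum integrable_mult_right I)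
  have "(LINT x|lebesgue. (comb \<alpha> x)\<^sup>2) = (\<Sum>i\<in>M. \<Sum>j\<in>M. \<alpha> i * \<alpha> j * (LINT x|lebesgue. \<psi> i x * \<psi> j x))"
    unfolding sq using I by (simp add: Bochner_Integration.integral_sum Bochner_Integration.integrable_sum)
  also have "\<dots> = (\<Sum>i\<in>M. \<Sum>j\<in>M. if j = i then (\<alpha> i)\<^sup>2 * (LINT x|lebesgue. (\<psi> i x)\<^sup>2) else 0)"
    using eigen_solution_orthogonal[OF \<psi> \<psi>] by (intro sum.cong refl) (auto simp: power2_eq_square)
  finally show "(LINT x|lebesgue. (comb \<alpha> x)\<^sup>2) = (\<Sum>\<mu>\<in>M. (\<alpha> \<mu>)\<^sup>2 * (LINT x|lebesgue. (\<psi> \<mu> x)\<^sup>2))"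
    using M(1) by simp
qed

lemma comb_energy:
  "integrable lebesgue (\<lambda>x. (comb' \<alpha> x)\<^sup>2)" "integrable lebesgue (\<lambda>x. V x * (comb \<alpha> x)\<^sup>2)"
  "(LINT x|lebesgue. (comb' \<alpha> x)\<^sup>2) + (LINT x|lebesgue. V x * (comb \<alpha> x)\<^sup>2)
    = (\<Sum>\<mu>\<in>M. \<mu> * ((\<alpha> \<mu>)\<^sup>2 * (LINT x|lebesgue. (\<psi> \<mu> x)\<^sup>2)))"
proof -
  have sq: "V x * (comb \<alpha> x)\<^sup>2 = (\<Sum>i\<in>M. \<Sum>j\<in>M. \<alpha> i * \<alpha> j * (V x * (\<psi> i x * \<psi> j x)))" for x
    unfolding comb_def power2_eq_square sum_product by (simp add: sum_distrib_left mult_ac)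
  have sq': "(comb' \<alpha> x)\<^sup>2 = (\<Sum>i\<in>M. \<Sum>j\<in>M. \<alpha> i * \<alpha> j * (\<psi>' i x * \<psi>' j x))" for x
    unfolding comb'_def power2_eq_square sum_product by (simp add: mult_ac)
  note I = eigen_solution_integrable_products(2,3)[OF \<psi> \<psi>]
  show "integrable lebesgue (\<lambda>x. (comb' \<alpha> x)\<^sup>2)" "integrable lebesgue (\<lambda>x. V x * (comb \<alpha> x)\<^sup>2)" unfolding sq sq'
    by (intro Bochner_Integration.integrable_sum integrable_mult_right I; assumption)+
  have "(LINT x|lebesgue. (comb' \<alpha> x)\<^sup>2) + (LINT x|lebesgue. V x * (comb \<alpha> x)\<^sup>2)
      = (\<Sum>i\<in>M. \<Sum>j\<in>M. \<alpha> i * \<alpha> j * ((LINT x|lebesgue. \<psi>' i x * \<psi>' j x) + (LINT x|lebesgue. V x * (\<psi> i x * \<psi> j x))))"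
    unfolding sq sq' using I
    by (simp add: Bochner_Integration.integral_sum Bochner_Integration.integrable_sum sum.distrib[symmetric] distrib_left)
  also have "\<dots> = (\<Sum>i\<in>M. \<Sum>j\<in>M. if j = i then i * ((\<alpha> i)\<^sup>2 * (LINT x|lebesgue. (\<psi> i x)\<^sup>2)) else 0)"
    using eigen_solution_orthogonal[OF \<psi> \<psi>] eigen_solution_form[OF \<psi> \<psi>]
    by (intro sum.cong refl) (auto simp: power2_eq_square)
  finally show "(LINT x|lebesgue. (comb' \<alpha> x)\<^sup>2) + (LINT x|lebesgue. V x * (comb \<alpha> x)\<^sup>2)
    = (\<Sum>\<mu>\<in>M. \<mu> * ((\<alpha> \<mu>)\<^sup>2 * (LINT x|lebesgue. (\<psi> \<mu> x)\<^sup>2)))"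
    using M(1) by simp
qed

lemma psi_square_nonneg: "0 \<le> (LINT x|lebesgue. (\<psi> \<mu> x)\<^sup>2)"
  by (rule integral_nonneg_AE) auto

lemma n2_sum: "n2 = (\<Sum>\<mu>\<in>M. (LINT x|lebesgue. (\<psi> \<mu> x)\<^sup>2))"
  unfolding n2_def total_comb comb_square_integral by simp

lemma n2_nonneg: "0 \<le> n2"
  unfolding n2_sum by (intro sum_nonneg psi_square_nonneg)

context
  fixes \<alpha> :: "real \<Rightarrow> real" and \<kappa> :: real
  assumes \<alpha>: "\<And>\<mu>. \<mu> \<in> M \<Longrightarrow> \<bar>\<alpha> \<mu>\<bar> \<le> \<kappa>" and \<kappa>: "0 \<le> \<kappa>"
begin

lemma comb_square_le: "(LINT x|lebesgue. (comb \<alpha> x)\<^sup>2) \<le> \<kappa>\<^sup>2 * n2"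
  unfolding comb_square_integral n2_sum sum_distrib_left
  by (intro sum_mono mult_right_mono psi_square_nonneg) (use \<alpha> in \<open>auto intro: abs_le_square_iff[THEN iffD1] simp: \<kappa>\<close>)

lemma comb_energy_le:
  "(LINT x|lebesgue. (comb' \<alpha> x)\<^sup>2) + (LINT x|lebesgue. V x * (comb \<alpha> x)\<^sup>2) \<le> l * (\<kappa>\<^sup>2 * n2)"
  unfolding comb_energy n2_sum sum_distrib_left
proof (intro sum_mono mult_mono mult_right_mono psi_square_nonneg)
  show "\<mu> \<le> l" if "\<mu> \<in> M" for \<mu> using M(3)[OF that] .
  show "(\<alpha> \<mu>)\<^sup>2 \<le> \<kappa>\<^sup>2" if "\<mu> \<in> M" for \<mu> using \<alpha>[OF that] \<kappa> by (simp add: abs_le_square_iff[symmetric])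
qed (use l psi_square_nonneg in auto)

lemma comb'_square_le: "(LINT x|lebesgue. (comb' \<alpha> x)\<^sup>2) \<le> l * (\<kappa>\<^sup>2 * n2)"
proof -
  have "0 \<le> (LINT x|lebesgue. V x * (comb \<alpha> x)\<^sup>2)" using V_nonneg by (intro integral_nonneg_AE) auto
  thus ?thesis using comb_energy_le by linarith
qed

text \<open>The Sobolev bound, with both norms diagonal by orthogonality: the multiplier contributes
  at most \<kappa> and the energy at most a factor l. The bound is polynomial in l, hence
  harmless.\<close>

lemma comb_sup: "\<bar>comb \<alpha> x\<bar> \<le> \<kappa> * (1 + l) * sqrt n2"
proof (rule abs_le_square_iff[THEN iffD2, of _ "\<kappa> * (1 + l) * sqrt n2", THEN order_trans])
  have "(comb \<alpha> x)\<^sup>2 \<le> \<kappa>\<^sup>2 * n2 + l * (\<kappa>\<^sup>2 * n2)"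
    using sup_bound_H1[OF comb_deriv comb_continuous(2) comb_square_integral(1) comb_energy(1), of \<alpha> x]
      comb_square_le comb'_square_le by linarith
  also have "\<dots> = (1 + l) * (\<kappa>\<^sup>2 * n2)" by (simp add: algebra_simps)
  also have "\<dots> \<le> (1 + l)\<^sup>2 * (\<kappa>\<^sup>2 * n2)"
    using l n2_nonneg by (intro mult_right_mono) (auto simp: power2_eq_square)
  also have "\<dots> = (\<kappa> * (1 + l) * sqrt n2)\<^sup>2" using n2_nonneg by (simp add: power_mult_distrib)
  finally show "(comb \<alpha> x)\<^sup>2 \<le> (\<kappa> * (1 + l) * sqrt n2)\<^sup>2" .
  show "\<bar>\<kappa> * (1 + l) * sqrt n2\<bar> \<le> \<kappa> * (1 + l) * sqrt n2" using \<kappa> l n2_nonneg by simp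
qed

end

text \<open>V is unbounded, so no global bound on second derivatives is at hand. By the equation,
  the derivative changes by at most \<open>c\<close> over the unit interval to the right of x; a
  larger value would persist there and contradict its L2 bound.\<close>

lemma comb'_sup:
  assumes \<alpha>: "\<And>\<mu>. \<mu> \<in> M \<Longrightarrow> \<bar>\<alpha> \<mu>\<bar> \<le> \<kappa>" and \<kappa>: "0 \<le> \<kappa>"
    and \<Lambda>: "\<And>y. y \<in> {x..x + 1} \<Longrightarrow> V y \<le> \<Lambda>"
  shows "\<bar>comb' \<alpha> x\<bar> \<le> \<kappa> * (1 + l)\<^sup>2 * (1 + \<Lambda>) * sqrt n2"
proof -
  define n where "n = sqrt n2"
  have n0: "0 \<le> n" unfolding n_def using n2_nonneg by simp
  have \<Lambda>0: "0 \<le> \<Lambda>" using \<Lambda>[of x] V_nonneg[of x] by simp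
  define c where "c = \<Lambda> * (\<kappa> * (1 + l) * n) + \<kappa> * l * (1 + l) * n"
  define I where "I = l * (\<kappa>\<^sup>2 * n2)"
  have I0: "0 \<le> I" unfolding I_def using l n2_nonneg by simp
  have c0: "0 \<le> c" unfolding c_def using \<Lambda>0 \<kappa> l n0 by simp
  have "\<bar>comb' \<alpha> x\<bar> \<le> c + sqrt I"
  proof (rule ccontr)
    assume a: "\<not> ?thesis"
    define b where "b = \<bar>comb' \<alpha> x\<bar> - c"
    have b: "sqrt I < b" unfolding b_def using a by simp
    have ge: "b\<^sup>2 \<le> (comb' \<alpha> y)\<^sup>2" if y: "y \<in> {x..x + 1}" for y
    proof -
      have "((\<lambda>t. V t * comb \<alpha> t - comb (\<lambda>\<mu>. \<alpha> \<mu> * \<mu>) t) has_integral (comb' \<alpha> y - comb' \<alpha> x)) {x..y}"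
        using primitive_onD[OF comb'_primitive[of x y]] y by simp
      hence "\<bar>comb' \<alpha> y - comb' \<alpha> x\<bar> \<le> c * (y - x)"
      proof (rule has_integral_abs_le)
        fix t assume t: "t \<in> {x..y}"
        have "\<bar>comb \<alpha> t\<bar> \<le> \<kappa> * (1 + l) * n" unfolding n_def by (rule comb_sup[OF \<alpha> \<kappa>])
        hence "\<bar>V t * comb \<alpha> t\<bar> \<le> \<Lambda> * (\<kappa> * (1 + l) * n)"
          unfolding abs_mult using \<Lambda>[of t] V_nonneg[of t] \<Lambda>0 t y by (intro mult_mono) auto
        moreover have "\<bar>comb (\<lambda>\<mu>. \<alpha> \<mu> * \<mu>) t\<bar> \<le> (\<kappa> * l) * (1 + l) * n"
          unfolding n_def
        proof (rule comb_sup)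
          show "\<bar>\<alpha> \<mu> * \<mu>\<bar> \<le> \<kappa> * l" if "\<mu> \<in> M" for \<mu>
            unfolding abs_mult using \<alpha>[OF that] M(2,3)[OF that] \<kappa> by (intro mult_mono) auto
        qed (use \<kappa> l in auto)
        ultimately show "\<bar>V t * comb \<alpha> t - comb (\<lambda>\<mu>. \<alpha> \<mu> * \<mu>) t\<bar> \<le> c" unfolding c_def by linarith
      qed (use y c0 in auto)
      also have "\<dots> \<le> c * 1" using y c0 by (intro mult_left_mono) auto
      finally have "b \<le> \<bar>comb' \<alpha> y\<bar>" unfolding b_def by linarith
      moreover have "0 \<le> b" using b real_sqrt_ge_zero[OF I0] by linarith
      ultimately show ?thesis by (simp add: abs_le_square_iff[symmetric])
    qed
    have "((\<lambda>_. b\<^sup>2) has_integral (b\<^sup>2 * (x + 1 - x))) {x..x + 1}"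
      using has_integral_const_real[of "b\<^sup>2" x "x + 1"] by (simp add: mult.commute)
    hence "b\<^sup>2 * (x + 1 - x) \<le> (LINT t:{x..x + 1}|lebesgue. (comb' \<alpha> t)\<^sup>2)"
      by (rule has_integral_le[OF _ has_integral_Icc_lebesgue[OF comb_energy(1)]]) (use ge in auto)
    also have "\<dots> \<le> (LINT t|lebesgue. (comb' \<alpha> t)\<^sup>2)"
      by (rule set_integral_le_integral[OF comb_energy(1)]) auto
    also have "\<dots> \<le> I" unfolding I_def by (rule comb'_square_le[OF \<alpha> \<kappa>])
    finally have "b\<^sup>2 \<le> I" by simp
    hence "b \<le> sqrt I" by (rule real_le_rsqrt)
    thus False using b by simp
  qed
  moreover have "sqrt I \<le> \<kappa> * (1 + l) * n"
  proof (rule real_le_lsqrt)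
    have "l * (\<kappa>\<^sup>2 * n2) \<le> (1 + l)\<^sup>2 * (\<kappa>\<^sup>2 * n2)"
      using l n2_nonneg by (intro mult_right_mono) (auto simp: power2_eq_square algebra_simps \<kappa>)
    also have "\<dots> = (\<kappa> * (1 + l) * n)\<^sup>2" unfolding n_def using n2_nonneg by (simp add: power_mult_distrib)
    finally show "I \<le> (\<kappa> * (1 + l) * n)\<^sup>2" unfolding I_def .
  qed (use \<kappa> l n0 I0 in auto)
  moreover have "c + \<kappa> * (1 + l) * n \<le> \<kappa> * (1 + l)\<^sup>2 * (1 + \<Lambda>) * n"
  proof -
    have "\<kappa> * (1 + l)\<^sup>2 * (1 + \<Lambda>) * n - (c + \<kappa> * (1 + l) * n) = \<kappa> * n * (1 + l) * (l * \<Lambda>)"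
      unfolding c_def by (simp add: power2_eq_square algebra_simps)
    moreover have "0 \<le> \<kappa> * n * (1 + l) * (l * \<Lambda>)" using \<kappa> n0 l \<Lambda>0 by simp
    ultimately show ?thesis by linarith
  qed
  ultimately show ?thesis unfolding n_def by linarith
qed

text \<open>Agmon-type localisation in its crudest form: half of the mass lies in \<open>[-X, X]\<close>.\<close>

lemma large_value:
  assumes X: "0 < X" and V: "\<And>x. X \<le> \<bar>x\<bar> \<Longrightarrow> 2 * l \<le> V x"
  obtains x0 where "\<bar>x0\<bar> \<le> X" "n2 \<le> 4 * X * (total x0)\<^sup>2"
proof -
  note I = comb_square_integral(1)[of "\<lambda>_. 1", folded total_comb]
  have tc: "continuous_on S total" for S unfolding total_comb by (rule comb_continuous)
  have "\<exists>x0\<in>{-X..X}. \<forall>y\<in>{-X..X}. (total y)\<^sup>2 \<le> (total x0)\<^sup>2"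
    by (rule continuous_attains_sup) (use X tc in \<open>auto intro!: continuous_intros\<close>)
  then obtain x0 where x0: "x0 \<in> {-X..X}" "\<And>y. y \<in> {-X..X} \<Longrightarrow> (total y)\<^sup>2 \<le> (total x0)\<^sup>2" by blast
  have VI: "integrable lebesgue (\<lambda>x. V x * (total x)\<^sup>2)" unfolding total_comb by (rule comb_energy)
  have "(LINT x|lebesgue. V x * (total x)\<^sup>2) \<le> l * (1\<^sup>2 * n2)"
  proof -
    have "0 \<le> (LINT x|lebesgue. (comb' (\<lambda>_. 1) x)\<^sup>2)" by (intro integral_nonneg_AE) auto
    moreover have "(LINT x|lebesgue. (comb' (\<lambda>_. 1) x)\<^sup>2) + (LINT x|lebesgue. V x * (comb (\<lambda>_. 1) x)\<^sup>2) \<le> l * (1\<^sup>2 * n2)"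
      by (rule comb_energy_le) auto
    ultimately show ?thesis unfolding total_comb by linarith
  qed
  moreover have ind: "integrable lebesgue (indicat_real {-X..X})" by (rule integrable_real_indicator) (use X in auto)
  have "2 * l * n2 = (LINT x|lebesgue. 2 * l * (total x)\<^sup>2)" unfolding n2_def by simp
  \<comment> \<open>Outside [-X, X] the potential dominates 2l, inside the maximum does. Since the
    potential energy is at most l n2, half of the left side is absorbed.\<close>
  also have "\<dots> \<le> (LINT x|lebesgue. V x * (total x)\<^sup>2 + 2 * l * (total x0)\<^sup>2 * indicat_real {-X..X} x)"
  proof (rule integral_mono)
    fix x
    show "2 * l * (total x)\<^sup>2 \<le> V x * (total x)\<^sup>2 + 2 * l * (total x0)\<^sup>2 * indicat_real {-X..X} x"
    proof (cases "x \<in> {-X..X}")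
      case True
      have "2 * l * (total x)\<^sup>2 \<le> 2 * l * (total x0)\<^sup>2" using x0(2)[OF True] l by simp
      moreover have "0 \<le> V x * (total x)\<^sup>2" using V_nonneg[of x] by simp
      ultimately show ?thesis using True by simp
    next
      case False
      hence "2 * l \<le> V x" by (intro V) auto
      thus ?thesis using False by (simp add: mult_right_mono)
    qed
  qed (use I VI ind in auto)
  also have "\<dots> = (LINT x|lebesgue. V x * (total x)\<^sup>2) + 2 * l * (total x0)\<^sup>2 * (2 * X)"
    using VI ind X by simp
  finally have "l * n2 \<le> l * (4 * X * (total x0)\<^sup>2)"
    using \<open>(LINT x|lebesgue. V x * (total x)\<^sup>2) \<le> l * (1\<^sup>2 * n2)\<close> by (simp add: algebra_simps)
  hence "n2 \<le> 4 * X * (total x0)\<^sup>2" using l by simp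
  with x0(1) show thesis by (intro that[of x0]) auto
qed

end

section \<open>Propagation of smallness\<close>

context spectral_family begin

text \<open>All requirements are expressed through one scale T: the genuine exponents B r and r sqrt
  l, and the logarithms of everything polynomial. The density \<theta> then enters only through |ln
  \<theta>|, once for each of about T nodes.\<close>

lemma propagation_estimate:
  fixes x0 X r B T \<theta> :: real
  assumes x0: "n2 \<le> 4 * X * (total x0)\<^sup>2" and X: "0 < X"
    and r: "0 < r" and B: "0 < B"
    and VB: "\<And>x. \<bar>x - x0\<bar> \<le> 11 * r + 1 \<Longrightarrow> V x \<le> B\<^sup>2"
    and E0: "E0 \<in> sets lebesgue" "E0 \<subseteq> {x0 - r..x0 + r}"
    and \<theta>: "0 < \<theta>" "\<theta> \<le> 1 / 2" "2 * \<theta> * r \<le> measure lebesgue E0"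
    and T: "1 \<le> T" "1 + l \<le> exp T" "1 + B\<^sup>2 \<le> exp T" "1 + 10 * r \<le> exp T" "1 / r \<le> exp T"
      "4 * sqrt X \<le> exp T" "B * r \<le> T" "r * sqrt l \<le> T"
  shows "sqrt n2 \<le> exp (622 * T * \<bar>ln \<theta>\<bar>) * sqrt (LINT x:E0|lebesgue. (total x)\<^sup>2)"
proof -
  define n where "n = sqrt n2"
  have n0: "0 \<le> n" and nn: "n\<^sup>2 = n2" unfolding n_def using n2_nonneg by auto
  define W where "W = sqrt (LINT x:E0|lebesgue. (total x)\<^sup>2)"
  have Wnn: "0 \<le> (LINT x:E0|lebesgue. (total x)\<^sup>2)" unfolding set_lebesgue_integral_def by (rule integral_nonneg_AE) auto
  hence W0: "0 \<le> W" and WW: "W\<^sup>2 = (LINT x:E0|lebesgue. (total x)\<^sup>2)" unfolding W_def by auto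
  define z where "z = \<bar>ln \<theta>\<bar>"
  have z: "exp z = 1 / \<theta>" "1 / 2 \<le> z"
  proof -
    have z': "z = - ln \<theta>" unfolding z_def using \<theta> by simp
    thus "exp z = 1 / \<theta>" using \<theta> by (simp add: exp_minus inverse_eq_divide)
    have "exp (1 / 2 :: real) \<le> 2"
    proof (rule power2_le_imp_le)
      have "(exp (1 / 2 :: real))\<^sup>2 = exp 1" by (simp add: power2_eq_square exp_add[symmetric])
      also have "\<dots> \<le> 2\<^sup>2" using exp_le by simp
      finally show "(exp (1 / 2 :: real))\<^sup>2 \<le> 2\<^sup>2" .
    qed simp
    also have "2 \<le> exp z" unfolding \<open>exp z = 1 / \<theta>\<close> using \<theta> by (simp add: field_simps)
    finally show "1 / 2 \<le> z" by simp
  qed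
  have x0n: "n \<le> 2 * sqrt X * \<bar>total x0\<bar>"
  proof (rule power2_le_imp_le)
    show "n\<^sup>2 \<le> (2 * sqrt X * \<bar>total x0\<bar>)\<^sup>2" unfolding nn using x0 X by (simp add: power_mult_distrib)
  qed (use X in auto)
  have tm: "total \<in> borel_measurable lebesgue" unfolding total_comb by (rule comb_measurable)
  have tI: "integrable lebesgue (\<lambda>x. (total x)\<^sup>2)" unfolding total_comb by (rule comb_square_integral)
  define m0 where "m0 = measure lebesgue E0"
  have m0: "2 * \<theta> * r \<le> m0" "0 < m0"
    using \<theta> r unfolding m0_def by (auto intro: less_le_trans[of 0 "2 * \<theta> * r"])
  have E0f: "E0 \<in> lmeasurable" using E0 by (meson bounded_closed_interval bounded_set_imp_lmeasurable bounded_subset)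
  \<comment> \<open>\<open>W\<close> may be 0, so the argument runs with a strictly larger value,
    which makes the threshold \<open>\<delta>\<close> positive; the excess is removed at the
    end.\<close>
  have main: "n \<le> exp (622 * T * z) * W1" if W1: "W < W1" for W1
  proof -
    have W10: "0 < W1" using W1 W0 by linarith
    \<comment> \<open>Chebyshev threshold: at most half of \<open>E0\<close> carries values above
      \<open>\<delta>\<close>, so the nodes can be taken from the other half.\<close>
    define \<delta> where "\<delta> = W1 * sqrt (2 / m0)"
    have \<delta>0: "0 < \<delta>" unfolding \<delta>_def using W10 m0 by simp
    have \<delta>2: "\<delta>\<^sup>2 = W1\<^sup>2 * (2 / m0)" unfolding \<delta>_def using m0 by (simp add: power_mult_distrib)
    define Bd where "Bd = {x \<in> E0. \<delta> < \<bar>total x\<bar>}"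
    have Bdm: "Bd \<in> sets lebesgue"
    proof -
      have "{x \<in> space lebesgue. \<delta> < \<bar>total x\<bar>} \<in> sets lebesgue" using tm by measurable
      moreover have "Bd = E0 \<inter> {x \<in> space lebesgue. \<delta> < \<bar>total x\<bar>}" unfolding Bd_def by auto
      ultimately show ?thesis using E0(1) by auto
    qed
    have Bdf: "Bd \<in> lmeasurable" by (rule fmeasurableI2[OF E0f _ Bdm]) (auto simp: Bd_def)
    have "\<delta>\<^sup>2 * measure lebesgue Bd = (LINT x|lebesgue. \<delta>\<^sup>2 * indicat_real Bd x)" by simp
    also have "\<dots> \<le> (LINT x|lebesgue. indicator E0 x *\<^sub>R (total x)\<^sup>2)"
    proof (rule integral_mono)
      show "integrable lebesgue (\<lambda>x. \<delta>\<^sup>2 * indicat_real Bd x)"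
        by (intro integrable_mult_right integrable_real_indicator Bdm) (use Bdf in \<open>auto simp: fmeasurable_def\<close>)
      show "integrable lebesgue (\<lambda>x. indicator E0 x *\<^sub>R (total x)\<^sup>2)"
        by (rule integrable_mult_indicator[OF E0(1) tI])
      fix x
      show "\<delta>\<^sup>2 * indicat_real Bd x \<le> indicator E0 x *\<^sub>R (total x)\<^sup>2"
      proof (cases "x \<in> Bd")
        case True
        hence "\<delta>\<^sup>2 \<le> \<bar>total x\<bar>\<^sup>2" using \<delta>0 unfolding Bd_def by (intro power_mono) auto
        thus ?thesis using True unfolding Bd_def by simp
      qed (auto simp: indicator_def)
    qed
    also have "\<dots> = W\<^sup>2" unfolding WW set_lebesgue_integral_def ..
    also have "\<dots> \<le> W1\<^sup>2" using W1 W0 by (intro power_mono) auto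
    finally have "W1\<^sup>2 * (2 / m0 * measure lebesgue Bd) \<le> W1\<^sup>2 * 1" unfolding \<delta>2 by (simp add: mult.assoc)
    hence "2 / m0 * measure lebesgue Bd \<le> 1" using W10 by (subst (asm) mult_le_cancel_left_pos) auto
    hence Bdh: "measure lebesgue Bd \<le> m0 / 2" using m0 by (simp add: field_simps)
    define E where "E = E0 - Bd"
    have Em: "E \<in> sets lebesgue" "E \<subseteq> {x0 - r..x0 + r}" unfolding E_def using E0 Bdm by auto
    define m where "m = m0 / 2"
    have "measure lebesgue E = m0 - measure lebesgue Bd" unfolding E_def m0_def
      by (rule measurable_measure_Diff) (use E0f Bdm in \<open>auto simp: Bd_def\<close>)
    hence mE: "m \<le> measure lebesgue E" unfolding m_def using Bdh by simp
    have m0': "0 < m" "\<theta> * r \<le> m" unfolding m_def using m0 by auto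
    \<comment> \<open>4^N \<ge> e^N must beat exp(70 T): 60 T from the similarity factor, 9 T from
      the growth of \<open>f\<close>, and T from 4 sqrt X. The remainder is then at most n and is
      absorbed into 2n.\<close>
    define N where "N = nat \<lceil>70 * T\<rceil>"
    have N: "70 * T \<le> real N" "real N \<le> 71 * T" "0 < N"
    proof -
      show "70 * T \<le> real N" unfolding N_def by linarith
      show "real N \<le> 71 * T" unfolding N_def using T(1) by linarith
      show "0 < N" unfolding N_def using T(1) by simp
    qed
    define \<kappa> where "\<kappa> = exp (5 * T)"
    have st: "\<bar>sqrt \<mu> * t\<bar> \<le> 5 * T" if "\<mu> \<in> M" "\<bar>t\<bar> \<le> 5 * r" for \<mu> t
    proof -
      have "\<bar>sqrt \<mu> * t\<bar> \<le> sqrt l * (5 * r)" unfolding abs_mult using M(2,3)[OF that(1)] that l r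
        by (intro mult_mono) auto
      thus ?thesis using T(8) by (simp add: mult.commute mult.left_commute)
    qed
    have ck: "\<bar>cosh (sqrt \<mu> * t)\<bar> \<le> \<kappa>" if "\<mu> \<in> M" "\<bar>t\<bar> \<le> 5 * r" for \<mu> t
      using abs_cosh_le[of "sqrt \<mu> * t"] st[OF that] unfolding \<kappa>_def by (meson exp_le_cancel_iff order_trans)
    have sk: "\<bar>sinh (sqrt \<mu> * t) / sqrt \<mu>\<bar> \<le> 5 * r * \<kappa>" if "\<mu> \<in> M" "\<bar>t\<bar> \<le> 5 * r" for \<mu> t
    proof -
      have \<mu>: "0 < sqrt \<mu>" using M(2)[OF that(1)] by simp
      have "\<bar>sinh (sqrt \<mu> * t)\<bar> \<le> (sqrt \<mu> * \<bar>t\<bar>) * exp \<bar>sqrt \<mu> * t\<bar>"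
        using abs_sinh_le[of "sqrt \<mu> * t"] \<mu> by (simp add: abs_mult)
      also have "\<dots> \<le> (sqrt \<mu> * (5 * r)) * \<kappa>"
        unfolding \<kappa>_def using \<mu> that(2) st[OF that] r by (intro mult_mono) auto
      finally show ?thesis using \<mu> by (simp add: abs_divide divide_le_eq mult_ac)
    qed
    have \<kappa>0: "0 < \<kappa>" "0 \<le> 5 * r * \<kappa>" unfolding \<kappa>_def using r by auto
    define P where "P = \<kappa> * (1 + l) * n"
    define Q1 where "Q1 = 5 * r * \<kappa> * (1 + l)\<^sup>2 * (1 + B\<^sup>2) * n"
    define Q2 where "Q2 = 5 * r * \<kappa> * (1 + l) * n"
    have LP: "\<bar>\<Sum>\<mu>\<in>M. \<psi> \<mu> x0\<bar> \<le> exp (60 * B * r) * (N * (12 * r / m) ^ N * \<delta> + (P + Q1 + B * Q2) / 4 ^ N)"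
    proof (rule local_propagation[OF M(1,2) r B V_integrable_Icc _ eigen_solutionD(1)[OF \<psi>] eigen_solutionD(2)[OF \<psi>] Em m0'(1) mE])
      show "0 \<le> V x \<and> V x \<le> B\<^sup>2" if "x \<in> {x0 - 11 * r..x0 + 11 * r}" for x
        using V_nonneg[of x] VB[of x] that by auto
      show "\<bar>\<Sum>\<mu>\<in>M. \<psi> \<mu> x\<bar> \<le> \<delta>" if "x \<in> E" for x
        using that unfolding E_def Bd_def total_def[symmetric] by auto
      fix x t assume xt: "\<bar>x - x0\<bar> \<le> 5 * r" "\<bar>t\<bar> \<le> 5 * r"
      show "\<bar>\<Sum>\<mu>\<in>M. cosh (sqrt \<mu> * t) * \<psi> \<mu> x\<bar> \<le> P"
        unfolding P_def n_def using comb_sup[of "\<lambda>\<mu>. cosh (sqrt \<mu> * t)" \<kappa> x] ck xt \<kappa>0 unfolding comb_def by simp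
      show "\<bar>\<Sum>\<mu>\<in>M. sinh (sqrt \<mu> * t) / sqrt \<mu> * \<psi> \<mu> x\<bar> \<le> Q2"
        unfolding Q2_def n_def using comb_sup[of "\<lambda>\<mu>. sinh (sqrt \<mu> * t) / sqrt \<mu>" "5 * r * \<kappa>" x] sk xt \<kappa>0 unfolding comb_def by blast
      have "V y \<le> B\<^sup>2" if "y \<in> {x..x + 1}" for y using VB[of y] that xt r by auto
      thus "\<bar>\<Sum>\<mu>\<in>M. sinh (sqrt \<mu> * t) / sqrt \<mu> * \<psi>' \<mu> x\<bar> \<le> Q1"
        unfolding Q1_def n_def using comb'_sup[of "\<lambda>\<mu>. sinh (sqrt \<mu> * t) / sqrt \<mu>" "5 * r * \<kappa>" x "B\<^sup>2"] sk xt \<kappa>0 unfolding comb'_def by blast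
    qed (use N in auto)
    \<comment> \<open>9 T = 5 T for \<open>\<kappa>\<close>, 2 T for (1 + l)^2, and T each for 1 +
      B^2 and 1 + 10 r.\<close>
    have PQ: "P + Q1 + B * Q2 \<le> n * exp (9 * T)"
    proof -
      define F where "F = \<kappa> * (1 + l)\<^sup>2 * (1 + B\<^sup>2) * n"
      have B1: "B \<le> 1 + B\<^sup>2" using zero_le_power2[of "B - 1"] B by (simp add: power2_diff)
      have l1: "1 + l \<le> (1 + l)\<^sup>2" using l by (simp add: power2_eq_square)
      have "P * 1 \<le> \<kappa> * (1 + l)\<^sup>2 * n * (1 + B\<^sup>2)"
        unfolding P_def using l1 \<kappa>0 n0 l by (intro mult_mono mult_right_mono mult_left_mono) auto
      hence P: "P \<le> F" unfolding F_def by (simp add: mult_ac)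
      have "B * (\<kappa> * (1 + l) * n) \<le> (1 + B\<^sup>2) * (\<kappa> * (1 + l)\<^sup>2 * n)"
        using B1 l1 \<kappa>0 n0 l B by (intro mult_mono mult_right_mono mult_left_mono) auto
      hence "5 * r * (B * (\<kappa> * (1 + l) * n)) \<le> 5 * r * F" unfolding F_def using r by (intro mult_left_mono) (auto simp: mult_ac)
      hence Q2: "B * Q2 \<le> 5 * r * F" unfolding Q2_def by (simp add: mult_ac)
      have Q1: "Q1 = 5 * r * F" unfolding Q1_def F_def by (simp add: mult_ac)
      have "P + Q1 + B * Q2 \<le> F * (1 + 10 * r)" using P Q1 Q2 by (simp add: algebra_simps)
      also have "\<dots> \<le> (exp (5 * T) * (exp T)\<^sup>2 * exp T * n) * exp T"
        unfolding F_def \<kappa>_def using T n0 l r by (intro mult_mono power_mono) auto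
      also have "\<dots> = n * exp (9 * T)" by (simp add: power2_eq_square exp_add[symmetric])
      finally show ?thesis .
    qed
    have t1: "\<bar>total x0\<bar> \<le> exp (60 * T) * (N * (12 * r / m) ^ N * \<delta> + n * exp (9 * T) / 4 ^ N)"
    proof -
      have "0 \<le> N * (12 * r / m) ^ N * \<delta>" using r m0' \<delta>0 by auto
      moreover have "0 \<le> P + Q1 + B * Q2" unfolding P_def Q1_def Q2_def using \<kappa>0 l r n0 B by simp
      moreover have "N * (12 * r / m) ^ N * \<delta> + (P + Q1 + B * Q2) / 4 ^ N \<le> N * (12 * r / m) ^ N * \<delta> + n * exp (9 * T) / 4 ^ N"
        using PQ by (intro add_left_mono divide_right_mono) auto
      ultimately have "exp (60 * B * r) * (N * (12 * r / m) ^ N * \<delta> + (P + Q1 + B * Q2) / 4 ^ N)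
          \<le> exp (60 * T) * (N * (12 * r / m) ^ N * \<delta> + n * exp (9 * T) / 4 ^ N)"
        using T(7) by (intro mult_mono) auto
      with LP show ?thesis unfolding total_def by (rule order_trans)
    qed
    have small: "4 * sqrt X * (exp (60 * T) * (n * exp (9 * T) / 4 ^ N)) \<le> n"
    proof -
      have "exp (70 * T) \<le> exp (real N)" using N by simp
      also have "\<dots> = exp 1 ^ N" by (simp add: exp_of_nat_mult[symmetric])
      also have "\<dots> \<le> 4 ^ N" using exp_le by (intro power_mono) auto
      finally have "exp (70 * T) / 4 ^ N \<le> 1" by simp
      have "4 * sqrt X * (exp (60 * T) * (n * exp (9 * T) / 4 ^ N)) \<le> exp T * (exp (60 * T) * (n * exp (9 * T) / 4 ^ N))"
        using T(6) n0 by (intro mult_right_mono) auto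
      also have "\<dots> = n * ((exp T * exp (60 * T) * exp (9 * T)) / 4 ^ N)" by simp
      also have "exp T * exp (60 * T) * exp (9 * T) = exp (70 * T)" by (simp add: exp_add[symmetric])
      also have "n * (exp (70 * T) / 4 ^ N) \<le> n * 1" using \<open>exp (70 * T) / 4 ^ N \<le> 1\<close> n0 by (rule mult_left_mono)
      finally show ?thesis by simp
    qed
    have "2 * n \<le> 4 * sqrt X * \<bar>total x0\<bar>" using x0n by simp
    also have "\<dots> \<le> 4 * sqrt X * (exp (60 * T) * (N * (12 * r / m) ^ N * \<delta> + n * exp (9 * T) / 4 ^ N))"
      using t1 X by (intro mult_left_mono) auto
    also have "\<dots> = 4 * sqrt X * (exp (60 * T) * (N * (12 * r / m) ^ N * \<delta>)) + 4 * sqrt X * (exp (60 * T) * (n * exp (9 * T) / 4 ^ N))"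
      by (simp add: distrib_left)
    finally have "n \<le> 4 * sqrt X * (exp (60 * T) * (N * (12 * r / m) ^ N * \<delta>))" using small by linarith
    also have "\<dots> \<le> exp T * (exp (60 * T) * (exp (71 * T) * exp (5 * z * (71 * T)) * (W1 * (exp z * exp T))))"
    proof (intro mult_mono)
      show "4 * sqrt X \<le> exp T" by (rule T)
      have "real N \<le> exp (real N)" using exp_ge_add_one_self[of "real N"] by linarith
      also have "\<dots> \<le> exp (71 * T)" using N by simp
      finally show "real N \<le> exp (71 * T)" .
      have "r / m \<le> r / (\<theta> * r)" using m0' \<theta> r by (intro divide_left_mono) auto
      hence rm: "r / m \<le> exp z" unfolding z(1) using r by simp
      \<comment> \<open>Since \<theta> \<le> 1/2, exp z \<ge> 2; the constant 12 of the Lagrange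
        bound becomes the fourth power of 1/\<theta>, at 5z per node in total.\<close>
      have "exp (4 * z) \<ge> 12"
      proof -
        have "2 \<le> exp z" unfolding z(1) using \<theta> by (simp add: field_simps)
        hence "2 ^ 4 \<le> exp z ^ 4" by (intro power_mono) auto
        also have "exp z ^ 4 = exp (4 * z)" by (simp add: exp_of_nat_mult[symmetric])
        finally show ?thesis by simp
      qed
      hence "12 * (r / m) \<le> exp (4 * z) * exp z" using rm r m0' by (intro mult_mono) auto
      also have "\<dots> = exp (5 * z)" by (simp add: exp_add[symmetric])
      finally have "(12 * r / m) ^ N \<le> exp (5 * z) ^ N" using r m0' by (intro power_mono) auto
      also have "\<dots> = exp (real N * (5 * z))" by (rule exp_of_nat_mult[symmetric])
      also have "\<dots> \<le> exp (5 * z * (71 * T))"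
        using mult_right_mono[OF N(2), of "5 * z"] z(2) by (simp add: mult.commute)
      finally show "(12 * r / m) ^ N \<le> exp (5 * z * (71 * T))" .
      show "\<delta> \<le> W1 * (exp z * exp T)" unfolding \<delta>_def
      proof (rule mult_left_mono)
        show "sqrt (2 / m0) \<le> exp z * exp T"
        proof (rule real_le_lsqrt)
          have "2 / m0 \<le> 2 / (2 * \<theta> * r)" using m0 \<theta> r by (intro divide_left_mono) auto
          also have "\<dots> = exp z * (1 / r)" unfolding z(1) by simp
          also have "\<dots> \<le> exp z * exp T" using T(5) by (intro mult_left_mono) auto
          also have "\<dots> \<le> (exp z * exp T)\<^sup>2"
          proof -
            have "1 \<le> exp z * exp T" using z(2) T(1) by (simp add: exp_add[symmetric])
            thus ?thesis by (simp add: power2_eq_square)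
          qed
          finally show "2 / m0 \<le> (exp z * exp T)\<^sup>2" .
        qed (use m0 in auto)
      qed (use W10 in auto)
    qed (use r m0' \<delta>0 X in auto)
    also have "\<dots> = exp (133 * T + 355 * (T * z) + z) * W1"
      by (simp add: exp_add[symmetric] algebra_simps)
    also have "\<dots> \<le> exp (622 * T * z) * W1"
    proof (rule mult_right_mono)
      \<comment> \<open>z \<ge> 1/2 and T \<ge> 1 convert all terms to multiples of T z: 622 = 2 *
        133 + 355 + 1.\<close>
      have "T * 1 \<le> T * (2 * z)" using z(2) T(1) by (intro mult_left_mono) auto
      moreover have "1 * z \<le> T * z" using z(2) T(1) by (intro mult_right_mono) auto
      ultimately have "133 * T + 355 * (T * z) + z \<le> 622 * (T * z)" by simp
      thus "exp (133 * T + 355 * (T * z) + z) \<le> exp (622 * T * z)" by simp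
    qed (use W10 in auto)
    finally show ?thesis .
  qed
  have "n \<le> exp (622 * T * z) * W"
  proof (rule field_le_epsilon)
    fix e :: real assume e: "0 < e"
    have "n \<le> exp (622 * T * z) * (W + e / exp (622 * T * z))" by (rule main) (use e in auto)
    thus "n \<le> exp (622 * T * z) * W + e" by (simp add: distrib_left)
  qed
  thus ?thesis unfolding n_def W_def z_def .
qed

end

section \<open>Thick sets\<close>

text \<open>Each summand meets one requirement on T in the propagation estimate; terms of the form
  coefficient plus twice an exponent come from absorbing a power of l into an exponential. The
  constant is explicit so that it visibly does not involve \<tau>, \<gamma>, \<omega> or V.\<close>

definition scale_const :: "real \<Rightarrow> real \<Rightarrow> real \<Rightarrow> real \<Rightarrow> real \<Rightarrow> real \<Rightarrow> real"
  where "scale_const c2 \<beta>1 \<beta>2 k d q =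
    (let b = sqrt c2 * (3 + 11 * d) powr (\<beta>2 / 2) in
      1 + 4 + ((1 + b\<^sup>2) * k powr \<beta>2 + 2 * (\<beta>2 / \<beta>1)) + ((1 + 10 * d) * k + 2 * (1 / \<beta>1))
      + (d * k powr q + 2 * (q / \<beta>1)) + (4 * k + 2 * (1 / \<beta>1)) + b * d + d)"

text \<open>K \<le> e^K, and l^q is the power 2q of sqrt l \<le> exp(sqrt l). This is where an
  exponent of at least 1/2 makes polynomial losses free.\<close>

lemma power_le_exp_sqrt:
  fixes K q l e :: real
  assumes "1 \<le> l" "0 \<le> K" "0 \<le> q" "1 / 2 \<le> e"
  shows "K * l powr q \<le> exp ((K + 2 * q) * l powr e)"
proof -
  define y where "y = l powr (1 / 2)"
  have y: "1 \<le> y" unfolding y_def using assms by (simp add: ge_one_powr_ge_zero)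
  have "K \<le> exp K" using exp_ge_add_one_self[of K] by linarith
  also have "\<dots> \<le> exp (K * y)" using mult_left_mono[OF y assms(2)] by simp
  finally have 1: "K \<le> exp (K * y)" .
  have "l powr q = y powr (2 * q)" unfolding y_def by (simp add: powr_powr)
  also have "\<dots> \<le> exp y powr (2 * q)"
  proof (rule powr_mono2)
    show "y \<le> exp y" using exp_ge_add_one_self[of y] by linarith
  qed (use y assms in auto)
  also have "\<dots> = exp (2 * q * y)" by (simp add: powr_def)
  finally have "K * l powr q \<le> exp (K * y) * exp (2 * q * y)" using 1 by (intro mult_mono) auto
  also have "\<dots> = exp ((K + 2 * q) * y)" by (simp add: exp_add[symmetric] algebra_simps)
  also have "\<dots> \<le> exp ((K + 2 * q) * l powr e)"
    unfolding y_def using assms by (simp add: mult_left_mono powr_mono)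
  finally show ?thesis .
qed

context spectral_family
begin

text \<open>R dominates the distance of the centre from the origin, so sqrt(sup V) on the window is
  of order R^(\<beta>2/2). Only the last two conditions on r fix the exponent e; the others enter
  through logarithms.\<close>

lemma scale_estimate:
  fixes c2 \<beta>1 \<beta>2 k d q e :: real
  assumes l1: "1 \<le> l" and c: "0 < c2" "0 < \<beta>1" "0 < \<beta>2" "1 \<le> k" "0 < d" "0 \<le> q" "1 / 2 \<le> e"
    and VB: "\<And>x. V x \<le> c2 * (\<bar>x\<bar> + 1) powr \<beta>2"
    and x0: "n2 \<le> 4 * X * (total x0)\<^sup>2" and X: "0 < X" "X \<le> k * l powr (1 / \<beta>1)"
    and R: "1 \<le> R" "R \<le> k * l powr (1 / \<beta>1)" "\<bar>x0\<bar> \<le> R"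
    and r: "0 < r" "r \<le> d * R" "1 / r \<le> d * R powr q"
      "r * R powr (\<beta>2 / 2) \<le> d * l powr e" "r * sqrt l \<le> d * l powr e"
    and E0: "E0 \<in> sets lebesgue" "E0 \<subseteq> {x0 - r..x0 + r}"
    and \<theta>: "0 < \<theta>" "\<theta> \<le> 1 / 2" "2 * \<theta> * r \<le> measure lebesgue E0"
  shows "sqrt n2 \<le> exp (622 * (scale_const c2 \<beta>1 \<beta>2 k d q * l powr e) * \<bar>ln \<theta>\<bar>) * sqrt (LINT x:E0|lebesgue. (total x)\<^sup>2)"
proof -
  \<comment> \<open>(3 + 11 d) R bounds |x| + 1 on the window |x - x0| \<le> 11 r + 1: R for the
    centre, 11 d R for the radius, 2 R for the additive constants.\<close>
  define b where "b = sqrt c2 * (3 + 11 * d) powr (\<beta>2 / 2)"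
  have b: "0 < b" unfolding b_def using c by simp
  define K where "K = scale_const c2 \<beta>1 \<beta>2 k d q"
  have K: "K = 1 + 4 + ((1 + b\<^sup>2) * k powr \<beta>2 + 2 * (\<beta>2 / \<beta>1)) + ((1 + 10 * d) * k + 2 * (1 / \<beta>1))
      + (d * k powr q + 2 * (q / \<beta>1)) + (4 * k + 2 * (1 / \<beta>1)) + b * d + d"
    unfolding K_def scale_const_def b_def Let_def ..
  define t1 where "t1 = (1 + b\<^sup>2) * k powr \<beta>2 + 2 * (\<beta>2 / \<beta>1)"
  define t2 where "t2 = (1 + 10 * d) * k + 2 * (1 / \<beta>1)"
  define t3 where "t3 = d * k powr q + 2 * (q / \<beta>1)"
  define t4 where "t4 = 4 * k + 2 * (1 / \<beta>1)"
  have Kt: "K = 1 + 4 + t1 + t2 + t3 + t4 + b * d + d" unfolding K t1_def t2_def t3_def t4_def ..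
  have t0: "0 \<le> t1" "0 \<le> t2" "0 \<le> t3" "0 \<le> t4" "0 \<le> b * d"
    unfolding t1_def t2_def t3_def t4_def using c b by auto
  have Kge: "1 \<le> K" "4 \<le> K" "t1 \<le> K" "t2 \<le> K" "t3 \<le> K" "t4 \<le> K" "b * d \<le> K" "d \<le> K"
    using t0 c(5) unfolding Kt by linarith+
  define T where "T = K * l powr e"
  have le1: "1 \<le> l powr e" using l1 c by (simp add: ge_one_powr_ge_zero)
  have Tge: "exp (a * l powr e) \<le> exp T" if "a \<le> K" for a
    unfolding T_def using that by (simp add: mult_right_mono)
  have Tge': "a * l powr e \<le> T" if "a \<le> K" for a
    unfolding T_def using that by (simp add: mult_right_mono)
  have Rq: "R powr v \<le> k powr v * l powr (v / \<beta>1)" if "0 \<le> v" for v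
  proof -
    have "R powr v \<le> (k * l powr (1 / \<beta>1)) powr v" using R that by (intro powr_mono2) auto
    also have "\<dots> = k powr v * l powr (v / \<beta>1)" using c l1 by (simp add: powr_mult powr_powr)
    finally show ?thesis .
  qed
  define B where "B = b * R powr (\<beta>2 / 2)"
  have B0: "0 < B" unfolding B_def using b R by simp
  have B2: "B\<^sup>2 = c2 * ((3 + 11 * d) * R) powr \<beta>2"
  proof -
    have "(R powr (\<beta>2 / 2))\<^sup>2 = R powr \<beta>2" "((3 + 11 * d) powr (\<beta>2 / 2))\<^sup>2 = (3 + 11 * d) powr \<beta>2"
      using R c by (simp_all add: power2_eq_square powr_add[symmetric])
    thus ?thesis unfolding B_def b_def using c R by (simp add: power_mult_distrib powr_mult)
  qed
  have B2': "B\<^sup>2 \<le> b\<^sup>2 * (k powr \<beta>2 * l powr (\<beta>2 / \<beta>1))"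
  proof -
    have "B\<^sup>2 = b\<^sup>2 * R powr \<beta>2"
      unfolding B_def using R by (simp add: power_mult_distrib power2_eq_square[of "R powr _"] powr_add[symmetric])
    thus ?thesis using Rq[of \<beta>2] c by (simp add: mult_left_mono)
  qed
  show ?thesis unfolding K_def[symmetric] T_def[symmetric]
  proof (rule propagation_estimate[OF x0 X(1) r(1) B0 _ E0 \<theta>])
    fix x assume "\<bar>x - x0\<bar> \<le> 11 * r + 1"
    hence "\<bar>x\<bar> + 1 \<le> R + 11 * (d * R) + 2 * R" using R r by linarith
    hence "\<bar>x\<bar> + 1 \<le> (3 + 11 * d) * R" by (simp add: algebra_simps)
    hence "(\<bar>x\<bar> + 1) powr \<beta>2 \<le> ((3 + 11 * d) * R) powr \<beta>2" using c by (intro powr_mono2) auto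
    hence "c2 * (\<bar>x\<bar> + 1) powr \<beta>2 \<le> B\<^sup>2" unfolding B2 using c by simp
    thus "V x \<le> B\<^sup>2" using VB[of x] by linarith
  next
    show "1 \<le> T" using Tge'[OF Kge(1)] le1 by simp
    have "2 * l powr 1 \<le> exp ((2 + 2 * 1) * l powr e)" by (rule power_le_exp_sqrt) (use l1 c in auto)
    also have "\<dots> \<le> exp T" by (rule Tge) (use Kge(2) in simp)
    finally show "1 + l \<le> exp T" using l1 by simp
    have k1: "1 \<le> k powr \<beta>2" "1 \<le> l powr (\<beta>2 / \<beta>1)" using c l1 by (auto simp: ge_one_powr_ge_zero)
    have "1 * 1 \<le> k powr \<beta>2 * l powr (\<beta>2 / \<beta>1)" using k1 by (intro mult_mono) auto
    hence "1 + B\<^sup>2 \<le> (1 + b\<^sup>2) * k powr \<beta>2 * l powr (\<beta>2 / \<beta>1)" using B2' by (simp add: algebra_simps)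
    also have "\<dots> \<le> exp (t1 * l powr e)" unfolding t1_def by (rule power_le_exp_sqrt) (use l1 c in auto)
    also have "\<dots> \<le> exp T" by (rule Tge[OF Kge(3)])
    finally show "1 + B\<^sup>2 \<le> exp T" .
    have "1 + 10 * r \<le> (1 + 10 * d) * R" using r R by (simp add: algebra_simps)
    also have "\<dots> \<le> (1 + 10 * d) * (k * l powr (1 / \<beta>1))" using R c by (intro mult_left_mono) auto
    also have "\<dots> = (1 + 10 * d) * k * l powr (1 / \<beta>1)" by simp
    also have "\<dots> \<le> exp (t2 * l powr e)" unfolding t2_def by (rule power_le_exp_sqrt) (use l1 c in auto)
    also have "\<dots> \<le> exp T" by (rule Tge[OF Kge(4)])
    finally show "1 + 10 * r \<le> exp T" .
    have "1 / r \<le> d * (k powr q * l powr (q / \<beta>1))"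
      using r(3) Rq[OF c(6)] c by (meson less_imp_le mult_left_mono order_trans)
    also have "\<dots> = d * k powr q * l powr (q / \<beta>1)" by simp
    also have "\<dots> \<le> exp (t3 * l powr e)" unfolding t3_def by (rule power_le_exp_sqrt) (use l1 c in auto)
    also have "\<dots> \<le> exp T" by (rule Tge[OF Kge(5)])
    finally show "1 / r \<le> exp T" .
    have kl: "1 \<le> k * l powr (1 / \<beta>1)" using R by linarith
    have "sqrt X \<le> sqrt (k * l powr (1 / \<beta>1))" using X by simp
    also have "\<dots> \<le> k * l powr (1 / \<beta>1)" using self_le_power[OF kl, of 2] kl by (intro real_le_lsqrt) auto
    finally have "4 * sqrt X \<le> 4 * k * l powr (1 / \<beta>1)" by simp
    also have "\<dots> \<le> exp (t4 * l powr e)" unfolding t4_def by (rule power_le_exp_sqrt) (use l1 c in auto)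
    also have "\<dots> \<le> exp T" by (rule Tge[OF Kge(6)])
    finally show "4 * sqrt X \<le> exp T" .
    have "B * r = b * (r * R powr (\<beta>2 / 2))" unfolding B_def by simp
    also have "\<dots> \<le> b * (d * l powr e)" using r(4) b by (intro mult_left_mono) auto
    also have "\<dots> = b * d * l powr e" by simp
    also have "\<dots> \<le> T" by (rule Tge'[OF Kge(7)])
    finally show "B * r \<le> T" .
    show "r * sqrt l \<le> T" using r(5) Tge'[OF Kge(8)] by linarith
  qed
qed

end

text \<open>The two bounds are compared far out. As a consequence case (iii) lies in s < 0, and s =
  1 belongs to the regime of case (i).\<close>

lemma potential_exponents_le:
  fixes c1 c2 \<beta>1 \<beta>2 :: real and V :: "real \<Rightarrow> real"
  assumes c: "0 < c1" "0 < c2" and b: "0 < \<beta>1" "0 < \<beta>2"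
    and V: "\<And>x. c1 * (\<bar>x\<bar> + 1) powr \<beta>1 \<le> V x \<and> V x \<le> c2 * (\<bar>x\<bar> + 1) powr \<beta>2"
  shows "\<beta>1 \<le> \<beta>2"
proof (rule ccontr)
  assume "\<not> ?thesis"
  hence d: "0 < \<beta>1 - \<beta>2" by simp
  define y where "y = (c2 / c1 + 1) powr (1 / (\<beta>1 - \<beta>2))"
  have y1: "1 \<le> y" unfolding y_def using c d by (intro ge_one_powr_ge_zero) auto
  have "c1 * y powr \<beta>1 \<le> c2 * y powr \<beta>2" using V[of "y - 1"] y1 by simp
  hence "c1 * (y powr (\<beta>1 - \<beta>2) * y powr \<beta>2) \<le> c2 * y powr \<beta>2" by (simp add: powr_add[symmetric])
  hence "c1 * y powr (\<beta>1 - \<beta>2) \<le> c2" using y1 by (simp add: mult.assoc[symmetric] mult_le_cancel_right)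
  moreover have "y powr (\<beta>1 - \<beta>2) = c2 / c1 + 1" unfolding y_def using d c by (simp add: powr_powr)
  ultimately have "c1 * (c2 / c1 + 1) \<le> c2" by simp
  moreover have "c1 * (c2 / c1 + 1) = c2 + c1" using c by (simp add: distrib_left)
  ultimately show False using c by linarith
qed

lemma japanese_bracket_bounds: "1 \<le> japanese_bracket x" "\<bar>x\<bar> \<le> japanese_bracket x" "japanese_bracket x \<le> 1 + \<bar>x\<bar>"
proof -
  show "1 \<le> japanese_bracket x" unfolding japanese_bracket_def by simp
  show "\<bar>x\<bar> \<le> japanese_bracket x" unfolding japanese_bracket_def by (rule real_le_rsqrt) simp
  show "japanese_bracket x \<le> 1 + \<bar>x\<bar>" unfolding japanese_bracket_def
    by (rule real_le_lsqrt) (auto simp: power2_sum)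
qed

lemma thickD:
  assumes "thick s \<tau> \<gamma> D \<omega>"
  shows "\<omega> \<in> sets lebesgue" "0 < \<gamma>" "\<gamma> < 1 / 2" "0 < D"
    "\<gamma> powr (japanese_bracket x powr \<tau>) * (2 * (D * japanese_bracket x powr s))
      \<le> measure lebesgue (\<omega> \<inter> {x - D * japanese_bracket x powr s..x + D * japanese_bracket x powr s})"
proof -
  show "\<omega> \<in> sets lebesgue" "0 < \<gamma>" "\<gamma> < 1 / 2" and D: "0 < D" using assms unfolding thick_def by auto
  have "0 \<le> D * japanese_bracket x powr s" using D by simp
  moreover have "\<gamma> powr (japanese_bracket x powr \<tau>) * measure lebesgue {x - D * japanese_bracket x powr s..x + D * japanese_bracket x powr s}
      \<le> measure lebesgue (\<omega> \<inter> {x - D * japanese_bracket x powr s..x + D * japanese_bracket x powr s})"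
    using assms unfolding thick_def Let_def by auto
  ultimately show "\<gamma> powr (japanese_bracket x powr \<tau>) * (2 * (D * japanese_bracket x powr s))
      \<le> measure lebesgue (\<omega> \<inter> {x - D * japanese_bracket x powr s..x + D * japanese_bracket x powr s})"
    by simp
qed

text \<open>The larger of the rates of sqrt l and of r sqrt(sup V) at distance l^(1/\<beta>1). The
  branches meet at s = (\<beta>1 - \<beta>2)/2, the threshold between cases (i) and (iii).\<close>

definition spectral_exponent :: "real \<Rightarrow> real \<Rightarrow> real \<Rightarrow> real"
  where "spectral_exponent s \<beta>1 \<beta>2 = max (1 / 2) ((s + \<beta>2 / 2) / \<beta>1)"

text \<open>For \<open>\<tau> \<ge> 2 + \<beta>2 / 2\<close> the thickness near the origin alone suffices. This keeps the constant uniform in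
  \<open>\<tau>\<close>: for smaller \<open>\<tau>\<close> the loss \<open>k powr \<tau>\<close> in \<open>\<langle>x\<rangle> powr \<tau> \<le> (k * l powr (1 / \<beta>1)) powr \<tau>\<close> is bounded.\<close>

theorem real_spectral_inequality:
  fixes c1 c2 \<beta>1 \<beta>2 s D :: real
  assumes c: "0 < c1" "0 < c2" "0 < \<beta>1" "0 < \<beta>2" "0 < D" and s: "s \<le> 1"
  obtains C where "0 < C" "\<And>\<tau> \<gamma> V \<omega> M \<psi> \<psi>' l. 0 \<le> \<tau> \<Longrightarrow>
    (\<And>x. c1 * (\<bar>x\<bar> + 1) powr \<beta>1 \<le> V x \<and> V x \<le> c2 * (\<bar>x\<bar> + 1) powr \<beta>2) \<Longrightarrow>
    thick s \<tau> \<gamma> D \<omega> \<Longrightarrow> spectral_family V M \<psi> \<psi>' l \<Longrightarrow> 1 \<le> l \<Longrightarrow>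
    (LINT x|lebesgue. (\<Sum>\<mu>\<in>M. \<psi> \<mu> x)\<^sup>2)
      \<le> (exp (C * \<bar>ln \<gamma>\<bar> * l powr (\<tau> / \<beta>1 + spectral_exponent s \<beta>1 \<beta>2)))\<^sup>2 * (LINT x:\<omega>|lebesgue. (\<Sum>\<mu>\<in>M. \<psi> \<mu> x)\<^sup>2)"
proof -
  define p where "p = spectral_exponent s \<beta>1 \<beta>2"
  have p: "1 / 2 \<le> p" "s + \<beta>2 / 2 \<le> p * \<beta>1"
    unfolding p_def spectral_exponent_def using c by (auto simp: le_max_iff_disj max_def field_simps)
  \<comment> \<open>The exponent for a window reaching from the centre back to the origin: its
    radius has order l^(1/\<beta>1), which amounts to s = 1.\<close>
  define p' where "p' = (1 + \<beta>2 / 2) / \<beta>1"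
  \<comment> \<open>Makes 1 + X at most k l^(1/\<beta>1), where |x| \<ge> X forces V \<ge>
    2l.\<close>
  define k where "k = 1 + (2 / c1) powr (1 / \<beta>1)"
  have k: "1 \<le> k" unfolding k_def by simp
  define dA where "dA = D + 1 / D + D * k powr (p * \<beta>1) + D * k"
  define dB where "dB = (1 + D) + 1 / D + (1 + D) * k powr (1 + \<beta>2 / 2) + (1 + D) * k"
  have dA: "D \<le> dA" "1 / D \<le> dA" "D * k powr (p * \<beta>1) \<le> dA" "D * k \<le> dA" "0 < dA"
  proof -
    have "0 < D" "0 < 1 / D" "0 \<le> D * k powr (p * \<beta>1)" "0 \<le> D * k" using c k by auto
    thus "D \<le> dA" "1 / D \<le> dA" "D * k powr (p * \<beta>1) \<le> dA" "D * k \<le> dA" "0 < dA"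
      unfolding dA_def by linarith+
  qed
  have dB: "1 + D \<le> dB" "1 / D \<le> dB" "(1 + D) * k powr (1 + \<beta>2 / 2) \<le> dB" "(1 + D) * k \<le> dB" "0 < dB"
  proof -
    have "0 < 1 + D" "0 < 1 / D" "0 \<le> (1 + D) * k powr (1 + \<beta>2 / 2)" "0 \<le> (1 + D) * k" using c k by auto
    thus "1 + D \<le> dB" "1 / D \<le> dB" "(1 + D) * k powr (1 + \<beta>2 / 2) \<le> dB" "(1 + D) * k \<le> dB" "0 < dB"
      unfolding dB_def by linarith+
  qed
  define KA where "KA = scale_const c2 \<beta>1 \<beta>2 k dA \<bar>s\<bar>"
  define KB where "KB = scale_const c2 \<beta>1 \<beta>2 k dB 0"
  have sc0: "0 < scale_const c2 \<beta>1 \<beta>2 k d q" if "0 < d" "0 \<le> q" for d q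
    unfolding scale_const_def Let_def using that c k by (auto intro!: add_pos_nonneg add_nonneg_nonneg mult_nonneg_nonneg)
  have KA0: "0 < KA" and KB0: "0 < KB" unfolding KA_def KB_def using sc0 dA dB by auto
  \<comment> \<open>\<tau>0/\<beta>1 = p' + 1/\<beta>1 is the exponent obtained from the thickness
    at the origin: p' for the large window and 1/\<beta>1 for the logarithm of its density. Beyond
    \<tau>0 it is below the exponent to be proved.\<close>
  define \<tau>0 where "\<tau>0 = 2 + \<beta>2 / 2"
  define CA where "CA = 622 * KA * k powr \<tau>0"
  define CB where "CB = 622 * KB * ((3 + 2 / D) * k)"
  define C where "C = CA + CB"
  have "0 < 3 + 2 / D" using c by (simp add: add_pos_pos)
  hence CA0: "0 < CA" and CB0: "0 < CB" unfolding CA_def CB_def using KA0 KB0 k by auto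
  show thesis
  proof (rule that)
    show "0 < C" unfolding C_def using CA0 CB0 by simp
    fix \<tau> \<gamma> V \<omega> M \<psi> \<psi>' l
    assume \<tau>: "0 \<le> \<tau>" and V: "\<And>x. c1 * (\<bar>x\<bar> + 1) powr \<beta>1 \<le> V x \<and> V x \<le> c2 * (\<bar>x\<bar> + 1) powr \<beta>2"
      and th: "thick s \<tau> \<gamma> D \<omega>" and sf: "spectral_family V M \<psi> \<psi>' l" and l1: "1 \<le> l"
    interpret spectral_family V M \<psi> \<psi>' l by (rule sf)
    have b12: "\<beta>1 \<le> \<beta>2" by (rule potential_exponents_le[OF c(1-4) V])
    note thD = thickD[OF th]
    define z where "z = \<bar>ln \<gamma>\<bar>"
    have zl: "z = - ln \<gamma>" "1 / 2 \<le> z"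
    proof -
      show z: "z = - ln \<gamma>" unfolding z_def using thD by simp
      \<comment> \<open>\<gamma> < 1/2 keeps |ln \<gamma>| away from 0, so terms free of \<gamma>
        can be charged to a multiple of |ln \<gamma>|.\<close>
      have "ln \<gamma> \<le> \<gamma> - 1" using thD by (intro ln_le_minus_one) auto
      thus "1 / 2 \<le> z" unfolding z using thD by linarith
    qed
    define X where "X = (2 * l / c1) powr (1 / \<beta>1)"
    have X0: "0 < X" unfolding X_def using c l1 by simp
    have Xl: "X = (2 / c1) powr (1 / \<beta>1) * l powr (1 / \<beta>1)" unfolding X_def using c l1 by (simp add: powr_mult[symmetric])
    have lb: "1 \<le> l powr (1 / \<beta>1)" using l1 c by (simp add: ge_one_powr_ge_zero)
    have X1: "1 + X \<le> k * l powr (1 / \<beta>1)" unfolding k_def Xl using lb by (simp add: algebra_simps)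
    have Xk: "X \<le> k * l powr (1 / \<beta>1)" using X1 by simp
    have VX: "2 * l \<le> V x" if "X \<le> \<bar>x\<bar>" for x
    proof -
      have "X powr \<beta>1 = 2 * l / c1" unfolding X_def using c l1 by (simp add: powr_powr)
      moreover have "X powr \<beta>1 \<le> (\<bar>x\<bar> + 1) powr \<beta>1" using that X0 c by (intro powr_mono2) auto
      ultimately have "c1 * (2 * l / c1) \<le> c1 * (\<bar>x\<bar> + 1) powr \<beta>1" using c by (intro mult_left_mono) auto
      thus ?thesis using V[of x] c by simp
    qed
    obtain x0 where x0: "\<bar>x0\<bar> \<le> X" "n2 \<le> 4 * X * (total x0)\<^sup>2" using large_value[OF X0 VX] by blast
    have Vu: "V x \<le> c2 * (\<bar>x\<bar> + 1) powr \<beta>2" for x using V[of x] by simp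
    define E where "E = \<tau> / \<beta>1 + p"
    have tI: "integrable lebesgue (\<lambda>x. (total x)\<^sup>2)" unfolding total_comb by (rule comb_square_integral)
    have fin: "n2 \<le> (exp (C * z * l powr E))\<^sup>2 * (LINT x:\<omega>|lebesgue. (total x)\<^sup>2)"
      if est: "sqrt n2 \<le> exp Q * sqrt (LINT x:E0|lebesgue. (total x)\<^sup>2)" "Q \<le> C * z * l powr E"
      and E0: "E0 \<in> sets lebesgue" "E0 \<subseteq> \<omega>" for Q E0
    proof -
      define I0 where "I0 = (LINT x:E0|lebesgue. (total x)\<^sup>2)"
      have I0: "0 \<le> I0" unfolding I0_def set_lebesgue_integral_def by (rule integral_nonneg_AE) auto
      have I0le: "I0 \<le> (LINT x:\<omega>|lebesgue. (total x)\<^sup>2)"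
        unfolding I0_def set_lebesgue_integral_def
        by (rule integral_mono[OF integrable_mult_indicator[OF E0(1) tI] integrable_mult_indicator[OF thD(1) tI]])
          (use E0(2) in \<open>auto simp: indicator_def\<close>)
      have "n2 = (sqrt n2)\<^sup>2" using n2_nonneg by simp
      also have "\<dots> \<le> (exp Q * sqrt I0)\<^sup>2" using est(1) n2_nonneg unfolding I0_def by (intro power_mono) auto
      also have "\<dots> = (exp Q)\<^sup>2 * I0" using I0 by (simp add: power_mult_distrib)
      also have "\<dots> \<le> (exp (C * z * l powr E))\<^sup>2 * (LINT x:\<omega>|lebesgue. (total x)\<^sup>2)"
        using est(2) I0 I0le by (intro mult_mono power_mono) auto
      finally show ?thesis .
    qed
    have "n2 \<le> (exp (C * z * l powr E))\<^sup>2 * (LINT x:\<omega>|lebesgue. (total x)\<^sup>2)"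
    proof (cases "\<tau> \<le> \<tau>0")
      case True
      define Y where "Y = japanese_bracket x0"
      have Y: "1 \<le> Y" "\<bar>x0\<bar> \<le> Y" "Y \<le> k * l powr (1 / \<beta>1)"
        using japanese_bracket_bounds[of x0] x0(1) X1 unfolding Y_def by auto
      define r where "r = D * Y powr s"
      have r0: "0 < r" unfolding r_def using c Y by simp
      have Yk: "Y powr v \<le> k powr v * l powr (v / \<beta>1)" if "0 \<le> v" for v
      proof -
        have "Y powr v \<le> (k * l powr (1 / \<beta>1)) powr v" using Y that by (intro powr_mono2) auto
        also have "\<dots> = k powr v * l powr (v / \<beta>1)" using k l1 by (simp add: powr_mult powr_powr)
        finally show ?thesis .
      qed
      define \<theta> where "\<theta> = \<gamma> powr (Y powr \<tau>)"
      have Y\<tau>: "1 \<le> Y powr \<tau>" using Y \<tau> by (simp add: ge_one_powr_ge_zero)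
      have \<theta>0: "0 < \<theta>" unfolding \<theta>_def using thD by simp
      have "\<theta> \<le> \<gamma> powr 1" unfolding \<theta>_def using thD(2,3) Y\<tau> by (intro powr_mono') auto
      hence \<theta>h: "\<theta> \<le> 1 / 2" using thD by simp
      have ln\<theta>: "\<bar>ln \<theta>\<bar> = Y powr \<tau> * z" unfolding \<theta>_def z_def using thD Y\<tau> by (simp add: ln_powr abs_mult)
      have "sqrt n2 \<le> exp (622 * (KA * l powr p) * \<bar>ln \<theta>\<bar>) * sqrt (LINT x:\<omega> \<inter> {x0 - r..x0 + r}|lebesgue. (total x)\<^sup>2)"
        unfolding KA_def
      proof (rule scale_estimate[OF l1 c(2-4) k dA(5) abs_ge_zero p(1) Vu x0(2) X0 Xk Y(1,3,2) r0])
        have "Y powr s \<le> Y powr 1" using Y s by (intro powr_mono) auto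
        hence "r \<le> D * Y" unfolding r_def using c Y by simp
        also have "\<dots> \<le> dA * Y" using dA Y by (intro mult_right_mono) auto
        finally show "r \<le> dA * Y" .
        have "1 / r = 1 / D * Y powr (- s)" unfolding r_def using Y by (simp add: powr_minus field_simps)
        also have "\<dots> \<le> dA * Y powr \<bar>s\<bar>" using dA Y c by (intro mult_mono powr_mono) auto
        finally show "1 / r \<le> dA * Y powr \<bar>s\<bar>" .
        have "r * Y powr (\<beta>2 / 2) = D * Y powr (s + \<beta>2 / 2)" unfolding r_def by (simp add: powr_add)
        also have "\<dots> \<le> D * Y powr (p * \<beta>1)" using p Y c by (intro mult_left_mono powr_mono) auto
        also have "\<dots> \<le> D * (k powr (p * \<beta>1) * l powr (p * \<beta>1 / \<beta>1))" using p c by (intro mult_left_mono Yk) auto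
        also have "\<dots> = D * k powr (p * \<beta>1) * l powr p" using c by simp
        also have "\<dots> \<le> dA * l powr p" using dA by (intro mult_right_mono) auto
        finally show "r * Y powr (\<beta>2 / 2) \<le> dA * l powr p" .
        have "Y powr s * l powr (1 / 2) \<le> k * l powr p"
        proof (cases "s \<le> 0")
          case True
          have "Y powr s \<le> Y powr 0" using True Y by (intro powr_mono) auto
          hence "Y powr s \<le> k" using Y k by simp
          thus ?thesis using k l1 p by (intro mult_mono powr_mono) auto
        next
          case False
          hence "Y powr s \<le> k powr s * l powr (s / \<beta>1)" by (intro Yk) auto
          also have "\<dots> \<le> k powr 1 * l powr (s / \<beta>1)" using k s by (intro mult_right_mono powr_mono) auto
          finally have "Y powr s * l powr (1 / 2) \<le> k * l powr (s / \<beta>1) * l powr (1 / 2)" using k by (intro mult_right_mono) auto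
          also have "\<dots> = k * l powr (s / \<beta>1 + 1 / 2)" by (simp add: powr_add)
          also have "\<dots> \<le> k * l powr p"
          proof (intro mult_left_mono powr_mono)
            \<comment> \<open>For s > 0 the window grows with the distance, and r sqrt l is
              controlled only because \<beta>1 \<le> \<beta>2 lets sup V dominate l in order of
              growth.\<close>
            have "s + \<beta>1 / 2 \<le> p * \<beta>1" using p b12 by linarith
            thus "s / \<beta>1 + 1 / 2 \<le> p" using c by (simp add: field_simps)
          qed (use l1 k in auto)
          finally show ?thesis .
        qed
        hence "D * (Y powr s * l powr (1 / 2)) \<le> D * (k * l powr p)" using c by (intro mult_left_mono) auto
        also have "\<dots> = D * k * l powr p" by simp
        also have "\<dots> \<le> dA * l powr p" using dA by (intro mult_right_mono) auto
        finally show "r * sqrt l \<le> dA * l powr p" unfolding r_def using l1 by (simp add: powr_half_sqrt)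
        show "2 * \<theta> * r \<le> measure lebesgue (\<omega> \<inter> {x0 - r..x0 + r})"
          using thD(5)[of x0] unfolding \<theta>_def r_def Y_def by (simp add: mult_ac)
      qed (use thD(1) \<theta>0 \<theta>h in auto)
      moreover have "622 * (KA * l powr p) * \<bar>ln \<theta>\<bar> \<le> C * z * l powr E"
      proof -
        have "Y powr \<tau> \<le> k powr \<tau> * l powr (\<tau> / \<beta>1)" by (rule Yk[OF \<tau>])
        also have "\<dots> \<le> k powr \<tau>0 * l powr (\<tau> / \<beta>1)" using k True by (intro mult_right_mono powr_mono) auto
        finally have "622 * (KA * l powr p) * (Y powr \<tau> * z) \<le> 622 * (KA * l powr p) * ((k powr \<tau>0 * l powr (\<tau> / \<beta>1)) * z)"
          using KA0 zl by (intro mult_left_mono mult_right_mono) auto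
        also have "\<dots> = CA * (z * l powr E)" unfolding CA_def E_def by (simp add: powr_add mult_ac)
        also have "\<dots> \<le> C * (z * l powr E)" unfolding C_def using CB0 zl(2) by (intro mult_right_mono) auto
        finally show ?thesis unfolding ln\<theta> by (simp add: mult_ac)
      qed
      ultimately show ?thesis by (rule fin) (use thD(1) in auto)
    next
      case False
      define R where "R = 1 + X"
      have R: "1 \<le> R" "R \<le> k * l powr (1 / \<beta>1)" "\<bar>x0\<bar> \<le> R" unfolding R_def using X0 X1 x0 by auto
      \<comment> \<open>As |x0| \<le> X, this radius makes the window about x0 contain [-D, D],
        where thickness at the point 0 applies with bracket 1.\<close>
      define r where "r = X + D"
      have r0: "0 < r" unfolding r_def using X0 c by simp
      have rR: "r \<le> (1 + D) * R" unfolding r_def R_def using X0 c by (simp add: algebra_simps)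
      have Rk: "R powr v \<le> k powr v * l powr (v / \<beta>1)" if "0 \<le> v" for v
      proof -
        have "R powr v \<le> (k * l powr (1 / \<beta>1)) powr v" using R that by (intro powr_mono2) auto
        also have "\<dots> = k powr v * l powr (v / \<beta>1)" using k l1 by (simp add: powr_mult powr_powr)
        finally show ?thesis .
      qed
      define \<theta> where "\<theta> = \<gamma> * (D / r)"
      have Dr: "0 < D / r" "D / r \<le> 1" using c r0 X0 unfolding r_def by auto
      have \<theta>0: "0 < \<theta>" unfolding \<theta>_def by (rule mult_pos_pos[OF thD(2) Dr(1)])
      have "\<theta> \<le> \<gamma> * 1" unfolding \<theta>_def using thD Dr by (intro mult_left_mono) auto
      hence \<theta>h: "\<theta> \<le> 1 / 2" using thD by simp
      \<comment> \<open>The logarithm of r/D is bounded linearly, by X/D. This wastes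
        l^(1/\<beta>1), which \<tau> > \<tau>0 can afford, and 1 \<le> 2z supplies the factor |ln
        \<gamma>|.\<close>
      have ln\<theta>: "\<bar>ln \<theta>\<bar> \<le> z * ((3 + 2 / D) * R)"
      proof -
        have "ln \<theta> = ln \<gamma> + ln (D / r)" unfolding \<theta>_def using thD(2) Dr(1) by (rule ln_mult_pos)
        moreover have "ln (D / r) = - ln (r / D)" using c r0 by (simp add: ln_div)
        moreover have "ln (r / D) \<le> r / D - 1" using c r0 by (intro ln_le_minus_one) auto
        moreover have "ln \<theta> \<le> 0" using \<theta>0 \<theta>h by simp
        ultimately have "\<bar>ln \<theta>\<bar> \<le> z + (r / D - 1)" using zl by linarith
        also have "r / D - 1 = X / D" unfolding r_def using c by (simp add: field_simps)
        also have "X / D \<le> (2 * z) * (X / D)" using zl(2) X0 c by (intro mult_right_mono[of 1 "2 * z", simplified]) auto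
        also have "z + (2 * z) * (X / D) = z * (1 + 2 / D * X)" by (simp add: algebra_simps)
        also have "\<dots> \<le> z * ((3 + 2 / D) * R)"
        proof (rule mult_left_mono)
          define u where "u = 2 / D"
          have "0 \<le> u" unfolding u_def using c by simp
          thus "1 + 2 / D * X \<le> (3 + 2 / D) * R" unfolding R_def u_def[symmetric] using X0 by (simp add: algebra_simps)
        qed (use zl in auto)
        finally show ?thesis by simp
      qed
      have p'h: "1 / 2 \<le> p'" unfolding p'_def using c b12 by (simp add: field_simps)
      have "sqrt n2 \<le> exp (622 * (KB * l powr p') * \<bar>ln \<theta>\<bar>) * sqrt (LINT x:\<omega> \<inter> {- D..D}|lebesgue. (total x)\<^sup>2)"
        unfolding KB_def
      proof (rule scale_estimate[OF l1 c(2-4) k dB(5) order_refl p'h Vu x0(2) X0 Xk R r0])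
        show "r \<le> dB * R" using rR dB(1) R by (meson mult_right_mono order_trans zero_le_one)
        have "1 / r \<le> 1 / D" unfolding r_def using X0 c by (intro divide_left_mono) auto
        thus "1 / r \<le> dB * R powr 0" using dB(2) R by simp
        have "r * R powr (\<beta>2 / 2) \<le> (1 + D) * R * R powr (\<beta>2 / 2)" using rR by (intro mult_right_mono) auto
        also have "\<dots> = (1 + D) * R powr (1 + \<beta>2 / 2)" using R by (simp add: powr_add)
        also have "\<dots> \<le> (1 + D) * (k powr (1 + \<beta>2 / 2) * l powr ((1 + \<beta>2 / 2) / \<beta>1))"
          using c by (intro mult_left_mono Rk) auto
        also have "\<dots> = (1 + D) * k powr (1 + \<beta>2 / 2) * l powr p'" unfolding p'_def by simp
        also have "\<dots> \<le> dB * l powr p'" using dB by (intro mult_right_mono) auto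
        finally show "r * R powr (\<beta>2 / 2) \<le> dB * l powr p'" .
        have "r * l powr (1 / 2) \<le> (1 + D) * (k * l powr (1 / \<beta>1)) * l powr (1 / 2)"
          using rR R(2) c by (intro mult_right_mono) (auto intro: order_trans mult_left_mono)
        also have "\<dots> = (1 + D) * k * l powr (1 / \<beta>1 + 1 / 2)" by (simp add: powr_add)
        also have "\<dots> \<le> dB * l powr p'"
        proof (intro mult_mono powr_mono)
          show "1 / \<beta>1 + 1 / 2 \<le> p'" unfolding p'_def using c b12 by (simp add: field_simps)
        qed (use dB l1 in auto)
        finally show "r * sqrt l \<le> dB * l powr p'" using l1 by (simp add: powr_half_sqrt)
        show "\<omega> \<inter> {- D..D} \<subseteq> {x0 - r..x0 + r}" unfolding r_def using x0(1) by auto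
        have "japanese_bracket 0 = 1" unfolding japanese_bracket_def by simp
        hence "\<gamma> * (2 * D) \<le> measure lebesgue (\<omega> \<inter> {- D..D})" using thD(5)[of 0] thD(2) by simp
        moreover have "2 * \<theta> * r = \<gamma> * (2 * D)" unfolding \<theta>_def using r0 by simp
        ultimately show "2 * \<theta> * r \<le> measure lebesgue (\<omega> \<inter> {- D..D})" by simp
      qed (use thD(1) \<theta>0 \<theta>h in auto)
      moreover have "622 * (KB * l powr p') * \<bar>ln \<theta>\<bar> \<le> C * z * l powr E"
      proof -
        have "\<bar>ln \<theta>\<bar> \<le> z * ((3 + 2 / D) * (k * l powr (1 / \<beta>1)))"
          using ln\<theta> R(2) zl c by (meson add_nonneg_nonneg divide_nonneg_pos mult_left_mono order_trans zero_le_numeral half_gt_zero_iff less_le_trans less_imp_le zero_less_divide_1_iff zero_less_numeral)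
        hence "622 * (KB * l powr p') * \<bar>ln \<theta>\<bar> \<le> 622 * (KB * l powr p') * (z * ((3 + 2 / D) * (k * l powr (1 / \<beta>1))))"
          using KB0 by (intro mult_left_mono) auto
        also have "\<dots> = CB * z * l powr (p' + 1 / \<beta>1)" unfolding CB_def by (simp add: powr_add mult_ac)
        also have "\<dots> \<le> CB * z * l powr E"
        proof (intro mult_left_mono powr_mono)
          have "p' + 1 / \<beta>1 = \<tau>0 / \<beta>1" unfolding p'_def \<tau>0_def using c by (simp add: field_simps)
          also have "\<dots> \<le> \<tau> / \<beta>1" using False c by (intro divide_right_mono) auto
          finally show "p' + 1 / \<beta>1 \<le> E" unfolding E_def using p by linarith
        qed (use l1 CB0 zl(2) in auto)
        also have "\<dots> \<le> C * z * l powr E" unfolding C_def using CA0 zl(2) by (intro mult_right_mono) auto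
        finally show ?thesis .
      qed
      ultimately show ?thesis by (rule fin) (use thD(1) in auto)
    qed
    thus "(LINT x|lebesgue. (\<Sum>\<mu>\<in>M. \<psi> \<mu> x)\<^sup>2)
      \<le> (exp (C * \<bar>ln \<gamma>\<bar> * l powr (\<tau> / \<beta>1 + spectral_exponent s \<beta>1 \<beta>2)))\<^sup>2 * (LINT x:\<omega>|lebesgue. (\<Sum>\<mu>\<in>M. \<psi> \<mu> x)\<^sup>2)"
      unfolding n2_def total_def E_def z_def p_def .
  qed
qed

section \<open>The spectral subspace\<close>

context potential
begin

lemma eigen_solution_zero: "eigen_solution \<mu> (\<lambda>_. 0) (\<lambda>_. 0)"
  unfolding eigen_solution_def primitive_on_def by auto

lemma eigen_solution_add:
  assumes u: "eigen_solution \<mu> u u'" and v: "eigen_solution \<mu> v v'"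
  shows "eigen_solution \<mu> (\<lambda>x. u x + v x) (\<lambda>x. u' x + v' x)"
  unfolding eigen_solution_def
proof (intro conjI allI)
  show "((\<lambda>x. u x + v x) has_real_derivative u' x + v' x) (at x)" for x
    by (intro derivative_intros eigen_solutionD(1)[OF u] eigen_solutionD(1)[OF v])
  show "primitive_on a b (\<lambda>x. u' x + v' x) (\<lambda>x. (V x - \<mu>) * (u x + v x))" for a b
    using primitive_on_add[OF eigen_solutionD(2)[OF u] eigen_solutionD(2)[OF v]] by (simp add: distrib_left)
  have "(u x + v x)\<^sup>2 = (u x)\<^sup>2 + (v x)\<^sup>2 + 2 * (u x * v x)" for x by (simp add: power2_sum)
  thus "integrable lebesgue (\<lambda>x. (u x + v x)\<^sup>2)"
    using eigen_solutionD(3)[OF u] eigen_solutionD(3)[OF v] eigen_solution_integrable_products(1)[OF u v] by simp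
qed

lemma eigen_solution_sum:
  assumes "\<And>i. i \<in> I \<Longrightarrow> eigen_solution \<mu> (u i) (u' i)"
  shows "eigen_solution \<mu> (\<lambda>x. \<Sum>i\<in>I. u i x) (\<lambda>x. \<Sum>i\<in>I. u' i x)"
  using assms
proof (induction I rule: infinite_finite_induct)
  case (insert i I)
  thus ?case using eigen_solution_add[of \<mu> "u i" "u' i"] by simp
qed (auto intro: eigen_solution_zero)

text \<open>The form gives c |u|^2 \<le> \<mu> |u|^2 in norm, so the spectrum starts at c or above.
  This discards nonpositive eigenvalues, for which sqrt \<mu> would be meaningless, and settles the
  range l < c1.\<close>

lemma eigen_solution_eq_0:
  assumes u: "eigen_solution \<mu> u u'" and c: "0 < c" "\<And>x. c \<le> V x" "\<mu> < c"
  shows "u x = 0"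
proof -
  note I = eigen_solution_energy[OF u] and uD = eigen_solutionD[OF u]
  define S where "S = (LINT x|lebesgue. (u x)\<^sup>2)"
  define S' where "S' = (LINT x|lebesgue. (u' x)\<^sup>2)"
  have S: "0 \<le> S" "0 \<le> S'" unfolding S_def S'_def by (rule integral_nonneg_AE; simp)+
  have "c * S = (LINT x|lebesgue. c * (u x)\<^sup>2)" unfolding S_def by simp
  also have "\<dots> \<le> (LINT x|lebesgue. V x * (u x)\<^sup>2)"
    by (rule integral_mono) (use I uD(3) c in \<open>auto intro: mult_right_mono\<close>)
  finally have e: "S' + c * S \<le> \<mu> * S"
    using eigen_solution_form[OF u u] unfolding S_def S'_def by (simp add: power2_eq_square)
  hence "(c - \<mu>) * S \<le> 0" using S by (simp add: algebra_simps)
  hence "S = 0" using c S by (simp add: mult_le_0_iff)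
  moreover from this have "S' = 0" using e S by simp
  ultimately have "(u x)\<^sup>2 \<le> 0"
    using sup_bound_H1[OF uD(1) uD(6) uD(3) I(1), of x] unfolding S_def S'_def by simp
  thus ?thesis by simp
qed

text \<open>V and \<mu> are real, so the real part of any complex multiple again solves the
  equation; the coefficient c is left free so that real and imaginary parts of a linear combination
  can both be read off.\<close>

lemma schroedinger_eigen_solution:
  assumes "(f, \<lambda>x. complex_of_real \<mu> * f x) \<in> schroedinger V"
  obtains u u' where "AE x in lebesgue. f x = u x"
    "\<And>c. eigen_solution \<mu> (\<lambda>x. Re (c * u x)) (\<lambda>x. Re (c * u' x))"
proof -
  from assms obtain u u' u'' where f: "f \<in> L2" and fu: "AE x in lebesgue. f x = u x"
    and u: "\<And>x. (u has_vector_derivative u' x) (at x)"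
    and u'': "\<And>a b. a \<le> b \<Longrightarrow> (u'' has_integral (u' b - u' a)) {a..b}"
    and eq: "AE x in lebesgue. complex_of_real \<mu> * f x = - u'' x + complex_of_real (V x) * u x"
    unfolding schroedinger_def by blast
  have ae: "AE x in lebesgue. u'' x = of_real (V x - \<mu>) * u x"
    using fu eq
  proof eventually_elim
    case (elim x)
    hence "complex_of_real (V x) * u x = u'' x + complex_of_real \<mu> * u x" by simp
    thus ?case by (simp add: left_diff_distrib)
  qed
  obtain Z where Z: "{x \<in> space lebesgue. \<not> (u'' x = of_real (V x - \<mu>) * u x)} \<subseteq> Z"
      "emeasure lebesgue Z = 0" "Z \<in> sets lebesgue"
    by (rule AE_E[OF ae])
  have neg: "negligible Z" using Z(2,3) by (simp add: negligible_iff_null_sets null_setsI)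
  have Zeq: "of_real (V x - \<mu>) * u x = u'' x" if "x \<notin> Z" for x
  proof -
    have "\<not> (u'' x = of_real (V x - \<mu>) * u x) \<Longrightarrow> x \<in> Z" using Z(1) by (auto simp del: of_real_diff)
    thus ?thesis using that by metis
  qed
  have uc: "continuous_on S u" for S using u by (meson continuous_on_vector_derivative has_vector_derivative_at_within)
  show thesis
  proof (rule that[OF fu])
    fix c
    define w where "w x = Re (c * u x)" for x
    have bl: "bounded_linear (\<lambda>y. Re (c * y))"
      by (intro bounded_linear_compose[OF bounded_linear_Re] bounded_linear_mult_right)
    have wc: "continuous_on S w" for S unfolding w_def by (intro continuous_intros uc)
    have um: "(\<lambda>x. (cmod (u x))\<^sup>2) \<in> borel_measurable lebesgue" by (intro continuous_imp_borel_lebesgue continuous_intros uc)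
    have fi: "integrable lebesgue (\<lambda>x. (cmod (f x))\<^sup>2)" using f unfolding L2_def by simp
    have ui: "integrable lebesgue (\<lambda>x. (cmod (u x))\<^sup>2)"
    proof (rule integrable_cong_AE_imp[OF fi um])
      show "AE x in lebesgue. (cmod (f x))\<^sup>2 = (cmod (u x))\<^sup>2" using fu by eventually_elim simp
    qed
    have "integrable lebesgue (\<lambda>x. (w x)\<^sup>2)"
    proof (rule Bochner_Integration.integrable_bound)
      show "integrable lebesgue (\<lambda>x. (cmod c)\<^sup>2 * (cmod (u x))\<^sup>2)" using ui by simp
      show "(\<lambda>x. (w x)\<^sup>2) \<in> borel_measurable lebesgue" by (intro continuous_imp_borel_lebesgue continuous_intros wc)
      have "(w x)\<^sup>2 \<le> (cmod c)\<^sup>2 * (cmod (u x))\<^sup>2" for x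
        unfolding w_def power_mult_distrib[symmetric] norm_mult[symmetric]
        using abs_Re_le_cmod[of "c * u x"] by (simp add: abs_le_square_iff[symmetric])
      thus "AE x in lebesgue. norm ((w x)\<^sup>2) \<le> norm ((cmod c)\<^sup>2 * (cmod (u x))\<^sup>2)" by simp
    qed
    moreover have "(w has_real_derivative Re (c * u' x)) (at x)" for x
      using bounded_linear.has_vector_derivative[OF bl u[of x]]
      unfolding w_def has_real_derivative_iff_has_vector_derivative .
    moreover have "primitive_on a b (\<lambda>x. Re (c * u' x)) (\<lambda>x. (V x - \<mu>) * w x)" for a b
      unfolding primitive_on_def
    proof (intro conjI allI impI)
      fix x y :: real assume xy: "x \<le> y"
      have "((\<lambda>t. Re (c * u'' t)) has_integral (Re (c * (u' y - u' x)))) {x..y}"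
        using has_integral_linear[OF u''[OF xy] bl] by (simp add: o_def)
      moreover have "(V t - \<mu>) * w t = Re (c * u'' t)" if "t \<in> {x..y} - Z" for t
      proof -
        have "Re (c * u'' t) = Re (of_real (V t - \<mu>) * (c * u t))"
          using Zeq[of t] that by (simp add: mult.left_commute)
        thus ?thesis unfolding w_def by simp
      qed
      \<comment> \<open>The equation holds only off the null set \<open>Z\<close>; under the
        integral it can be assumed everywhere, which also yields the pointwise bound on compact
        intervals.\<close>
      ultimately have "((\<lambda>x. (V x - \<mu>) * w x) has_integral (Re (c * (u' y - u' x)))) {x..y}"
        by (rule has_integral_spike[OF neg, rotated]) 
      thus "((\<lambda>x. (V x - \<mu>) * w x) has_integral (Re (c * u' y) - Re (c * u' x))) {x..y}"
        by (simp add: right_diff_distrib)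
    next
      obtain K where K: "\<And>x. \<bar>x\<bar> \<le> max \<bar>a\<bar> \<bar>b\<bar> \<Longrightarrow> V x \<le> K" using V_bounded by blast
      have "bounded (w ` {a..b})" using wc by (simp add: compact_continuous_image compact_imp_bounded)
      then obtain L where L: "\<And>x. x \<in> {a..b} \<Longrightarrow> \<bar>w x\<bar> \<le> L" by (metis bounded_real imageI)
      have "\<bar>(V x - \<mu>) * w x\<bar> \<le> (\<bar>K\<bar> + \<bar>\<mu>\<bar>) * L" if "x \<in> {a..b}" for x
        unfolding abs_mult
      proof (rule mult_mono)
        show "\<bar>V x - \<mu>\<bar> \<le> \<bar>K\<bar> + \<bar>\<mu>\<bar>" 
        proof -
          have "\<bar>x\<bar> \<le> max \<bar>a\<bar> \<bar>b\<bar>" using that by auto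
          hence "V x \<le> K" by (rule K)
          thus ?thesis using V_nonneg[of x] by linarith
        qed
      qed (use L[OF that] in auto)
      thus "\<exists>M. \<forall>x\<in>{a..b}. \<bar>(V x - \<mu>) * w x\<bar> \<le> M" by blast
    qed
    ultimately show "eigen_solution \<mu> (\<lambda>x. Re (c * u x)) (\<lambda>x. Re (c * u' x))"
      unfolding eigen_solution_def w_def by blast
  qed
qed

text \<open>Grouping the eigenfunctions by their eigenvalue makes the members of the family orthogonal.\<close>

lemma eigen_solutions_grouped:
  fixes n :: nat
  assumes c: "0 < c" "\<And>x. c \<le> V x" and l: "0 < l"
    and w: "\<And>k. k < n \<Longrightarrow> \<mu> k \<le> l \<and> eigen_solution (\<mu> k) (w k) (w' k)"
  obtains M \<psi> \<psi>' where "spectral_family V M \<psi> \<psi>' l" "\<And>x. (\<Sum>k<n. w k x) = (\<Sum>\<nu>\<in>M. \<psi> \<nu> x)"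
proof -
  \<comment> \<open>Terms with nonpositive eigenvalue are identically 0 and are dropped, so that the
    members of \<open>M\<close> are positive.\<close>
  define K where "K = {k. k < n \<and> 0 < \<mu> k}"
  define M where "M = \<mu> ` K"
  define \<psi> where "\<psi> \<nu> x = (\<Sum>k | k \<in> K \<and> \<mu> k = \<nu>. w k x)" for \<nu> x
  define \<psi>' where "\<psi>' \<nu> x = (\<Sum>k | k \<in> K \<and> \<mu> k = \<nu>. w' k x)" for \<nu> x
  have K: "finite K" "\<And>k. k \<in> K \<Longrightarrow> k < n \<and> 0 < \<mu> k" unfolding K_def by auto
  show thesis
  proof (rule that)
    show "spectral_family V M \<psi> \<psi>' l"
    proof (unfold_locales)
      show "finite M" unfolding M_def using K by simp
      show "0 < \<nu>" "\<nu> \<le> l" if "\<nu> \<in> M" for \<nu> using that K(2) w unfolding M_def by auto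
      show "eigen_solution \<nu> (\<psi> \<nu>) (\<psi>' \<nu>)" if "\<nu> \<in> M" for \<nu>
        unfolding \<psi>_def \<psi>'_def by (rule eigen_solution_sum) (use w K(2) in auto)
      show "0 < l" by (rule l)
    qed
    fix x
    have "(\<Sum>k<n. w k x) = (\<Sum>k\<in>K. w k x)"
    proof (rule sum.mono_neutral_right)
      show "\<forall>k\<in>{..<n} - K. w k x = 0"
      proof
        fix k assume "k \<in> {..<n} - K"
        hence k: "k < n" "\<mu> k < c" using c(1) unfolding K_def by auto
        show "w k x = 0" by (rule eigen_solution_eq_0[OF _ c k(2)]) (use w[OF k(1)] in blast)
      qed
    qed (use K in auto)
    also have "\<dots> = (\<Sum>\<nu>\<in>M. \<psi> \<nu> x)"
      unfolding M_def \<psi>_def using sum.image_gen[OF K(1), of "\<lambda>k. w k x" \<mu>] by simp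
    finally show "(\<Sum>k<n. w k x) = (\<Sum>\<nu>\<in>M. \<psi> \<nu> x)" .
  qed
qed

lemma Ran_P_real_families:
  assumes c: "0 < c" "\<And>x. c \<le> V x" and l: "0 < l" and \<phi>: "\<phi> \<in> Ran_P (schroedinger V) l"
  obtains M1 \<psi>1 \<psi>1' M2 \<psi>2 \<psi>2' where "spectral_family V M1 \<psi>1 \<psi>1' l" "spectral_family V M2 \<psi>2 \<psi>2' l"
    "AE x in lebesgue. \<phi> x = Complex (\<Sum>\<mu>\<in>M1. \<psi>1 \<mu> x) (\<Sum>\<mu>\<in>M2. \<psi>2 \<mu> x)"
proof -
  obtain n :: nat and a \<mu> e where e: "\<And>k. k < n \<Longrightarrow> \<mu> k \<le> l \<and> eigenfunction (schroedinger V) (\<mu> k) (e k)"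
    and \<phi>e: "AE x in lebesgue. \<phi> x = (\<Sum>k<n. a k * e k x)"
    using \<phi> unfolding Ran_P_def by blast
  have "\<exists>u u'. (AE x in lebesgue. e k x = u x) \<and> (\<forall>c. eigen_solution (\<mu> k) (\<lambda>x. Re (c * u x)) (\<lambda>x. Re (c * u' x)))"
    if "k < n" for k
  proof -
    have "(e k, \<lambda>x. complex_of_real (\<mu> k) * e k x) \<in> schroedinger V" using e[OF that] unfolding eigenfunction_def by blast
    from schroedinger_eigen_solution[OF this] show ?thesis by metis
  qed
  then obtain u u' where ue: "\<And>k. k < n \<Longrightarrow> AE x in lebesgue. e k x = u k x"
    and us: "\<And>k c. k < n \<Longrightarrow> eigen_solution (\<mu> k) (\<lambda>x. Re (c * u k x)) (\<lambda>x. Re (c * u' k x))"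
    by metis
  obtain M1 \<psi>1 \<psi>1' where 1: "spectral_family V M1 \<psi>1 \<psi>1' l"
    "\<And>x. (\<Sum>k<n. Re (a k * u k x)) = (\<Sum>\<nu>\<in>M1. \<psi>1 \<nu> x)"
    by (rule eigen_solutions_grouped[OF c l, of n \<mu> "\<lambda>k x. Re (a k * u k x)" "\<lambda>k x. Re (a k * u' k x)"])
      (use e us in blast)+
  \<comment> \<open>Multiplication by -i turns the imaginary part into a real part.\<close>
  obtain M2 \<psi>2 \<psi>2' where 2: "spectral_family V M2 \<psi>2 \<psi>2' l"
    "\<And>x. (\<Sum>k<n. Re (- \<i> * a k * u k x)) = (\<Sum>\<nu>\<in>M2. \<psi>2 \<nu> x)"
    by (rule eigen_solutions_grouped[OF c l, of n \<mu> "\<lambda>k x. Re (- \<i> * a k * u k x)" "\<lambda>k x. Re (- \<i> * a k * u' k x)"])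
      (use e us in blast)+
  have "AE x in lebesgue. \<forall>k\<in>{..<n}. e k x = u k x" using ue by (intro AE_finite_allI) auto
  with \<phi>e have "AE x in lebesgue. \<phi> x = Complex (\<Sum>\<mu>\<in>M1. \<psi>1 \<mu> x) (\<Sum>\<mu>\<in>M2. \<psi>2 \<mu> x)"
  proof eventually_elim
    case (elim x)
    hence "\<phi> x = (\<Sum>k<n. a k * u k x)" by simp
    thus ?case unfolding 1(2)[symmetric] 2(2)[symmetric] by (simp add: complex_eq_iff)
  qed
  with 1(1) 2(1) show thesis by (rule that)
qed

end

section \<open>Passage to complex-valued functions\<close>

lemma (in spectral_family) total_integrable:
  "total \<in> borel_measurable lebesgue" "integrable lebesgue (\<lambda>x. (total x)\<^sup>2)"
  unfolding total_comb by (rule comb_measurable, rule comb_square_integral)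

text \<open>Squared norms of real and imaginary parts add up, so estimates in squared form combine
  with no loss in the constant.\<close>

lemma L2_norm_Complex_le:
  assumes t: "t1 \<in> borel_measurable lebesgue" "integrable lebesgue (\<lambda>x. (t1 x)\<^sup>2)"
      "t2 \<in> borel_measurable lebesgue" "integrable lebesgue (\<lambda>x. (t2 x)\<^sup>2)"
    and \<phi>: "AE x in lebesgue. \<phi> x = Complex (t1 x) (t2 x)"
    and \<omega>: "\<omega> \<in> sets lebesgue" and K: "0 \<le> K"
    and le: "(LINT x|lebesgue. (t1 x)\<^sup>2) \<le> K\<^sup>2 * (LINT x:\<omega>|lebesgue. (t1 x)\<^sup>2)"
      "(LINT x|lebesgue. (t2 x)\<^sup>2) \<le> K\<^sup>2 * (LINT x:\<omega>|lebesgue. (t2 x)\<^sup>2)"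
  shows "L2_norm UNIV \<phi> \<le> K * L2_norm \<omega> \<phi>"
proof -
  have sq: "AE x in lebesgue. (cmod (\<phi> x))\<^sup>2 = (t1 x)\<^sup>2 + (t2 x)\<^sup>2"
    using \<phi> by eventually_elim (simp add: cmod_def)
  have m: "(\<lambda>x. (t1 x)\<^sup>2 + (t2 x)\<^sup>2) \<in> borel_measurable lebesgue" using t by measurable
  have m': "(\<lambda>x. (cmod (\<phi> x))\<^sup>2) \<in> borel_measurable lebesgue"
    by (rule borel_measurable_AE[OF m]) (use sq in \<open>auto elim: eventually_mono\<close>)
  have I: "(LINT x:A|lebesgue. (cmod (\<phi> x))\<^sup>2) = (LINT x:A|lebesgue. (t1 x)\<^sup>2) + (LINT x:A|lebesgue. (t2 x)\<^sup>2)"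
    if A: "A \<in> sets lebesgue" for A
  proof -
    have "(LINT x:A|lebesgue. (cmod (\<phi> x))\<^sup>2) = (LINT x|lebesgue. indicator A x *\<^sub>R ((t1 x)\<^sup>2 + (t2 x)\<^sup>2))"
      unfolding set_lebesgue_integral_def
    proof (rule integral_cong_AE)
      show "AE x in lebesgue. indicator A x *\<^sub>R (cmod (\<phi> x))\<^sup>2 = indicator A x *\<^sub>R ((t1 x)\<^sup>2 + (t2 x)\<^sup>2)"
        using sq by eventually_elim simp
    qed (use A m m' in \<open>auto intro!: borel_measurable_scaleR borel_measurable_indicator\<close>)
    also have "\<dots> = (LINT x|lebesgue. indicator A x *\<^sub>R (t1 x)\<^sup>2 + indicator A x *\<^sub>R (t2 x)\<^sup>2)"
      by (simp add: distrib_left)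
    also have "\<dots> = (LINT x:A|lebesgue. (t1 x)\<^sup>2) + (LINT x:A|lebesgue. (t2 x)\<^sup>2)"
      unfolding set_lebesgue_integral_def
      by (rule Bochner_Integration.integral_add) (intro integrable_mult_indicator A t)+
    finally show ?thesis .
  qed
  have "(LINT x:UNIV|lebesgue. (cmod (\<phi> x))\<^sup>2) \<le> K\<^sup>2 * (LINT x:\<omega>|lebesgue. (cmod (\<phi> x))\<^sup>2)"
    using le unfolding I[OF \<omega>] I[of UNIV, simplified] by (simp add: set_lebesgue_integral_def algebra_simps)
  hence "sqrt (LINT x:UNIV|lebesgue. (cmod (\<phi> x))\<^sup>2) \<le> sqrt (K\<^sup>2 * (LINT x:\<omega>|lebesgue. (cmod (\<phi> x))\<^sup>2))"
    by (rule real_sqrt_le_mono)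
  also have "\<dots> = K * sqrt (LINT x:\<omega>|lebesgue. (cmod (\<phi> x))\<^sup>2)" using K by (simp add: real_sqrt_mult)
  finally show ?thesis unfolding L2_norm_def .
qed

lemma potential_of_bounds:
  assumes V: "V \<in> Linf_loc" and c: "0 < c1" "0 < c2" "0 < \<beta>1" "0 < \<beta>2"
    and VB: "\<And>x. c1 * (\<bar>x\<bar> + 1) powr \<beta>1 \<le> V x \<and> V x \<le> c2 * (\<bar>x\<bar> + 1) powr \<beta>2"
  shows "potential V" "c1 \<le> V x"
proof -
  have "1 \<le> (\<bar>x\<bar> + 1) powr \<beta>1" for x :: real using c by (intro ge_one_powr_ge_zero) auto
  hence "c1 * 1 \<le> c1 * (\<bar>x\<bar> + 1) powr \<beta>1" for x :: real using c by (intro mult_left_mono) auto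
  hence ge: "c1 \<le> V x" for x using VB[of x] by (metis mult_1_right order_trans)
  show "c1 \<le> V x" by (rule ge)
  show "potential V"
  proof
    show "V \<in> borel_measurable lebesgue" using V unfolding Linf_loc_def by simp
    show "0 \<le> V x" for x using ge[of x] c by linarith
    show "\<exists>K. \<forall>x. \<bar>x\<bar> \<le> R \<longrightarrow> V x \<le> K" for R
    proof (intro exI allI impI)
      fix x :: real assume "\<bar>x\<bar> \<le> R"
      hence "(\<bar>x\<bar> + 1) powr \<beta>2 \<le> (R + 1) powr \<beta>2" using c by (intro powr_mono2) auto
      hence "c2 * (\<bar>x\<bar> + 1) powr \<beta>2 \<le> c2 * (R + 1) powr \<beta>2" using c by (intro mult_left_mono) auto
      thus "V x \<le> c2 * (R + 1) powr \<beta>2" using VB[of x] by linarith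
    qed
  qed
qed

section \<open>Exponents and constants of the theorem\<close>

lemma spectral_exponent_large:
  assumes "0 < \<beta>1" "(\<beta>1 - \<beta>2) / 2 \<le> s"
  shows "\<tau> / \<beta>1 + spectral_exponent s \<beta>1 \<beta>2 = \<tau> / \<beta>1 + s / \<beta>1 + \<beta>2 / (2 * \<beta>1)"
proof -
  have "1 / 2 \<le> (s + \<beta>2 / 2) / \<beta>1" using assms by (simp add: field_simps)
  thus ?thesis unfolding spectral_exponent_def using assms by (simp add: max_def add_divide_distrib)
qed

lemma spectral_exponent_small:
  assumes "0 < \<beta>1" "s < (\<beta>1 - \<beta>2) / 2"
  shows "\<tau> / \<beta>1 + spectral_exponent s \<beta>1 \<beta>2 = \<tau> / \<beta>1 + 1 / 2"
proof -
  have "(s + \<beta>2 / 2) / \<beta>1 \<le> 1 / 2" using assms by (simp add: field_simps)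
  thus ?thesis unfolding spectral_exponent_def by (simp add: max_def)
qed

text \<open>Two constants appear because \<open>l powr E\<close> with l < 1 becomes small as \<tau>
  grows: \<open>C\<^sub>0\<close> is independent of \<tau> and serves l \<ge> 1, while
  \<open>C\<^sub>1\<close> serves every l > 0 and may depend on \<tau>. Both are fixed before
  \<gamma>, V and \<omega>.\<close>

theorem theorem2:
  fixes c\<^sub>1 c\<^sub>2 \<beta>\<^sub>1 \<beta>\<^sub>2 s D :: real
  assumes "c\<^sub>1 > 0" "c\<^sub>2 > 0" "\<beta>\<^sub>1 > 0" "\<beta>\<^sub>2 > 0" "D > 0"
  shows "\<exists>C\<^sub>0>0. \<forall>\<tau>\<ge>0. \<exists>C\<^sub>1>0. \<forall>\<gamma> V \<omega>.
    V \<in> Linf_loc \<longrightarrow>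
    (\<forall>x. c\<^sub>1 * (\<bar>x\<bar> + 1) powr \<beta>\<^sub>1 \<le> V x \<and> V x \<le> c\<^sub>2 * (\<bar>x\<bar> + 1) powr \<beta>\<^sub>2) \<longrightarrow>
    thick s \<tau> \<gamma> D \<omega> \<longrightarrow>
    (\<forall>C l. l > 0 \<longrightarrow> C = C\<^sub>1 * \<bar>ln \<gamma>\<bar> \<or> (C = C\<^sub>0 * \<bar>ln \<gamma>\<bar> \<and> l \<ge> 1) \<longrightarrow>
      ((\<beta>\<^sub>1 - \<beta>\<^sub>2) / 2 \<le> s \<and> s < 1 \<longrightarrow>
        (\<forall>\<phi> \<in> Ran_P (schroedinger V) l.
          L2_norm UNIV \<phi> \<le> exp (C * l powr (\<tau> / \<beta>\<^sub>1 + s / \<beta>\<^sub>1 + \<beta>\<^sub>2 / (2 * \<beta>\<^sub>1))) * L2_norm \<omega> \<phi>)) \<and>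
      (s = 1 \<and> \<tau> = 0 \<longrightarrow>
        (\<forall>\<phi> \<in> Ran_P (schroedinger V) l.
          L2_norm UNIV \<phi> \<le> exp (C * l powr (\<tau> / \<beta>\<^sub>1 + s / \<beta>\<^sub>1 + \<beta>\<^sub>2 / (2 * \<beta>\<^sub>1))) * L2_norm \<omega> \<phi>)) \<and>
      (s < (\<beta>\<^sub>1 - \<beta>\<^sub>2) / 2 \<longrightarrow>
        (\<forall>\<phi> \<in> Ran_P (schroedinger V) l.
          L2_norm UNIV \<phi> \<le> exp (C * l powr (\<tau> / \<beta>\<^sub>1 + 1 / 2)) * L2_norm \<omega> \<phi>)))"
proof (cases "s \<le> 1")
  case s: True
  note c = assms
  obtain C where C: "0 < C" "\<And>\<tau> \<gamma> V \<omega> M \<psi> \<psi>' l. 0 \<le> \<tau> \<Longrightarrow>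
    (\<And>x. c\<^sub>1 * (\<bar>x\<bar> + 1) powr \<beta>\<^sub>1 \<le> V x \<and> V x \<le> c\<^sub>2 * (\<bar>x\<bar> + 1) powr \<beta>\<^sub>2) \<Longrightarrow>
    thick s \<tau> \<gamma> D \<omega> \<Longrightarrow> spectral_family V M \<psi> \<psi>' l \<Longrightarrow> 1 \<le> l \<Longrightarrow>
    (LINT x|lebesgue. (\<Sum>\<mu>\<in>M. \<psi> \<mu> x)\<^sup>2)
      \<le> (exp (C * \<bar>ln \<gamma>\<bar> * l powr (\<tau> / \<beta>\<^sub>1 + spectral_exponent s \<beta>\<^sub>1 \<beta>\<^sub>2)))\<^sup>2 * (LINT x:\<omega>|lebesgue. (\<Sum>\<mu>\<in>M. \<psi> \<mu> x)\<^sup>2)"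
    using real_spectral_inequality[OF c s] by blast
  show ?thesis
  proof (rule exI[of _ C], intro conjI allI impI)
    show "0 < C" by (rule C)
    fix \<tau> :: real assume \<tau>: "0 \<le> \<tau>"
    define E where "E = \<tau> / \<beta>\<^sub>1 + spectral_exponent s \<beta>\<^sub>1 \<beta>\<^sub>2"
    have E0: "0 \<le> E" unfolding E_def spectral_exponent_def using \<tau> c by (intro add_nonneg_nonneg) (auto simp: max_def)
    \<comment> \<open>For l < c1 the spectral subspace is trivial; for c1 \<le> l < 1 the factor
      c1^(-E) compensates for the decay of l^E, which is at least c1^E.\<close>
    define C\<^sub>1 where "C\<^sub>1 = C * max 1 (c\<^sub>1 powr - E)"
    have C1: "0 < C\<^sub>1" "C \<le> C\<^sub>1"
    proof -
      have "C * 1 \<le> C * max 1 (c\<^sub>1 powr - E)" using C by (intro mult_left_mono) auto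
      thus "C \<le> C\<^sub>1" "0 < C\<^sub>1" using C unfolding C\<^sub>1_def by auto
    qed
    have main: "L2_norm UNIV \<phi> \<le> exp (K * l powr E) * L2_norm \<omega> \<phi>"
      if V: "V \<in> Linf_loc" and VB: "\<forall>x. c\<^sub>1 * (\<bar>x\<bar> + 1) powr \<beta>\<^sub>1 \<le> V x \<and> V x \<le> c\<^sub>2 * (\<bar>x\<bar> + 1) powr \<beta>\<^sub>2"
        and th: "thick s \<tau> \<gamma> D \<omega>" and l: "0 < l"
        and K: "K = C\<^sub>1 * \<bar>ln \<gamma>\<bar> \<or> (K = C * \<bar>ln \<gamma>\<bar> \<and> 1 \<le> l)"
        and \<phi>: "\<phi> \<in> Ran_P (schroedinger V) l" for V \<gamma> \<omega> K l \<phi>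
    proof -
      have VB': "c\<^sub>1 * (\<bar>x\<bar> + 1) powr \<beta>\<^sub>1 \<le> V x \<and> V x \<le> c\<^sub>2 * (\<bar>x\<bar> + 1) powr \<beta>\<^sub>2" for x using VB by blast
      interpret potential V by (rule potential_of_bounds(1)[OF V c(1-4) VB'])
      have Vc: "c\<^sub>1 \<le> V x" for x by (rule potential_of_bounds(2)[OF V c(1-4) VB'])
      \<comment> \<open>Raising the spectral bound to 1 keeps the family admissible and brings it
        into the range of the real inequality.\<close>
      define l' where "l' = max 1 l"
      have l': "1 \<le> l'" "0 < l'" "l \<le> l'" unfolding l'_def by auto
      obtain M1 \<psi>1 \<psi>1' M2 \<psi>2 \<psi>2' where sf: "spectral_family V M1 \<psi>1 \<psi>1' l" "spectral_family V M2 \<psi>2 \<psi>2' l"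
        and \<phi>M: "AE x in lebesgue. \<phi> x = Complex (\<Sum>\<mu>\<in>M1. \<psi>1 \<mu> x) (\<Sum>\<mu>\<in>M2. \<psi>2 \<mu> x)"
        by (rule Ran_P_real_families[OF c(1) Vc l \<phi>])
      interpret f1: spectral_family V M1 \<psi>1 \<psi>1' l by (rule sf)
      interpret f2: spectral_family V M2 \<psi>2 \<psi>2' l by (rule sf)
      note ti = f1.total_integrable[unfolded f1.total_def] f2.total_integrable[unfolded f2.total_def]
      have est: "(LINT x|lebesgue. (\<Sum>\<mu>\<in>M. \<psi> \<mu> x)\<^sup>2) \<le> (exp (K * l powr E))\<^sup>2 * (LINT x:\<omega>|lebesgue. (\<Sum>\<mu>\<in>M. \<psi> \<mu> x)\<^sup>2)"
        if f: "spectral_family V M \<psi> \<psi>' l" for M \<psi> \<psi>'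
      proof -
        interpret f: spectral_family V M \<psi> \<psi>' l by (rule f)
        have I0: "0 \<le> (LINT x:\<omega>|lebesgue. (\<Sum>\<mu>\<in>M. \<psi> \<mu> x)\<^sup>2)"
          unfolding set_lebesgue_integral_def by (rule integral_nonneg_AE) auto
        show ?thesis
        proof (cases "l < c\<^sub>1")
          case True
          have "\<psi> \<mu> x = 0" if "\<mu> \<in> M" for \<mu> x
            by (rule eigen_solution_eq_0[OF f.\<psi>[OF that] c(1) Vc]) (use f.M(3)[OF that] True in simp)
          hence "(\<Sum>\<mu>\<in>M. \<psi> \<mu> x) = 0" for x by simp
          thus ?thesis by (simp add: set_lebesgue_integral_def)
        next
          case cl: False
          have "spectral_family V M \<psi> \<psi>' l'"
            by unfold_locales (use f.M f.\<psi> l' in \<open>auto intro: order_trans\<close>)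
          from C(2)[OF \<tau> VB' th this l'(1), folded E_def]
          have "(LINT x|lebesgue. (\<Sum>\<mu>\<in>M. \<psi> \<mu> x)\<^sup>2)
            \<le> (exp (C * \<bar>ln \<gamma>\<bar> * l' powr E))\<^sup>2 * (LINT x:\<omega>|lebesgue. (\<Sum>\<mu>\<in>M. \<psi> \<mu> x)\<^sup>2)" .
          also have "\<dots> \<le> (exp (K * l powr E))\<^sup>2 * (LINT x:\<omega>|lebesgue. (\<Sum>\<mu>\<in>M. \<psi> \<mu> x)\<^sup>2)"
          proof (intro mult_right_mono power_mono I0)
            have "C * l' powr E \<le> C\<^sub>1 * l powr E"
            proof (cases "1 \<le> l")
              case True
              thus ?thesis using C1 unfolding l'_def by (intro mult_mono) auto
            next
              case False
              have "1 = c\<^sub>1 powr - E * c\<^sub>1 powr E" using c by (simp add: powr_add[symmetric])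
              also have "\<dots> \<le> max 1 (c\<^sub>1 powr - E) * l powr E"
                using cl c E0 by (intro mult_mono powr_mono2) auto
              finally have "C * 1 \<le> C * (max 1 (c\<^sub>1 powr - E) * l powr E)" using C by (intro mult_left_mono) auto
              thus ?thesis using False unfolding l'_def C\<^sub>1_def by (simp add: mult.assoc)
            qed
            hence "\<bar>ln \<gamma>\<bar> * (C * l' powr E) \<le> \<bar>ln \<gamma>\<bar> * (C\<^sub>1 * l powr E)" by (intro mult_left_mono) auto
            hence "C * \<bar>ln \<gamma>\<bar> * l' powr E \<le> K * l powr E" if "K = C\<^sub>1 * \<bar>ln \<gamma>\<bar>" using that by (simp add: mult_ac)
            moreover have "C * \<bar>ln \<gamma>\<bar> * l' powr E \<le> K * l powr E" if "K = C * \<bar>ln \<gamma>\<bar> \<and> 1 \<le> l"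
              using that unfolding l'_def by simp
            ultimately show "exp (C * \<bar>ln \<gamma>\<bar> * l' powr E) \<le> exp (K * l powr E)" using K by auto
          qed auto
          finally show ?thesis .
        qed
      qed
      show ?thesis
        by (rule L2_norm_Complex_le[OF ti \<phi>M thickD(1)[OF th] exp_ge_zero est[OF sf(1)] est[OF sf(2)]])
    qed
    show "\<exists>C\<^sub>1>0. \<forall>\<gamma> V \<omega>.
      V \<in> Linf_loc \<longrightarrow>
      (\<forall>x. c\<^sub>1 * (\<bar>x\<bar> + 1) powr \<beta>\<^sub>1 \<le> V x \<and> V x \<le> c\<^sub>2 * (\<bar>x\<bar> + 1) powr \<beta>\<^sub>2) \<longrightarrow>
      thick s \<tau> \<gamma> D \<omega> \<longrightarrow>
      (\<forall>K l. l > 0 \<longrightarrow> K = C\<^sub>1 * \<bar>ln \<gamma>\<bar> \<or> (K = C * \<bar>ln \<gamma>\<bar> \<and> l \<ge> 1) \<longrightarrow>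
        ((\<beta>\<^sub>1 - \<beta>\<^sub>2) / 2 \<le> s \<and> s < 1 \<longrightarrow>
          (\<forall>\<phi> \<in> Ran_P (schroedinger V) l.
            L2_norm UNIV \<phi> \<le> exp (K * l powr (\<tau> / \<beta>\<^sub>1 + s / \<beta>\<^sub>1 + \<beta>\<^sub>2 / (2 * \<beta>\<^sub>1))) * L2_norm \<omega> \<phi>)) \<and>
        (s = 1 \<and> \<tau> = 0 \<longrightarrow>
          (\<forall>\<phi> \<in> Ran_P (schroedinger V) l.
            L2_norm UNIV \<phi> \<le> exp (K * l powr (\<tau> / \<beta>\<^sub>1 + s / \<beta>\<^sub>1 + \<beta>\<^sub>2 / (2 * \<beta>\<^sub>1))) * L2_norm \<omega> \<phi>)) \<and>
        (s < (\<beta>\<^sub>1 - \<beta>\<^sub>2) / 2 \<longrightarrow>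
          (\<forall>\<phi> \<in> Ran_P (schroedinger V) l.
            L2_norm UNIV \<phi> \<le> exp (K * l powr (\<tau> / \<beta>\<^sub>1 + 1 / 2)) * L2_norm \<omega> \<phi>)))"
    proof (rule exI[of _ C\<^sub>1], intro conjI allI impI ballI)
      show "0 < C\<^sub>1" by (rule C1)
    next
      fix \<gamma> V \<omega> K l \<phi>
      assume h: "V \<in> Linf_loc" "\<forall>x. c\<^sub>1 * (\<bar>x\<bar> + 1) powr \<beta>\<^sub>1 \<le> V x \<and> V x \<le> c\<^sub>2 * (\<bar>x\<bar> + 1) powr \<beta>\<^sub>2"
        "thick s \<tau> \<gamma> D \<omega>" "0 < l" "K = C\<^sub>1 * \<bar>ln \<gamma>\<bar> \<or> K = C * \<bar>ln \<gamma>\<bar> \<and> 1 \<le> l" "\<phi> \<in> Ran_P (schroedinger V) l"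
      assume "(\<beta>\<^sub>1 - \<beta>\<^sub>2) / 2 \<le> s \<and> s < 1"
      hence "E = \<tau> / \<beta>\<^sub>1 + s / \<beta>\<^sub>1 + \<beta>\<^sub>2 / (2 * \<beta>\<^sub>1)"
        unfolding E_def using c by (intro spectral_exponent_large) auto
      thus "L2_norm UNIV \<phi> \<le> exp (K * l powr (\<tau> / \<beta>\<^sub>1 + s / \<beta>\<^sub>1 + \<beta>\<^sub>2 / (2 * \<beta>\<^sub>1))) * L2_norm \<omega> \<phi>"
        using main[OF h] by simp
    next
      fix \<gamma> V \<omega> K l \<phi>
      assume h: "V \<in> Linf_loc" "\<forall>x. c\<^sub>1 * (\<bar>x\<bar> + 1) powr \<beta>\<^sub>1 \<le> V x \<and> V x \<le> c\<^sub>2 * (\<bar>x\<bar> + 1) powr \<beta>\<^sub>2"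
        "thick s \<tau> \<gamma> D \<omega>" "0 < l" "K = C\<^sub>1 * \<bar>ln \<gamma>\<bar> \<or> K = C * \<bar>ln \<gamma>\<bar> \<and> 1 \<le> l" "\<phi> \<in> Ran_P (schroedinger V) l"
      assume s1: "s = 1 \<and> \<tau> = 0"
      have "\<beta>\<^sub>1 \<le> \<beta>\<^sub>2" by (rule potential_exponents_le[OF c(1-4)]) (use h(2) in blast)
      hence "E = \<tau> / \<beta>\<^sub>1 + s / \<beta>\<^sub>1 + \<beta>\<^sub>2 / (2 * \<beta>\<^sub>1)"
        unfolding E_def using s1 c by (intro spectral_exponent_large) auto
      thus "L2_norm UNIV \<phi> \<le> exp (K * l powr (\<tau> / \<beta>\<^sub>1 + s / \<beta>\<^sub>1 + \<beta>\<^sub>2 / (2 * \<beta>\<^sub>1))) * L2_norm \<omega> \<phi>"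
        using main[OF h] by simp
    next
      fix \<gamma> V \<omega> K l \<phi>
      assume h: "V \<in> Linf_loc" "\<forall>x. c\<^sub>1 * (\<bar>x\<bar> + 1) powr \<beta>\<^sub>1 \<le> V x \<and> V x \<le> c\<^sub>2 * (\<bar>x\<bar> + 1) powr \<beta>\<^sub>2"
        "thick s \<tau> \<gamma> D \<omega>" "0 < l" "K = C\<^sub>1 * \<bar>ln \<gamma>\<bar> \<or> K = C * \<bar>ln \<gamma>\<bar> \<and> 1 \<le> l" "\<phi> \<in> Ran_P (schroedinger V) l"
      assume "s < (\<beta>\<^sub>1 - \<beta>\<^sub>2) / 2"
      hence "E = \<tau> / \<beta>\<^sub>1 + 1 / 2"
        unfolding E_def using c by (intro spectral_exponent_small) auto
      thus "L2_norm UNIV \<phi> \<le> exp (K * l powr (\<tau> / \<beta>\<^sub>1 + 1 / 2)) * L2_norm \<omega> \<phi>"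
        using main[OF h] by simp
    qed
  qed
next
  case s: False
  \<comment> \<open>For s > 1 all three cases are void; for (iii) this uses that a potential with
    these bounds forces \<open>\<beta>\<^sub>1 \<le> \<beta>\<^sub>2\<close>.\<close>
  have "\<not> s < (\<beta>\<^sub>1 - \<beta>\<^sub>2) / 2"
    if "\<forall>x. c\<^sub>1 * (\<bar>x\<bar> + 1) powr \<beta>\<^sub>1 \<le> V x \<and> V x \<le> c\<^sub>2 * (\<bar>x\<bar> + 1) powr \<beta>\<^sub>2" for V :: "real \<Rightarrow> real"
  proof -
    have "\<beta>\<^sub>1 \<le> \<beta>\<^sub>2" by (rule potential_exponents_le[OF assms(1-4)]) (use that in blast)
    thus ?thesis using s by simp
  qed
  with s show ?thesis by (intro exI[of _ 1] conjI allI impI) auto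
qed

end
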